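(* Let $\Omega\subset\mathbb{R}^n$ and $(T_\varepsilon)_{\varepsilon\in(-\varepsilon_0,\varepsilon_0)}$ be as in the context, and let $H$ be either $H^1(\Omega)$ (homogeneous Neumann case) or $H^1_0(\Omega)$ (homogeneous Dirichlet case). Let $\lambda_0$ be algebraically simple and, for $\varepsilon\in(-\varepsilon_0,\varepsilon_0)$, let $(\lambda_\varepsilon,u_\varepsilon)\in\mathbb{R}\times H$ be an eigenpair of the dynamic Laplacian $\Delta^D_\varepsilon$, with $\|u_\varepsilon\|=1$. Let $V_0:=\{v\in H:\langle v,u_0\rangle=0\}$, and let $\dot u_0\in V_0$ and $\dot\lambda_0\in\mathbb{R}$ be the linear responses, i.e. $\lim_{\varepsilon\to0}\left\|\frac{u_\varepsilon-u_0}{\varepsilon}-\dot u_0\right\|_H=0$ and $\lim_{\varepsilon\to0}\left|\frac{\lambda_\varepsilon-\lambda_0}{\varepsilon}-\dot\lambda_0\right|=0$. Then $(\dot u_0,\dot\lambda_0)\in V_0\times\mathbb{R}$ is the unique solution of the equations $$a_0(\dot u_0,\varphi)-\lambda_0\langle\dot u_0,\varphi\rangle=-\left(\dot a_0(u_0,\varphi)-\dot\lambda_0\langle u_0,\varphi\rangle\right)\quad\text{for all }\varphi\in V_0$$ and $$\dot\lambda_0=\frac{\dot a_0(u_0,u_0)}{\|u_0\|^2}.$$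
   Context: Standing setting. $\Omega\subset\mathbb{R}^n$ is a compact, connected domain with smooth boundary. For $\varepsilon\in(-\varepsilon_0,\varepsilon_0)$, $T_\varepsilon:\Omega\to T_\varepsilon(\Omega)\subset\mathbb{R}^n$ is a volume-preserving $C^2$-diffeomorphism onto its image, and $\varepsilon\mapsto T_\varepsilon$ is $C^1$ with respect to the $C^2(\Omega,\mathbb{R}^n)$-norm; $\dot T_0$ denotes its derivative at $\varepsilon=0$. All functions are real-valued, $\ell$ is Lebesgue measure, and $\|\cdot\|$, $\langle\cdot,\cdot\rangle$ are the norm and inner product of $L^2(\Omega,\ell)$. Dynamic Laplacian. Put $A_\varepsilon:=\frac12\left(I+(DT_\varepsilon^\top DT_\varepsilon)^{-1}\right)$. The dynamic Laplacian is $\Delta^D_\varepsilon u:=\frac12\left(\Delta u+\left(\Delta (u\circ T_\varepsilon^{-1})\right)\circ T_\varepsilon\right)=\mathrm{div}(A_\varepsilon\nabla u)$, with homogeneous Neumann ($\nabla u\cdot A_\varepsilon\nu=0$ on $\partial\Omega$, $\nu$ the outer normal) or Dirichlet ($u=0$ on $\partial\Omega$) boundary conditions, understood in weak form: with $a_\varepsilon(u,\varphi):=\int_\Omega A_\varepsilon\nabla u\cdot\nabla\varphi\,d\ell$, an eigenpair of $\Delta^D_\varepsilon$ is a pair $(\lambda,u)\in\mathbb{R}\times H$, $u\neq0$, with $-a_\varepsilon(u,\varphi)=\lambda\langle u,\varphi\rangle$ for all $\varphi\in H$, where $H=H^1(\Omega)$ (Neumann) or $H=H^1_0(\Omega)$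 (Dirichlet). It is assumed throughout that all eigenvalues of $\Delta^D_\varepsilon$ are algebraically simple. Derivative form. $\dot A_0:=-\left((DT_0)^{-1}(D\dot T_0)(DT_0)^{-1}(DT_0)^{-\top}\right)^{\mathrm{sym}}$, where $Q^{\mathrm{sym}}=\frac12(Q+Q^\top)$, and $\dot a_0(\psi,\varphi):=\int_\Omega\dot A_0\nabla\psi\cdot\nabla\varphi\,d\ell$ for $\psi,\varphi\in H$.
   Formalization: With the convention −a(u,φ)=λ⟨u,φ⟩ the displayed equations have the wrong sign of λ₀ and λ̇₀; the proved ones are a₀(u̇₀,φ)+λ₀⟨u̇₀,φ⟩=−(ȧ₀(u₀,φ)+λ̇₀⟨u₀,φ⟩) and λ̇₀=−ȧ₀(u₀,u₀)/‖u₀‖². *)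

theory Defs
  imports "HOL-Analysis.Analysis"
begin

section \<open>Functions of class \<open>C\<^sup>k\<close> and smoothly bounded domains\<close>

text \<open>
  The derivative is taken within \<open>S\<close>. The predicate is only meant for sets on which this derivative
  is unique: open sets, and compact domains with regular boundary (and their diffeomorphic images),
  where it describes the \<open>C\<^sup>k\<close> functions whose derivatives extend continuously up to the boundary.
  Continuity of the derivative is expressed through the directional derivatives, which is
  the same thing in finite dimension.
\<close>

primrec Ck_on :: "nat \<Rightarrow> ('a::euclidean_space \<Rightarrow> 'b::real_normed_vector) \<Rightarrow> 'a set \<Rightarrow> bool" where
  "Ck_on 0 f S = continuous_on S f"
| "Ck_on (Suc k) f S =
    (f differentiable_on S \<and> (\<forall>v. Ck_on k (\<lambda>x. frechet_derivative f (at x within S) v) S))"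

definition smooth_on :: "('a::euclidean_space \<Rightarrow> 'b::real_normed_vector) \<Rightarrow> 'a set \<Rightarrow> bool" where
  "smooth_on f S \<longleftrightarrow> (\<forall>k. Ck_on k f S)"

definition smooth_compact_domain :: "'a::euclidean_space set \<Rightarrow> bool" where
  "smooth_compact_domain \<Omega> \<longleftrightarrow> \<Omega> \<noteq> {} \<and> compact \<Omega> \<and> connected \<Omega> \<and>
    (\<forall>p\<in>frontier \<Omega>. \<exists>U (\<rho> :: 'a \<Rightarrow> real). open U \<and> p \<in> U \<and> smooth_on \<rho> U \<and>
       frechet_derivative \<rho> (at p) \<noteq> (\<lambda>_. 0) \<and> \<Omega> \<inter> U = {x\<in>U. \<rho> x \<le> 0})"

section \<open>Families of volume-preserving diffeomorphisms\<close>

definition C2_norm :: "(real^'n) set \<Rightarrow> (real^'n \<Rightarrow> real^'n) \<Rightarrow> real" where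
  "C2_norm \<Omega> f = (SUP x\<in>\<Omega>. norm (f x)) + (SUP x\<in>\<Omega>. norm (jacobian f (at x within \<Omega>))) +
     (SUP x\<in>\<Omega>. onorm (frechet_derivative (\<lambda>y. jacobian f (at y within \<Omega>)) (at x within \<Omega>)))"

definition C2_diffeo_onto_image :: "(real^'n) set \<Rightarrow> (real^'n \<Rightarrow> real^'n) \<Rightarrow> bool" where
  "C2_diffeo_onto_image \<Omega> f \<longleftrightarrow>
     inj_on f \<Omega> \<and> Ck_on 2 f \<Omega> \<and> Ck_on 2 (inv_into \<Omega> f) (f ` \<Omega>)"

definition volume_preserving_on :: "(real^'n) set \<Rightarrow> (real^'n \<Rightarrow> real^'n) \<Rightarrow> bool" where
  "volume_preserving_on \<Omega> f \<longleftrightarrow>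
     (\<forall>B\<in>sets lebesgue. B \<subseteq> \<Omega> \<longrightarrow>
        f ` B \<in> sets lebesgue \<and> emeasure lebesgue (f ` B) = emeasure lebesgue B)"

text \<open>
  \<open>\<epsilon> \<mapsto> T \<epsilon>\<close> is a \<open>C\<^sup>1\<close> curve, with derivative \<open>T' \<epsilon>\<close>, in the Banach space of \<open>C\<^sup>2\<close> maps on \<open>\<Omega>\<close>.
\<close>

definition C1_family_in_C2 ::
  "real \<Rightarrow> (real^'n) set \<Rightarrow> (real \<Rightarrow> real^'n \<Rightarrow> real^'n) \<Rightarrow> (real \<Rightarrow> real^'n \<Rightarrow> real^'n) \<Rightarrow> bool" where
  "C1_family_in_C2 \<epsilon>0 \<Omega> T T' \<longleftrightarrow>
     (\<forall>\<epsilon>\<in>{-\<epsilon>0<..<\<epsilon>0}.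
        Ck_on 2 (T \<epsilon>) \<Omega> \<and> Ck_on 2 (T' \<epsilon>) \<Omega> \<and>
        ((\<lambda>h. C2_norm \<Omega> (\<lambda>x. (1 / h) *\<^sub>R (T (\<epsilon> + h) x - T \<epsilon> x) - T' \<epsilon> x)) \<longlongrightarrow> 0) (at 0) \<and>
        ((\<lambda>\<delta>. C2_norm \<Omega> (\<lambda>x. T' \<delta> x - T' \<epsilon> x)) \<longlongrightarrow> 0) (at \<epsilon>))"

section \<open>Lebesgue and Sobolev spaces\<close>

text \<open>
  Elements of these spaces are functions, not classes modulo equality almost everywhere; identities
  between elements are therefore stated almost everywhere on \<open>\<Omega>\<close>. Weak derivatives are taken in the
  interior of \<open>\<Omega>\<close>; the boundary of a smoothly bounded domain is a null set.
\<close>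

definition L2 :: "(real^'n) set \<Rightarrow> (real^'n \<Rightarrow> 'b::euclidean_space) set" where
  "L2 \<Omega> = {u \<in> borel_measurable (lebesgue_on \<Omega>). integrable (lebesgue_on \<Omega>) (\<lambda>x. (norm (u x))\<^sup>2)}"

definition L2_inner :: "(real^'n) set \<Rightarrow> (real^'n \<Rightarrow> real) \<Rightarrow> (real^'n \<Rightarrow> real) \<Rightarrow> real" where
  "L2_inner \<Omega> u v = (LINT x|lebesgue_on \<Omega>. u x * v x)"

definition L2_norm :: "(real^'n) set \<Rightarrow> (real^'n \<Rightarrow> real) \<Rightarrow> real" where
  "L2_norm \<Omega> u = sqrt (L2_inner \<Omega> u u)"

definition test_function :: "(real^'n) set \<Rightarrow> (real^'n \<Rightarrow> real) \<Rightarrow> bool" where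
  "test_function \<Omega> \<phi> \<longleftrightarrow> smooth_on \<phi> UNIV \<and>
     compact (closure {x. \<phi> x \<noteq> 0}) \<and> closure {x. \<phi> x \<noteq> 0} \<subseteq> interior \<Omega>"

definition weak_gradient :: "(real^'n) set \<Rightarrow> (real^'n \<Rightarrow> real) \<Rightarrow> (real^'n \<Rightarrow> real^'n) \<Rightarrow> bool" where
  "weak_gradient \<Omega> u g \<longleftrightarrow>
     (\<forall>\<phi> i. test_function \<Omega> \<phi> \<longrightarrow>
        (LINT x|lebesgue_on \<Omega>. u x * frechet_derivative \<phi> (at x) (axis i 1)) =
        - (LINT x|lebesgue_on \<Omega>. g x $ i * \<phi> x))"

definition H1 :: "(real^'n) set \<Rightarrow> (real^'n \<Rightarrow> real) set" where
  "H1 \<Omega> = {u \<in> L2 \<Omega>. \<exists>g\<in>L2 \<Omega>. weak_gradient \<Omega> u g}"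

definition wgrad :: "(real^'n) set \<Rightarrow> (real^'n \<Rightarrow> real) \<Rightarrow> real^'n \<Rightarrow> real^'n" where
  "wgrad \<Omega> u = (SOME g. g \<in> L2 \<Omega> \<and> weak_gradient \<Omega> u g)"

definition H1_norm :: "(real^'n) set \<Rightarrow> (real^'n \<Rightarrow> real) \<Rightarrow> real" where
  "H1_norm \<Omega> u = sqrt ((LINT x|lebesgue_on \<Omega>. (u x)\<^sup>2) +
                        (LINT x|lebesgue_on \<Omega>. (norm (wgrad \<Omega> u x))\<^sup>2))"

definition H1_0 :: "(real^'n) set \<Rightarrow> (real^'n \<Rightarrow> real) set" where
  "H1_0 \<Omega> = {u \<in> H1 \<Omega>. \<forall>e>0. \<exists>\<phi>. test_function \<Omega> \<phi> \<and> H1_norm \<Omega> (\<lambda>x. u x - \<phi> x) < e}"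

section \<open>The dynamic Laplacian\<close>

definition dyn_matrix :: "(real^'n) set \<Rightarrow> (real^'n \<Rightarrow> real^'n) \<Rightarrow> real^'n \<Rightarrow> real^'n^'n" where
  "dyn_matrix \<Omega> T x =
     (let J = jacobian T (at x within \<Omega>)
      in (1 / 2) *\<^sub>R (mat 1 + matrix_inv (transpose J ** J)))"

definition sym_part :: "real^'n^'n \<Rightarrow> real^'n^'n" where
  "sym_part Q = (1 / 2) *\<^sub>R (Q + transpose Q)"

definition dyn_matrix_dot ::
  "(real^'n) set \<Rightarrow> (real^'n \<Rightarrow> real^'n) \<Rightarrow> (real^'n \<Rightarrow> real^'n) \<Rightarrow> real^'n \<Rightarrow> real^'n^'n" where
  "dyn_matrix_dot \<Omega> T T' x =
     (let J = jacobian T (at x within \<Omega>); J' = jacobian T' (at x within \<Omega>)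
      in - sym_part (matrix_inv J ** J' ** matrix_inv J ** transpose (matrix_inv J)))"

definition grad_form ::
  "(real^'n) set \<Rightarrow> (real^'n \<Rightarrow> real^'n^'n) \<Rightarrow> (real^'n \<Rightarrow> real) \<Rightarrow> (real^'n \<Rightarrow> real) \<Rightarrow> real" where
  "grad_form \<Omega> A u \<phi> = (LINT x|lebesgue_on \<Omega>. (A x *v wgrad \<Omega> u x) \<bullet> wgrad \<Omega> \<phi> x)"

text \<open>
  In the following, \<open>H\<close> is \<open>H1 \<Omega>\<close> for the Neumann and \<open>H1_0 \<Omega>\<close> for the Dirichlet condition.
  \<open>eigenpair\<close> is the weak form of \<open>div (A \<nabla>u) = lam u\<close>, so that \<open>lam \<le> 0\<close> for positive definite \<open>A\<close>.
\<close>

definition eigenpair ::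
  "(real^'n) set \<Rightarrow> (real^'n \<Rightarrow> real) set \<Rightarrow> (real^'n \<Rightarrow> real^'n^'n) \<Rightarrow> real \<Rightarrow> (real^'n \<Rightarrow> real) \<Rightarrow> bool" where
  "eigenpair \<Omega> H A lam u \<longleftrightarrow> u \<in> H \<and> \<not> (AE x in lebesgue_on \<Omega>. u x = 0) \<and>
     (\<forall>\<phi>\<in>H. - grad_form \<Omega> A u \<phi> = lam * L2_inner \<Omega> u \<phi>)"

text \<open>Graph of the unbounded operator on \<open>L\<^sup>2\<close> associated with the form: \<open>div (A \<nabla>u) = f\<close> weakly.\<close>

definition weak_operator ::
  "(real^'n) set \<Rightarrow> (real^'n \<Rightarrow> real) set \<Rightarrow> (real^'n \<Rightarrow> real^'n^'n) \<Rightarrow>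
     (real^'n \<Rightarrow> real) \<Rightarrow> (real^'n \<Rightarrow> real) \<Rightarrow> bool" where
  "weak_operator \<Omega> H A u f \<longleftrightarrow> u \<in> H \<and> f \<in> L2 \<Omega> \<and>
     (\<forall>\<phi>\<in>H. - grad_form \<Omega> A u \<phi> = L2_inner \<Omega> f \<phi>)"

text \<open>
  The kernel of the \<open>k\<close>-th power of (operator minus \<open>lam\<close>). An eigenvalue is algebraically simple if
  the union of these kernels over all \<open>k\<close> is one-dimensional.
\<close>

primrec gen_eigenspace ::
  "(real^'n) set \<Rightarrow> (real^'n \<Rightarrow> real) set \<Rightarrow> (real^'n \<Rightarrow> real^'n^'n) \<Rightarrow> real \<Rightarrow> nat \<Rightarrow>
     (real^'n \<Rightarrow> real) set" where
  "gen_eigenspace \<Omega> H A lam 0 = {u \<in> L2 \<Omega>. AE x in lebesgue_on \<Omega>. u x = 0}"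
| "gen_eigenspace \<Omega> H A lam (Suc k) =
     {u. \<exists>f. weak_operator \<Omega> H A u f \<and> (\<lambda>x. f x - lam * u x) \<in> gen_eigenspace \<Omega> H A lam k}"

definition algebraically_simple ::
  "(real^'n) set \<Rightarrow> (real^'n \<Rightarrow> real) set \<Rightarrow> (real^'n \<Rightarrow> real^'n^'n) \<Rightarrow> real \<Rightarrow> bool" where
  "algebraically_simple \<Omega> H A lam \<longleftrightarrow>
     (\<exists>u. eigenpair \<Omega> H A lam u \<and>
        (\<forall>k. \<forall>v\<in>gen_eigenspace \<Omega> H A lam k. \<exists>c. AE x in lebesgue_on \<Omega>. v x = c * u x))"

definition orth_in ::
  "(real^'n) set \<Rightarrow> (real^'n \<Rightarrow> real) set \<Rightarrow> (real^'n \<Rightarrow> real) \<Rightarrow> (real^'n \<Rightarrow> real) set" where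
  "orth_in \<Omega> H u = {v \<in> H. L2_inner \<Omega> v u = 0}"

text \<open>
  The equations for the linear response \<open>(v, \<mu>)\<close> of the eigenpair \<open>(lam, u)\<close>, where \<open>A'\<close> is the
  derivative of \<open>A\<close>. The signs go with the convention \<open>- a(u, \<phi>) = lam \<langle>u, \<phi>\<rangle>\<close> of \<open>eigenpair\<close>:
  differentiating it gives
  \<open>- a'(u, \<phi>) - a(v, \<phi>) = \<mu> \<langle>u, \<phi>\<rangle> + lam \<langle>v, \<phi>\<rangle>\<close>.
  With the opposite convention \<open>a(u, \<phi>) = lam \<langle>u, \<phi>\<rangle>\<close>, both \<open>lam\<close> and \<open>\<mu>\<close> change sign and the equations read
  \<open>a(v, \<phi>) - lam \<langle>v, \<phi>\<rangle> = - (a'(u, \<phi>) - \<mu> \<langle>u, \<phi>\<rangle>)\<close> and \<open>\<mu> = a'(u, u) / \<parallel>u\<parallel>\<^sup>2\<close>.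
\<close>

definition response_equations ::
  "(real^'n) set \<Rightarrow> (real^'n \<Rightarrow> real) set \<Rightarrow> (real^'n \<Rightarrow> real^'n^'n) \<Rightarrow> (real^'n \<Rightarrow> real^'n^'n) \<Rightarrow>
     real \<Rightarrow> (real^'n \<Rightarrow> real) \<Rightarrow> (real^'n \<Rightarrow> real) \<Rightarrow> real \<Rightarrow> bool" where
  "response_equations \<Omega> H A A' lam u v \<mu> \<longleftrightarrow>
     (\<forall>\<phi>\<in>orth_in \<Omega> H u.
        grad_form \<Omega> A v \<phi> + lam * L2_inner \<Omega> v \<phi> = - (grad_form \<Omega> A' u \<phi> + \<mu> * L2_inner \<Omega> u \<phi>)) \<and>
     \<mu> = - grad_form \<Omega> A' u u / (L2_norm \<Omega> u)\<^sup>2"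

end

theory Submission
  imports Defs
begin

text \<open>
  Since \<open>A\<^sub>\<epsilon>\<close> is differentiable in \<open>\<epsilon>\<close> uniformly on \<open>\<Omega>\<close>, the weak eigenvalue equation
  \<open>a\<^sub>\<epsilon>(u\<^sub>\<epsilon>, \<phi>) + \<lambda>\<^sub>\<epsilon> \<langle>u\<^sub>\<epsilon>, \<phi>\<rangle> = 0\<close> can be differentiated at \<open>\<epsilon> = 0\<close> for every fixed \<open>\<phi> \<in> H\<close>, which gives
  \<open>a\<^sub>0(v, \<phi>) + a'(u\<^sub>0, \<phi>) + \<lambda>\<^sub>0 \<langle>v, \<phi>\<rangle> + \<lambda>' \<langle>u\<^sub>0, \<phi>\<rangle> = 0\<close> for the linear responses \<open>v\<close> and \<open>\<lambda>'\<close>. For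
  \<open>\<phi> \<bottom> u\<^sub>0\<close> this is the first response equation; for \<open>\<phi> = u\<^sub>0\<close> the terms with \<open>v\<close> cancel because \<open>a\<^sub>0\<close>
  is symmetric and \<open>v \<bottom> u\<^sub>0\<close>, which leaves the formula for \<open>\<lambda>'\<close>. The difference of two solutions
  satisfies the eigenvalue equation for \<open>\<lambda>\<^sub>0\<close> against every \<open>\<phi> \<bottom> u\<^sub>0\<close> and, again by symmetry, against
  \<open>u\<^sub>0\<close>. It is thus an element of the eigenspace of \<open>\<lambda>\<^sub>0\<close> orthogonal to \<open>u\<^sub>0\<close>, and vanishes by simplicity.

  The weak gradient is linear only because it is unique almost everywhere on \<open>\<Omega>\<close>. For this the
  boundary must be a null set, and there must be enough test functions: products of rescaled copies of
  \<open>exp (-1/t)\<close> converge to the indicator functions of boxes.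
\<close>

section \<open>Smoothly bounded domains\<close>

text \<open>Two choice operators shape the proof: \<open>frechet_derivative\<close> within \<Omega>
  and \<open>wgrad\<close>. No algebraic rule is available for either before uniqueness is known:
  for the first at every point of \<Omega>, the boundary included, for the second almost everywhere.
  Both uniqueness statements draw on the same boundary data, a direction \<open>v\<close> in which a
  local defining function \<open>\<rho>\<close> grows. Its negative lies in an open cone of
  directions into \<Omega>, and locally every line parallel to \<open>v\<close> meets the boundary
  at most once, which makes the boundary null.

  The differentiation at \<epsilon> = 0 uses exact product rules for difference quotients. The
  quotient of \<open>a(u, \<phi>)\<close> splits into \<open>a_h(w_h, \<phi>)\<close>, where
  \<open>w_h\<close> is the quotient of the eigenfunctions, and the form of the quotient of the
  matrices at \<open>u_0\<close>. The limits then come from convergence of \<open>w_h\<close> in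
  \<open>H1_norm\<close> and uniform convergence of the matrices. The latter follows because the C^2
  norm bounds the Jacobian \<open>J\<close> and \<open>(J^T J)^-1 = J^-1 J^-T\<close>: this has
  derivative \<open>- (N + N^T)\<close>, and the factor 1/2 in \<open>dyn_matrix\<close> turns it
  into \<open>- sym_part N\<close>.\<close>

lemma linear_vanishing_on_open:
  fixes L :: "'a::real_normed_vector \<Rightarrow> 'b::real_normed_vector"
  assumes "linear L" "open W" "v \<in> W" and L0: "\<And>w. w \<in> W \<Longrightarrow> L w = 0"
  shows "L = (\<lambda>_. 0)"
proof
  fix w :: 'a
  interpret linear L by fact
  obtain r where r: "r > 0" "ball v r \<subseteq> W"
    using assms open_contains_ball by blast
  \<comment> \<open>The summand 1 keeps the denominator positive for \<open>w = 0\<close>.\<close>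
  define s where "s = r / (2 * (norm w + 1))"
  have "norm w + 1 > 0"
    by (smt (verit) norm_ge_zero)
  then have "s > 0" "s * (norm w + 1) = r / 2"
    using r(1) by (auto simp: s_def divide_simps)
  then have s: "s > 0" "s * norm w < r"
    using r(1) by (auto simp: distrib_left)
  then have "v + s *\<^sub>R w \<in> W"
    using r(2) by (intro subsetD[OF r(2)]) (simp add: dist_norm)
  from L0[OF this] have "L v + s *\<^sub>R L w = 0"
    by (simp add: add scale)
  then show "L w = 0"
    using L0[OF \<open>v \<in> W\<close>] s by simp
qed

text \<open>The difference of two derivatives is a derivative of the zero function. Restricted to
  the segment from \<open>x\<close> in a direction of \<open>W\<close>, it becomes a one-sided
  derivative at the end of an interval, which is unique and hence zero. A linear map that vanishes
  on an open set of directions vanishes.\<close>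

lemma has_derivative_unique_within_cone:
  fixes f :: "'a::real_normed_vector \<Rightarrow> 'b::real_normed_vector"
  assumes "(f has_derivative f') (at x within S)" "(f has_derivative f'') (at x within S)"
    and "open W" "v0 \<in> W"
    and cone: "\<And>v. v \<in> W \<Longrightarrow> \<exists>e>0. \<forall>t\<in>{0..e}. x + t *\<^sub>R v \<in> S"
  shows "f' = f''"
proof -
  define L where "L = (\<lambda>v. f' v - f'' v)"
  have L: "((\<lambda>_. 0) has_derivative L) (at x within S)"
    using has_derivative_diff[OF assms(1,2)] by (simp add: L_def)
  then have lin: "linear L"
    using has_derivative_linear by blast
  have "L v = 0" if v: "v \<in> W" for v
  proof -
    obtain e where e: "e > 0" "\<forall>t\<in>{0..e}. x + t *\<^sub>R v \<in> S"
      using cone[OF v] by blast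
    have "((\<lambda>t. x + t *\<^sub>R v) has_derivative (\<lambda>t. t *\<^sub>R v)) (at 0 within {0..e})"
      by (auto intro!: derivative_eq_intros)
    moreover have "((\<lambda>_. 0) has_derivative L) (at (x + 0 *\<^sub>R v) within (\<lambda>t. x + t *\<^sub>R v) ` {0..e})"
      using L e by (auto intro: has_derivative_subset)
    ultimately have "((\<lambda>_. 0) has_derivative (\<lambda>t. L (t *\<^sub>R v))) (at 0 within {0..e})"
      by (rule has_derivative_in_compose)
    then have "((\<lambda>_. 0) has_vector_derivative L v) (at 0 within cbox 0 e)"
      using lin by (simp add: has_vector_derivative_def linear_scale)
    then show ?thesis
      using vector_derivative_unique_within_closed_interval[OF e(1), of 0 "\<lambda>_. 0" "L v" 0] e(1)
      by simp
  qed
  then have "L = (\<lambda>_. 0)"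
    using linear_vanishing_on_open[OF lin assms(3,4)] by blast
  then show ?thesis
    by (auto simp: L_def fun_eq_iff)
qed

text \<open>Collects what the later arguments take from a local defining function. The definition of
  the domain gives only the sign of \<open>\<rho>\<close> on \<Omega> and a nonzero derivative at
  \<open>p\<close>; added here are a direction of strict growth and the fact that nearby boundary
  points lie on the level set \<open>\<rho> = 0\<close>.\<close>

lemma smooth_compact_domain_boundary:
  fixes \<Omega> :: "'a::euclidean_space set"
  assumes "smooth_compact_domain \<Omega>" "p \<in> frontier \<Omega>"
  obtains U and \<rho> :: "'a \<Rightarrow> real" and v
  where "open U" "p \<in> U" "\<And>x. x \<in> U \<Longrightarrow> (\<rho> has_derivative frechet_derivative \<rho> (at x)) (at x)"
    "\<And>w. continuous_on U (\<lambda>x. frechet_derivative \<rho> (at x) w)"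
    "frechet_derivative \<rho> (at p) v > 0" "\<Omega> \<inter> U = {x\<in>U. \<rho> x \<le> 0}"
    "\<And>x. x \<in> frontier \<Omega> \<inter> U \<Longrightarrow> \<rho> x = 0"
proof -
  obtain U and \<rho> :: "'a \<Rightarrow> real" where U: "open U" "p \<in> U" and sm: "smooth_on \<rho> U"
    and nz: "frechet_derivative \<rho> (at p) \<noteq> (\<lambda>_. 0)" and eq: "\<Omega> \<inter> U = {x\<in>U. \<rho> x \<le> 0}"
    using assms unfolding smooth_compact_domain_def by blast
  have "closed \<Omega>"
    using assms by (simp add: smooth_compact_domain_def compact_imp_closed)
  have Ck: "Ck_on (Suc 0) \<rho> U"
    using sm smooth_on_def by blast
  have within: "at x within U = at x" if "x \<in> U" for x
    using U(1) that by (rule at_within_open[rotated])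
  have der: "(\<rho> has_derivative frechet_derivative \<rho> (at x)) (at x)" if "x \<in> U" for x
    using Ck that within frechet_derivative_works
    by (fastforce simp: differentiable_on_def)
  have cont: "continuous_on U (\<lambda>x. frechet_derivative \<rho> (at x) w)" for w
  proof -
    have "continuous_on U (\<lambda>x. frechet_derivative \<rho> (at x within U) w)"
      using Ck by simp
    then show ?thesis
      by (rule continuous_on_cong[THEN iffD1, rotated -1]) (auto simp: within)
  qed
  interpret linear "frechet_derivative \<rho> (at p)"
    using der[OF U(2)] has_derivative_linear by blast
  obtain w where w: "frechet_derivative \<rho> (at p) w \<noteq> 0"
    using nz by auto
  \<comment> \<open>Scaling \<open>w\<close> by the value of the derivative at \<open>w\<close>
    makes the derivative at \<open>v\<close> a square, hence positive for either sign.\<close>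
  define v where "v = frechet_derivative \<rho> (at p) w *\<^sub>R w"
  have v: "frechet_derivative \<rho> (at p) v > 0"
    using w by (simp add: v_def scale flip: power2_eq_square)
  \<comment> \<open>If \<open>\<rho> x < 0\<close>, then \<open>\<rho>\<close> stays negative near
    \<open>x\<close> by continuity, so a whole neighbourhood of \<open>x\<close> lies in \<Omega>
    and \<open>x\<close> is interior.\<close>
  have zero: "\<rho> x = 0" if x: "x \<in> frontier \<Omega> \<inter> U" for x
  proof (rule ccontr)
    assume "\<rho> x \<noteq> 0"
    moreover have "x \<in> \<Omega>"
      using x \<open>closed \<Omega>\<close> frontier_subset_closed by blast
    ultimately have "\<rho> x < 0"
      using eq x by force
    have "isCont \<rho> x"
      using der x has_derivative_continuous by blast
    then have "\<forall>\<^sub>F y in at x. \<rho> y < 0"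
      using \<open>\<rho> x < 0\<close> unfolding isCont_def by (rule order_tendstoD)
    then have "\<forall>\<^sub>F y in nhds x. \<rho> y < 0"
      using \<open>\<rho> x < 0\<close> by (simp add: eventually_nhds_conv_at)
    moreover have "\<forall>\<^sub>F y in nhds x. y \<in> U"
      using U(1) x eventually_nhds_in_open by blast
    ultimately have "\<forall>\<^sub>F y in nhds x. y \<in> \<Omega>"
      by eventually_elim (use eq in force)
    then have "x \<in> interior \<Omega>"
      by (simp add: eventually_nhds interior_def) (metis subsetI)
    then show False
      using x by (simp add: frontier_def)
  qed
  show thesis
    using that[OF U der cont v eq zero] .
qed

text \<open>
  At a boundary point the directions with \<open>D\<rho>(v) < 0\<close> form an open cone pointing into \<open>\<Omega>\<close>. Therefore
  the choice made by \<^const>\<open>frechet_derivative\<close> is harmless up to the boundary.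
\<close>

lemma has_derivative_unique_within_smooth_domain:
  fixes f :: "'a::euclidean_space \<Rightarrow> 'b::real_normed_vector"
  assumes \<Omega>: "smooth_compact_domain \<Omega>" and "x \<in> \<Omega>"
    and f: "(f has_derivative f') (at x within \<Omega>)" "(f has_derivative f'') (at x within \<Omega>)"
  shows "f' = f''"
proof (cases "x \<in> interior \<Omega>")
  case True
  then show ?thesis
    using f by (metis at_within_interior has_derivative_unique)
next
  case False
  then have "x \<in> frontier \<Omega>"
    using \<open>x \<in> \<Omega>\<close> by (simp add: frontier_def closure_subset[THEN subsetD])
  then obtain U and \<rho> :: "'a \<Rightarrow> real" and v where U: "open U" "x \<in> U"
    and der: "\<And>y. y \<in> U \<Longrightarrow> (\<rho> has_derivative frechet_derivative \<rho> (at y)) (at y)"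
    and "\<And>w. continuous_on U (\<lambda>x. frechet_derivative \<rho> (at x) w)"
    and v: "frechet_derivative \<rho> (at x) v > 0" and eq: "\<Omega> \<inter> U = {x\<in>U. \<rho> x \<le> 0}"
    and rho0: "\<And>x. x \<in> frontier \<Omega> \<inter> U \<Longrightarrow> \<rho> x = 0"
    by (rule smooth_compact_domain_boundary[OF \<Omega>]) (rule that)
  define D where "D = frechet_derivative \<rho> (at x)"
  have D: "(\<rho> has_derivative D) (at x)"
    using der U by (simp add: D_def)
  then have lin: "bounded_linear D"
    using has_derivative_bounded_linear by blast
  then interpret bounded_linear D .
  have "\<rho> x = 0"
    using rho0 \<open>x \<in> frontier \<Omega>\<close> U by blast
  define W where "W = {w. D w < 0}"
  show ?thesis
  proof (rule has_derivative_unique_within_cone[OF f, of W "- v"])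
    show "open W"
      unfolding W_def using lin by (intro open_Collect_less) (auto intro: continuous_on continuous_on_id)
    show "- v \<in> W"
      using v linear_neg[OF bounded_linear.linear[OF lin], of v] by (simp add: W_def D_def)
    fix w assume "w \<in> W"
    then have "D w < 0"
      by (simp add: W_def)
    have line: "((\<lambda>t. x + t *\<^sub>R w) has_derivative (\<lambda>t. t *\<^sub>R w)) (at 0)"
      by (auto intro!: derivative_eq_intros)
    have "((\<lambda>t. \<rho> (x + t *\<^sub>R w)) has_derivative (\<lambda>t. D (t *\<^sub>R w))) (at 0)"
      using has_derivative_compose[OF line] D by simp
    then have "((\<lambda>t. \<rho> (x + t *\<^sub>R w)) has_real_derivative D w) (at 0)"
      by (simp add: has_field_derivative_def scaleR mult_commute_abs)
    from DERIV_neg_dec_right[OF this \<open>D w < 0\<close>] obtain d1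
      where d1: "d1 > 0" "\<And>h. h > 0 \<Longrightarrow> h < d1 \<Longrightarrow> \<rho> (x + h *\<^sub>R w) < 0"
      using \<open>\<rho> x = 0\<close> by auto
    have "((\<lambda>t. x + t *\<^sub>R w) \<longlongrightarrow> x + 0 *\<^sub>R w) (nhds 0)"
      by (intro tendsto_intros filterlim_ident)
    then have "\<forall>\<^sub>F t in nhds 0. x + t *\<^sub>R w \<in> U"
      using topological_tendstoD[OF _ U(1)] U(2) by simp
    then obtain d2 where d2: "d2 > 0" "\<And>h. \<bar>h\<bar> < d2 \<Longrightarrow> x + h *\<^sub>R w \<in> U"
      by (auto simp: eventually_nhds_metric dist_real_def)
    \<comment> \<open>Halving puts the closed interval \<open>{0..e}\<close> strictly below both
      thresholds.\<close>
    define e where "e = min d1 d2 / 2"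
    have "e > 0" "e < d1" "e < d2"
      using d1(1) d2(1) by (auto simp: e_def)
    moreover have "x + t *\<^sub>R w \<in> \<Omega>" if "t \<in> {0..e}" for t
    proof (cases "t = 0")
      case False
      then have "\<rho> (x + t *\<^sub>R w) < 0" "x + t *\<^sub>R w \<in> U"
        using that d1 d2 \<open>e < d1\<close> \<open>e < d2\<close> by auto
      then show ?thesis
        using eq by force
    qed (use \<open>x \<in> \<Omega>\<close> in simp)
    ultimately show "\<exists>e>0. \<forall>t\<in>{0..e}. x + t *\<^sub>R w \<in> \<Omega>"
      by blast
  qed
qed

text \<open>The translates of \<open>Z\<close> by \<open>v / (n + 1)\<close> are disjoint, of equal measure, and stay in a bounded set.\<close>

lemma negligible_transversal:
  fixes Z :: "'a::euclidean_space set"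
  assumes "compact Z" and trans: "\<And>z \<tau>. z \<in> Z \<Longrightarrow> z + \<tau> *\<^sub>R v \<in> Z \<Longrightarrow> \<tau> = 0"
  shows "negligible Z"
proof -
  obtain r where r: "r > 0" "Z \<subseteq> cball 0 r"
    using compact_imp_bounded[OF assms(1)] by (metis bounded_subset_ballD ball_subset_cball subset_trans)
  define S where "S n = (+) ((1 / real (Suc n)) *\<^sub>R v) ` Z" for n
  define C :: "'a set" where "C = cball 0 (r + norm v)"
  have Z: "Z \<in> lmeasurable"
    using assms(1) by (rule lmeasurable_compact)
  have S: "S n \<in> lmeasurable" "measure lebesgue (S n) = measure lebesgue Z" for n
    using Z by (auto simp: S_def measurable_translation measure_translation)
  have "S n \<subseteq> C" for n
  proof -
    have "norm ((1 / real (Suc n)) *\<^sub>R v) \<le> norm v"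
      by (simp add: divide_le_eq mult_left_le_one_le field_simps)
    then show ?thesis
      using r(2) by (auto simp: S_def C_def subset_iff intro!: order_trans[OF norm_triangle_ineq])
  qed
  have "disjnt (S m) (S n)" if "m \<noteq> n" for m n
  proof (rule ccontr)
    assume "\<not> disjnt (S m) (S n)"
    then obtain z z' where z: "z \<in> Z" "z' \<in> Z"
      "(1 / real (Suc m)) *\<^sub>R v + z = (1 / real (Suc n)) *\<^sub>R v + z'"
      by (auto simp: disjnt_def S_def)
    then have "z' = z + (1 / real (Suc m) - 1 / real (Suc n)) *\<^sub>R v"
      by (simp add: algebra_simps)
    then have "1 / real (Suc m) - 1 / real (Suc n) = 0"
      using trans z by metis
    then show False
      using that by simp
  qed
  then have pair: "pairwise (\<lambda>i j. disjnt (S i) (S j)) I" for I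
    by (simp add: pairwise_def)
  have bound: "real N * measure lebesgue Z \<le> measure lebesgue C" for N
  proof -
    have "real N * measure lebesgue Z = (\<Sum>n<N. measure lebesgue (S n))"
      by (simp add: S)
    also have "\<dots> = measure lebesgue (\<Union>n<N. S n)"
      by (rule measure_UNION'[symmetric]) (auto simp: S pair)
    also have "\<dots> \<le> measure lebesgue C"
      using \<open>\<And>n. S n \<subseteq> C\<close> S(1)
      by (intro measure_mono_fmeasurable) (auto simp: C_def fmeasurableD)
    finally show ?thesis .
  qed
  have "measure lebesgue Z = 0"
  proof (rule ccontr)
    assume "measure lebesgue Z \<noteq> 0"
    then have "measure lebesgue Z > 0"
      by (simp add: zero_less_measure_iff)
    then show False
      using bound reals_Archimedean3[of "measure lebesgue Z"] by (metis linorder_not_le)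
  qed
  then show ?thesis
    using Z by (simp add: negligible_iff_measure)
qed

text \<open>Near \<open>p\<close> the function \<open>\<rho>\<close> increases strictly along
  \<open>v\<close> and vanishes on the boundary, so no two boundary points there differ by a
  multiple of \<open>v\<close>. This is the transversality that makes the piece \<open>Z\<close> of
  the boundary null, and local nullity suffices.\<close>

lemma negligible_frontier_smooth_domain:
  fixes \<Omega> :: "'a::euclidean_space set"
  assumes \<Omega>: "smooth_compact_domain \<Omega>"
  shows "negligible (frontier \<Omega>)"
proof (subst locally_negligible_alt, rule ballI)
  fix p assume p: "p \<in> frontier \<Omega>"
  obtain U and \<rho> :: "'a \<Rightarrow> real" and v where U: "open U" "p \<in> U"
    and der: "\<And>y. y \<in> U \<Longrightarrow> (\<rho> has_derivative frechet_derivative \<rho> (at y)) (at y)"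
    and cont: "\<And>w. continuous_on U (\<lambda>x. frechet_derivative \<rho> (at x) w)"
    and v: "frechet_derivative \<rho> (at p) v > 0" and "\<Omega> \<inter> U = {x\<in>U. \<rho> x \<le> 0}"
    and zero: "\<And>x. x \<in> frontier \<Omega> \<inter> U \<Longrightarrow> \<rho> x = 0"
    by (rule smooth_compact_domain_boundary[OF \<Omega> p]) (rule that)
  have "open (U \<inter> (\<lambda>x. frechet_derivative \<rho> (at x) v) -` {0<..})"
    by (rule continuous_open_preimage[OF cont U(1) open_greaterThan])
  moreover have "p \<in> U \<inter> (\<lambda>x. frechet_derivative \<rho> (at x) v) -` {0<..}"
    using U v by simp
  ultimately obtain r where "r > 0" "ball p r \<subseteq> U \<inter> (\<lambda>x. frechet_derivative \<rho> (at x) v) -` {0<..}"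
    using open_contains_ball by blast
  then have r: "r > 0" "ball p r \<subseteq> {x\<in>U. 0 < frechet_derivative \<rho> (at x) v}"
    by auto
  \<comment> \<open>The closed ball makes \<open>Z\<close> compact; its radius is halved so that it
    lies in the open ball on which the derivative of \<open>\<rho>\<close> along \<open>v\<close> is
    positive.\<close>
  define Z where "Z = frontier \<Omega> \<inter> cball p (r / 2)"
  have Zball: "Z \<subseteq> ball p r"
    using r(1) by (auto simp: Z_def)
  \<comment> \<open>By convexity the segment between the two points stays in the ball. The mean
    value theorem would give a zero of the derivative along \<open>v\<close>, since
    \<open>\<rho>\<close> vanishes at both ends.\<close>
  have no_increase: False if z: "z \<in> Z" "z + \<tau> *\<^sub>R v \<in> Z" "\<tau> > 0" for z \<tau>
  proof -
    have seg: "z + t *\<^sub>R v \<in> ball p r" if "0 \<le> t" "t \<le> \<tau>" for t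
    proof -
      have "z + t *\<^sub>R v = (1 - t / \<tau>) *\<^sub>R z + (t / \<tau>) *\<^sub>R (z + \<tau> *\<^sub>R v)"
        using \<open>\<tau> > 0\<close> by (simp add: algebra_simps)
      also have "\<dots> \<in> ball p r"
        using z that Zball by (intro convexD[OF convex_ball]) auto
      finally show ?thesis .
    qed
    have d: "((\<lambda>t. \<rho> (z + t *\<^sub>R v)) has_derivative
        (\<lambda>h. frechet_derivative \<rho> (at (z + t *\<^sub>R v)) (h *\<^sub>R v))) (at t within {0..\<tau>})"
      if "0 \<le> t" "t \<le> \<tau>" for t
    proof -
      have line: "((\<lambda>t. z + t *\<^sub>R v) has_derivative (\<lambda>h. h *\<^sub>R v)) (at t within {0..\<tau>})"
        by (auto intro!: derivative_eq_intros)
      show ?thesis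
        using der seg[OF that] r(2) by (intro has_derivative_compose[OF line, of \<rho>]) blast
    qed
    obtain t where t: "t \<in> {0<..<\<tau>}"
      and eq: "\<rho> (z + \<tau> *\<^sub>R v) - \<rho> (z + 0 *\<^sub>R v) = frechet_derivative \<rho> (at (z + t *\<^sub>R v)) ((\<tau> - 0) *\<^sub>R v)"
      using mvt_simple[OF \<open>\<tau> > 0\<close> d] by auto
    have in_ball: "z + t *\<^sub>R v \<in> ball p r"
      using seg t by auto
    then have lin: "linear (frechet_derivative \<rho> (at (z + t *\<^sub>R v)))"
      using der r(2) has_derivative_linear by blast
    have "\<rho> z = 0" "\<rho> (z + \<tau> *\<^sub>R v) = 0"
      using z Zball r(2) by (auto simp: Z_def intro!: zero)
    then have "\<tau> * frechet_derivative \<rho> (at (z + t *\<^sub>R v)) v = 0"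
      using eq lin by (simp add: linear_scale)
    then show False
      using in_ball r(2) \<open>\<tau> > 0\<close> by auto
  qed
  have "negligible Z"
  proof (rule negligible_transversal[where v=v])
    show "compact Z"
      unfolding Z_def by (intro closed_Int_compact) auto
    fix z \<tau> assume z: "z \<in> Z" "z + \<tau> *\<^sub>R v \<in> Z"
    then show "\<tau> = 0"
      \<comment> \<open>A negative \<open>\<tau>\<close> is handled by exchanging the two end
        points.\<close>
      using no_increase[of z \<tau>] no_increase[of "z + \<tau> *\<^sub>R v" "- \<tau>"]
      by (cases \<tau> "0::real" rule: linorder_cases) auto
  qed
  then have "negligible (frontier \<Omega> \<inter> ball p (r / 2))"
    by (rule negligible_subset) (auto simp: Z_def)
  moreover have "openin (top_of_set (frontier \<Omega>)) (frontier \<Omega> \<inter> ball p (r / 2))"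
    by (simp add: openin_open_Int)
  ultimately show "\<exists>U. openin (top_of_set (frontier \<Omega>)) U \<and> p \<in> U \<and> negligible U"
    using p r(1) by (intro exI[of _ "frontier \<Omega> \<inter> ball p (r / 2)"]) auto
qed

section \<open>Bump functions\<close>

lemma Ck_on_Suc_imp: "Ck_on (Suc k) f S \<Longrightarrow> Ck_on k f S"
proof (induction k arbitrary: f)
  case 0
  then show ?case
    by (simp add: differentiable_imp_continuous_on)
next
  case (Suc k)
  then show ?case
    by (metis Ck_on.simps(2))
qed

lemma smooth_onD: "smooth_on f S \<Longrightarrow> Ck_on k f S"
  by (simp add: smooth_on_def)

lemma Ck_on_has_derivative_within:
  "Ck_on (Suc k) f S \<Longrightarrow> x \<in> S \<Longrightarrow>
    (f has_derivative frechet_derivative f (at x within S)) (at x within S)"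
  by (simp add: differentiable_on_def frechet_derivative_works)

lemma Ck_on_has_derivative:
  "Ck_on (Suc k) f UNIV \<Longrightarrow> (f has_derivative frechet_derivative f (at x)) (at x)"
  using Ck_on_has_derivative_within[of k f UNIV x] by simp

lemma Ck_on_const: "Ck_on k (\<lambda>_. c) UNIV"
  by (induction k arbitrary: c) auto

lemma Ck_on_add:
  assumes "Ck_on k f UNIV" "Ck_on k g UNIV"
  shows "Ck_on k (\<lambda>x. f x + g x) UNIV"
  using assms
proof (induction k arbitrary: f g)
  case 0
  then show ?case
    by (simp add: continuous_on_add)
next
  case (Suc k)
  have "((\<lambda>x. f x + g x) has_derivative
      (\<lambda>v. frechet_derivative f (at x) v + frechet_derivative g (at x) v)) (at x)" for x
    using Suc.prems by (intro has_derivative_add Ck_on_has_derivative)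
  note frechet_derivative_at[OF this, symmetric, THEN fun_cong]
  then show ?case
    using Suc by (auto intro: differentiable_on_add)
qed

lemma Ck_on_mult:
  fixes f g :: "'a::euclidean_space \<Rightarrow> real"
  assumes "Ck_on k f UNIV" "Ck_on k g UNIV"
  shows "Ck_on k (\<lambda>x. f x * g x) UNIV"
  using assms
proof (induction k arbitrary: f g)
  case 0
  then show ?case
    by (simp add: continuous_on_mult)
next
  case (Suc k)
  have "((\<lambda>x. f x * g x) has_derivative
      (\<lambda>v. f x * frechet_derivative g (at x) v + frechet_derivative f (at x) v * g x)) (at x)" for x
    using Suc.prems by (intro has_derivative_mult Ck_on_has_derivative)
  note D = frechet_derivative_at[OF this, symmetric, THEN fun_cong]
  have "Ck_on k (\<lambda>x. f x * frechet_derivative g (at x) v + frechet_derivative f (at x) v * g x) UNIV" for v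
    using Suc.prems
    by (intro Ck_on_add Suc.IH Ck_on_Suc_imp[OF Suc.prems(1)] Ck_on_Suc_imp[OF Suc.prems(2)]) auto
  then show ?case
    using Suc.prems by (auto simp: D intro: differentiable_on_mult)
qed

lemma smooth_on_const: "smooth_on (\<lambda>_. c) UNIV"
  and smooth_on_add: "smooth_on f UNIV \<Longrightarrow> smooth_on g UNIV \<Longrightarrow> smooth_on (\<lambda>x. f x + g x) UNIV"
  and smooth_on_mult: "smooth_on f' UNIV \<Longrightarrow> smooth_on g' UNIV \<Longrightarrow> smooth_on (\<lambda>x. f' x * g' x) UNIV"
  for f g :: "'a::euclidean_space \<Rightarrow> 'b::real_normed_vector" and f' g' :: "'a \<Rightarrow> real"
  by (auto simp: smooth_on_def intro: Ck_on_const Ck_on_add Ck_on_mult)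

lemma smooth_on_prod:
  fixes f :: "'i \<Rightarrow> 'a::euclidean_space \<Rightarrow> real"
  assumes "\<And>i. i \<in> I \<Longrightarrow> smooth_on (f i) UNIV"
  shows "smooth_on (\<lambda>x. \<Prod>i\<in>I. f i x) UNIV"
  using assms
  by (induction I rule: infinite_finite_induct) (auto intro: smooth_on_const smooth_on_mult)

text \<open>A sequence in which each function is the derivative of its predecessor encodes a smooth
  function with all its derivatives. One differentiation along \<open>v\<close> shifts
  \<open>m\<close> and produces the constant factor \<open>v \<bullet> w\<close>, so the induction
  on the order has to be general in \<open>m\<close>.\<close>

lemma smooth_on_compose_affine:
  fixes F :: "nat \<Rightarrow> real \<Rightarrow> real" and w :: "'a::euclidean_space"
  assumes F: "\<And>m t. (F m has_real_derivative F (Suc m) t) (at t)"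
  shows "smooth_on (\<lambda>x. F m (x \<bullet> w + c)) UNIV"
proof -
  have der: "((\<lambda>x. F m (x \<bullet> w + c)) has_derivative (\<lambda>v. (v \<bullet> w) * F (Suc m) (x \<bullet> w + c))) (at x)" for m x
    by (rule DERIV_compose_FDERIV[OF F]) (auto intro!: derivative_eq_intros)
  have "Ck_on k (\<lambda>x. F m (x \<bullet> w + c)) UNIV" for k
  proof (induction k arbitrary: m)
    case 0
    then show ?case
      using has_derivative_continuous[OF der] by (simp add: continuous_on_eq_continuous_at)
  next
    case (Suc k)
    have "frechet_derivative (\<lambda>x. F m (x \<bullet> w + c)) (at x) v = (v \<bullet> w) * F (Suc m) (x \<bullet> w + c)" for x v
      using frechet_derivative_at[OF der[of m x]] by metis
    moreover have "(\<lambda>x. F m (x \<bullet> w + c)) differentiable_on UNIV"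
      using der by (auto simp: differentiable_on_def differentiable_def)
    moreover have "Ck_on k (\<lambda>x. (v \<bullet> w) * F (Suc m) (x \<bullet> w + c)) UNIV" for v
      by (intro Ck_on_mult Ck_on_const Suc.IH)
    ultimately show ?case
      by simp
  qed
  then show ?thesis
    by (simp add: smooth_on_def)
qed

text \<open>
  The functions \<open>p(1/t) exp (-1/t)\<close>, extended by zero to \<open>t \<le> 0\<close>, are closed under differentiation:
  with \<open>s = 1/t\<close>, the derivative is \<open>s\<^sup>2 (p(s) - p'(s)) exp (-s)\<close>.
\<close>

definition flat_poly :: "real poly \<Rightarrow> real \<Rightarrow> real" where
  "flat_poly p t = (if t > 0 then poly p (1 / t) * exp (- (1 / t)) else 0)"

definition flat_deriv :: "real poly \<Rightarrow> real poly" where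
  "flat_deriv p = [:0, 0, 1:] * (p - pderiv p)"

lemma poly_mult_exp_minus_tendsto_0: "((\<lambda>s::real. poly p s * exp (- s)) \<longlongrightarrow> 0) at_top"
proof -
  have "((\<lambda>s::real. coeff p i * (s ^ i / exp s)) \<longlongrightarrow> 0) at_top" for i
    using tendsto_mult_right_zero[OF tendsto_power_div_exp_0] .
  then have "((\<lambda>s::real. \<Sum>i\<le>degree p. coeff p i * (s ^ i / exp s)) \<longlongrightarrow> 0) at_top"
    by (intro tendsto_null_sum) auto
  then show ?thesis
    by (simp add: poly_altdef sum_distrib_right exp_minus divide_inverse mult.assoc)
qed

lemma has_real_derivative_flat_poly:
  "(flat_poly p has_real_derivative flat_poly (flat_deriv p) t) (at t)"
proof (cases t "0::real" rule: linorder_cases)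
  case less
  have "((\<lambda>_. 0) has_real_derivative 0) (at t)"
    by simp
  then have "(flat_poly p has_real_derivative 0) (at t)"
    by (rule DERIV_cong_ev[THEN iffD1, rotated 3])
      (use less in \<open>auto simp: flat_poly_def eventually_nhds intro!: exI[of _ "{..<0}"]\<close>)
  then show ?thesis
    using less by (simp add: flat_poly_def)
next
  case greater
  have "((\<lambda>t. poly p (1 / t) * exp (- (1 / t))) has_real_derivative
      flat_poly (flat_deriv p) t) (at t)"
    using greater
    by (auto intro!: derivative_eq_intros poly_DERIV[THEN DERIV_chain2]
        simp: flat_poly_def flat_deriv_def power2_eq_square field_simps)
  then show ?thesis
    by (rule DERIV_cong_ev[THEN iffD1, rotated 3])
      (use greater in \<open>auto simp: flat_poly_def eventually_nhds intro!: exI[of _ "{0<..}"]\<close>)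
next
  case equal
  have "((\<lambda>h. flat_poly p h / h) \<longlongrightarrow> 0) (at_right 0)"
  proof -
    \<comment> \<open>Only the right difference quotient at 0 is delicate. Division by
      \<open>h\<close> is multiplication by \<open>s = 1/h\<close>, hence the additional factor
      \<open>[:0, 1:]\<close>, and the exponential beats every polynomial in
      \<open>s\<close>.\<close>
    have "((\<lambda>h. poly ([:0, 1:] * p) (inverse h) * exp (- inverse h)) \<longlongrightarrow> 0) (at_right 0)"
      by (rule filterlim_compose[OF poly_mult_exp_minus_tendsto_0 filterlim_inverse_at_top_right])
    then show ?thesis
      by (rule Lim_transform_eventually)
        (auto simp: flat_poly_def eventually_at_filter field_simps)
  qed
  moreover have "((\<lambda>h. flat_poly p h / h) \<longlongrightarrow> 0) (at_left 0)"
    by (rule tendsto_eventually) (auto simp: flat_poly_def eventually_at_filter)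
  ultimately have "((\<lambda>h. flat_poly p h / h) \<longlongrightarrow> 0) (at 0)"
    using filterlim_split_at by blast
  then show ?thesis
    using equal by (simp add: DERIV_def flat_poly_def)
qed

definition flat :: "real \<Rightarrow> real" where
  "flat t = (if t > 0 then exp (- (1 / t)) else 0)"

lemma smooth_on_flat_affine: "smooth_on (\<lambda>x. flat (x \<bullet> w + c)) UNIV"
proof -
  \<comment> \<open>The iterates start from the polynomial 1, for which \<open>flat_poly\<close> is
    \<open>flat\<close>.\<close>
  define F where "F m = flat_poly ((flat_deriv ^^ m) 1)" for m
  have "smooth_on (\<lambda>x. F 0 (x \<bullet> w + c)) UNIV"
    by (rule smooth_on_compose_affine) (simp add: F_def has_real_derivative_flat_poly)
  moreover have "F 0 = flat"
    by (auto simp: F_def flat_poly_def flat_def)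
  ultimately show ?thesis
    by simp
qed

lemma flat_nonneg: "0 \<le> flat t" and flat_le_1: "flat t \<le> 1" and flat_eq_0: "flat t = 0 \<longleftrightarrow> t \<le> 0"
  by (auto simp: flat_def)

lemma flat_tendsto: "(\<lambda>n. flat (real n * t)) \<longlonglongrightarrow> (if t > 0 then 1 else 0)"
proof (cases "t > 0")
  case True
  have "(\<lambda>n. exp (- ((1 / t) * (1 / real n)))) \<longlonglongrightarrow> exp (- ((1 / t) * 0))"
    by (intro tendsto_intros lim_1_over_n)
  \<comment> \<open>The index \<open>n = 0\<close> must be left out: there the exponential is 1
    because \<open>1 / 0 = 0\<close>, whereas \<open>flat 0 = 0\<close>.\<close>
  moreover have "\<forall>\<^sub>F n in sequentially. exp (- ((1 / t) * (1 / real n))) = flat (real n * t)"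
    using eventually_gt_at_top[of "0::nat"] by eventually_elim (use True in \<open>simp add: flat_def\<close>)
  ultimately have "(\<lambda>n. flat (real n * t)) \<longlonglongrightarrow> exp (- ((1 / t) * 0))"
    by (rule Lim_transform_eventually)
  then show ?thesis
    using True by simp
next
  case False
  then have "flat (real n * t) = 0" for n
    by (simp add: flat_eq_0 mult_nonneg_nonpos)
  then show ?thesis
    using False by simp
qed

text \<open>There is one factor for each face of the box. The scale \<open>n\<close> only sharpens
  the transition at the faces, so the functions for all \<open>n\<close> are supported in the one
  compact set \<open>cbox a b\<close> and bounded by 1.\<close>

definition box_bump :: "'a::euclidean_space \<Rightarrow> 'a \<Rightarrow> nat \<Rightarrow> 'a \<Rightarrow> real" where
  "box_bump a b n x =
    (\<Prod>i\<in>Basis. flat (real n * ((x - a) \<bullet> i)) * flat (real n * ((b - x) \<bullet> i)))"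

lemma smooth_on_box_bump: "smooth_on (box_bump a b n) UNIV"
proof -
  have "smooth_on (\<lambda>x. flat (x \<bullet> (real n *\<^sub>R i) + - (real n * (a \<bullet> i))) *
      flat (x \<bullet> (- real n *\<^sub>R i) + real n * (b \<bullet> i))) UNIV" for i
    by (intro smooth_on_mult smooth_on_flat_affine)
  then have "smooth_on (\<lambda>x. \<Prod>i\<in>Basis. flat (x \<bullet> (real n *\<^sub>R i) + - (real n * (a \<bullet> i))) *
      flat (x \<bullet> (- real n *\<^sub>R i) + real n * (b \<bullet> i))) UNIV"
    by (intro smooth_on_prod)
  then show ?thesis
    by (simp add: box_bump_def[abs_def] inner_diff_left algebra_simps)
qed

lemma box_bump_bounds: "0 \<le> box_bump a b n x" "box_bump a b n x \<le> 1"
  by (auto simp: box_bump_def intro!: prod_nonneg prod_le_1 mult_nonneg_nonneg mult_le_one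
      flat_nonneg flat_le_1)

lemma box_bump_eq_0: "x \<notin> box a b \<Longrightarrow> box_bump a b n x = 0"
  by (force simp: box_bump_def mem_box flat_eq_0 inner_diff_left mult_nonneg_nonpos not_less)

lemma box_bump_tendsto: "(\<lambda>n. box_bump a b n x) \<longlonglongrightarrow> indicator (box a b) x"
proof -
  have "(\<lambda>n. box_bump a b n x) \<longlonglongrightarrow>
    (\<Prod>i\<in>Basis. (if (x - a) \<bullet> i > 0 then 1 else 0) * (if (b - x) \<bullet> i > 0 then 1 else 0))"
    unfolding box_bump_def by (intro tendsto_prod tendsto_mult flat_tendsto)
  also have "(\<Prod>i\<in>Basis. (if (x - a) \<bullet> i > 0 then 1 else 0) * (if (b - x) \<bullet> i > 0 then 1 else 0)) =
    (indicator (box a b) x :: real)"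
  proof (cases "x \<in> box a b")
    case False
    then show ?thesis
      by (force simp: mem_box inner_diff_left)
  qed (simp add: mem_box inner_diff_left)
  finally show ?thesis .
qed

lemma test_function_box_bump:
  assumes "cbox a b \<subseteq> interior \<Omega>"
  shows "test_function \<Omega> (box_bump a b n)"
proof -
  have "{x. box_bump a b n x \<noteq> 0} \<subseteq> cbox a b"
    using box_bump_eq_0[of _ a b n] box_subset_cbox by blast
  then have "closure {x. box_bump a b n x \<noteq> 0} \<subseteq> cbox a b"
    by (rule closure_minimal) (rule closed_cbox)
  then show ?thesis
    using assms
    using smooth_on_box_bump[of a b n]
      compact_Int_closed[OF compact_cbox closed_closure, of a b "{x. box_bump a b n x \<noteq> 0}"]
    by (simp add: test_function_def inf.absorb2)
qed

section \<open>Functions with vanishing integrals and square-integrable functions\<close>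

text \<open>Open boxes form an intersection-stable generator of the Borel sets. The positive and
  negative parts of \<open>h\<close>, cut off to a box, are densities of two measures that agree on
  this generator, so the parts coincide and must vanish. Countably many boxes exhaust
  \<open>V\<close>.\<close>

lemma AE_eq_0_if_box_integrals_eq_0:
  fixes h :: "'a::euclidean_space \<Rightarrow> real"
  assumes h: "integrable lebesgue h" and "open V"
    and zero: "\<And>a b. cbox a b \<subseteq> V \<Longrightarrow> (LINT x|lebesgue. indicator (box a b) x * h x) = 0"
  shows "AE x in lebesgue. x \<in> V \<longrightarrow> h x = 0"
proof -
  \<comment> \<open>A Borel version of \<open>h\<close> is taken because boxes generate the Borel
    sets, not the Lebesgue sets.\<close>
  obtain g where [measurable]: "g \<in> borel_measurable lborel" and hg: "AE x in lborel. h x = g x"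
    using completion_ex_borel_measurable_real[OF borel_measurable_integrable[OF h]] by blast
  have hg': "AE x in lebesgue. h x = g x"
    using hg by (rule AE_completion)
  have [measurable]: "h \<in> borel_measurable lebesgue" "g \<in> borel_measurable lebesgue"
    using h by (auto intro: measurable_completion)
  have "integrable lebesgue g"
    using h hg' by (subst integrable_cong_AE[symmetric, of h]) auto
  then have g: "integrable lborel g"
    by (simp add: integrable_completion)
  have g0: "(LINT x|lborel. indicator (box a b) x * g x) = 0" if "cbox a b \<subseteq> V" for a b
  proof -
    have "(LINT x|lborel. indicator (box a b) x * g x) = (LINT x|lebesgue. indicator (box a b) x * g x)"
      by (rule integral_completion[symmetric]) simp
    also have "\<dots> = (LINT x|lebesgue. indicator (box a b) x * h x)"
    proof (rule integral_cong_AE)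
      show "AE x in lebesgue. indicator (box a b) x * g x = indicator (box a b) x * h x"
        using hg' by eventually_elim simp
    qed (auto intro!: borel_measurable_times borel_measurable_indicator)
    finally show ?thesis
      using zero[OF that] by simp
  qed
  have box0: "AE x in lborel. x \<in> box c d \<longrightarrow> g x = 0" if cd: "cbox c d \<subseteq> V" for c d
  proof -
    \<comment> \<open>\<open>ennreal\<close> sends negative numbers to 0, so these are the positive
      and the negative part of \<open>g\<close> on \<open>box c d\<close>.\<close>
    define p q where "p x = ennreal (indicator (box c d) x * g x)"
      and "q x = ennreal (- (indicator (box c d) x * g x))" for x
    have [measurable]: "p \<in> borel_measurable lborel" "q \<in> borel_measurable lborel"
      by (auto simp: p_def[abs_def] q_def[abs_def])
    have eq: "emeasure (density lborel p) (box a b) = emeasure (density lborel q) (box a b)"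
      and fin: "emeasure (density lborel p) (box a b) \<noteq> \<infinity>" for a b
    proof -
      define G where "G x = indicator (box a b \<inter> box c d) x * g x" for x
      \<comment> \<open>The same corners describe the intersections of the open and of the closed
        boxes, so \<open>cbox e f\<close> lies in \<open>V\<close> and the hypothesis applies to
        \<open>box e f\<close>.\<close>
      obtain e f where ef: "box a b \<inter> box c d = box e f" "cbox a b \<inter> cbox c d = cbox e f"
        using box_Int_box[of a b c d] Int_interval[of a b c d] by blast
      have G: "integrable lborel G"
        using integrable_real_mult_indicator[OF _ g, of "box a b \<inter> box c d"]
        by (simp add: G_def[abs_def] mult.commute)
      have "(LINT x|lborel. G x) = 0"
        unfolding G_def ef using ef(2) cd by (intro g0) blast
      then have "enn2real (\<integral>\<^sup>+x. ennreal (G x) \<partial>lborel) = enn2real (\<integral>\<^sup>+x. ennreal (- G x) \<partial>lborel)"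
        using real_lebesgue_integral_def[OF G] by simp
      moreover have fin: "(\<integral>\<^sup>+x. ennreal (G x) \<partial>lborel) \<noteq> \<infinity>" "(\<integral>\<^sup>+x. ennreal (- G x) \<partial>lborel) \<noteq> \<infinity>"
        using G by (auto simp: real_integrable_def)
      ultimately have "(\<integral>\<^sup>+x. ennreal (G x) \<partial>lborel) = (\<integral>\<^sup>+x. ennreal (- G x) \<partial>lborel)"
        by (metis ennreal_enn2real_if infinity_ennreal_def)
      moreover have "p x * indicator (box a b) x = ennreal (G x)"
        "q x * indicator (box a b) x = ennreal (- G x)" for x
        by (auto simp: p_def q_def G_def indicator_def)
      ultimately show "emeasure (density lborel p) (box a b) = emeasure (density lborel q) (box a b)"
        "emeasure (density lborel p) (box a b) \<noteq> \<infinity>"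
        using fin by (auto simp: emeasure_density)
    qed
    have "density lborel p = density lborel q"
    proof (rule measure_eqI_generator_eq)
      let ?E = "range (\<lambda>(a, b). box a b::'a set)"
      show "Int_stable ?E"
        by (auto simp: Int_stable_def box_Int_box)
      show "?E \<subseteq> Pow UNIV" "sets (density lborel p) = sigma_sets UNIV ?E"
        "sets (density lborel q) = sigma_sets UNIV ?E"
        by (simp_all add: borel_eq_box)
      let ?A = "\<lambda>n::nat. box (- (real n *\<^sub>R One)) (real n *\<^sub>R One) :: 'a set"
      show "range ?A \<subseteq> ?E" "(\<Union>i. ?A i) = UNIV"
        unfolding UN_box_eq_UNIV by auto
      show "emeasure (density lborel p) (?A i) \<noteq> \<infinity>" for i
        by (rule fin)
      show "emeasure (density lborel p) X = emeasure (density lborel q) X" if "X \<in> ?E" for X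
        using that eq by auto
    qed
    then have "AE x in lborel. p x = q x"
      by (intro sigma_finite_measure.density_unique[OF sigma_finite_lborel]) auto
    then show ?thesis
    proof eventually_elim
      case (elim x)
      show ?case
      proof
        assume "x \<in> box c d"
        then have "ennreal (g x) = ennreal (- g x)"
          using elim by (simp add: p_def q_def)
        then show "g x = 0"
          by (cases "g x \<ge> 0") (auto simp: ennreal_neg dest: sym)
      qed
    qed
  qed
  have "AE x in lborel. x \<in> V \<longrightarrow> g x = 0"
  proof -
    obtain \<D> where \<D>: "countable \<D>" "\<D> \<subseteq> Pow V" "\<And>X. X \<in> \<D> \<Longrightarrow> \<exists>a b. X = cbox a b" "\<Union>\<D> = V"
      using open_countable_Union_open_cbox[OF \<open>open V\<close>] by metis
    have "AE x in lborel. x \<in> X \<longrightarrow> g x = 0" if X: "X \<in> \<D>" for X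
    proof -
      obtain a b where ab: "X = cbox a b"
        using \<D> X by blast
      \<comment> \<open>The open set is covered by closed boxes, while the vanishing is known on
        open ones; the faces between them are null.\<close>
      have "cbox a b - box a b \<in> null_sets lborel"
        using negligible_frontier_interval[of a b]
        by (simp add: negligible_iff_null_sets completion.complete2 null_sets_completion_iff)
      then have "AE x in lborel. x \<notin> cbox a b - box a b"
        by (rule AE_not_in)
      moreover have "AE x in lborel. x \<in> box a b \<longrightarrow> g x = 0"
        using box0 ab \<D>(2) X by blast
      ultimately show ?thesis
        by eventually_elim (auto simp: ab)
    qed
    then have "AE x in lborel. \<forall>X\<in>\<D>. x \<in> X \<longrightarrow> g x = 0"
      using \<D>(1) by (intro AE_ball_countable[THEN iffD2]) auto
    then show ?thesis
      by eventually_elim (use \<D>(4) in blast)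
  qed
  then have "AE x in lebesgue. x \<in> V \<longrightarrow> g x = 0"
    by (rule AE_completion)
  with hg' show ?thesis
    by eventually_elim auto
qed

text \<open>The difference of the two sides is the square of \<open>norm (a - b)\<close>. The
  inequality plays the part of the triangle inequality wherever only squared norms are
  integrated.\<close>

lemma power2_norm_add_le:
  fixes a b :: "'a::real_inner"
  shows "(norm (a + b))\<^sup>2 \<le> 2 * (norm a)\<^sup>2 + 2 * (norm b)\<^sup>2"
proof -
  have "0 \<le> (norm (a - b))\<^sup>2"
    by simp
  then show ?thesis
    by (simp add: power2_norm_eq_inner inner_simps inner_commute)
qed

section \<open>Square-integrable functions and their pairing\<close>

lemma L2_measurable: "u \<in> L2 \<Omega> \<Longrightarrow> u \<in> borel_measurable (lebesgue_on \<Omega>)"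
  by (simp add: L2_def)

lemma L2_integrable: "u \<in> L2 \<Omega> \<Longrightarrow> integrable (lebesgue_on \<Omega>) (\<lambda>x. (norm (u x))\<^sup>2)"
  by (simp add: L2_def)

lemma L2_scaleR: "u \<in> L2 \<Omega> \<Longrightarrow> (\<lambda>x. a *\<^sub>R u x) \<in> L2 \<Omega>"
  by (auto simp: L2_def power_mult_distrib)

lemma L2_add:
  assumes "u \<in> L2 \<Omega>" "v \<in> L2 \<Omega>"
  shows "(\<lambda>x. u x + v x) \<in> L2 \<Omega>"
proof -
  have "integrable (lebesgue_on \<Omega>) (\<lambda>x. 2 * (norm (u x))\<^sup>2 + 2 * (norm (v x))\<^sup>2)"
    using assms by (auto simp: L2_def)
  then have "integrable (lebesgue_on \<Omega>) (\<lambda>x. (norm (u x + v x))\<^sup>2)"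
    by (rule Bochner_Integration.integrable_bound)
      (use assms in \<open>auto simp: L2_def power2_norm_add_le intro!: AE_I2\<close>)
  then show ?thesis
    using assms by (auto simp: L2_def intro: borel_measurable_add)
qed

lemma L2_lincomb:
  fixes u v :: "real^'n \<Rightarrow> real"
  shows "u \<in> L2 \<Omega> \<Longrightarrow> v \<in> L2 \<Omega> \<Longrightarrow> (\<lambda>x. a * u x + b * v x) \<in> L2 \<Omega>"
  using L2_add[OF L2_scaleR[of u _ a] L2_scaleR[of v _ b]] by simp

lemma L2_nth: "g \<in> L2 \<Omega> \<Longrightarrow> (\<lambda>x. g x $ i) \<in> L2 \<Omega>"
  for g :: "real^'n \<Rightarrow> real^'m"
proof -
  assume g: "g \<in> L2 \<Omega>"
  have "(g x $ i)\<^sup>2 \<le> (norm (g x))\<^sup>2" for x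
    using component_le_norm_cart[of "g x" i] by (metis norm_ge_zero real_sqrt_abs real_sqrt_le_iff abs_of_nonneg)
  moreover have "(\<lambda>x. g x $ i) \<in> borel_measurable (lebesgue_on \<Omega>)"
    using L2_measurable[OF g] by (simp add: cart_eq_inner_axis borel_measurable_inner)
  ultimately have "integrable (lebesgue_on \<Omega>) (\<lambda>x. (norm (g x $ i))\<^sup>2)"
    by (intro Bochner_Integration.integrable_bound[OF L2_integrable[OF g]]) (auto intro!: AE_I2)
  then show ?thesis
    using \<open>(\<lambda>x. g x $ i) \<in> borel_measurable (lebesgue_on \<Omega>)\<close> by (simp add: L2_def)
qed

lemma integrable_norm_mult:
  assumes "u \<in> L2 \<Omega>" "v \<in> L2 \<Omega>"
  shows "integrable (lebesgue_on \<Omega>) (\<lambda>x. norm (u x) * norm (v x))"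
proof -
  have "norm (u x) * norm (v x) \<le> (norm (u x))\<^sup>2 + (norm (v x))\<^sup>2" for x
  proof -
    have "0 \<le> norm (u x) * norm (v x)"
      by simp
    then show ?thesis
      using sum_squares_bound[of "norm (u x)" "norm (v x)"] by linarith
  qed
  then show ?thesis
    using assms
    by (intro Bochner_Integration.integrable_bound[OF
          Bochner_Integration.integrable_add[OF L2_integrable[OF assms(1)] L2_integrable[OF assms(2)]]])
      (auto simp: L2_def intro!: AE_I2)
qed

lemma integrable_L2_mult:
  fixes u v :: "real^'n \<Rightarrow> real"
  assumes "u \<in> L2 \<Omega>" "v \<in> L2 \<Omega>"
  shows "integrable (lebesgue_on \<Omega>) (\<lambda>x. u x * v x)"
  using integrable_norm_mult[OF assms]
  by (rule Bochner_Integration.integrable_bound) (use assms in \<open>auto simp: L2_def abs_mult\<close>)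

lemma continuous_on_imp_L2:
  fixes f :: "real^'n \<Rightarrow> 'b::euclidean_space"
  assumes "compact \<Omega>" "continuous_on \<Omega> f"
  shows "f \<in> L2 \<Omega>"
proof -
  have f: "f \<in> borel_measurable (lebesgue_on \<Omega>)"
    using assms(2) lmeasurable_compact[OF assms(1)]
    by (intro continuous_imp_measurable_on_sets_lebesgue) (auto simp: fmeasurable_def)
  obtain B where B: "\<And>x. x \<in> \<Omega> \<Longrightarrow> norm (f x) \<le> B"
    using compact_imp_bounded[OF compact_continuous_image[OF assms(2,1)]]
    by (auto simp: bounded_iff)
  have "integrable (lebesgue_on \<Omega>) (\<lambda>x. (norm (f x))\<^sup>2)"
  proof (rule finite_measure.integrable_const_bound[where B="B\<^sup>2"])
    show "finite_measure (lebesgue_on \<Omega>)"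
      by (rule finite_measure_lebesgue_on[OF lmeasurable_compact[OF assms(1)]])
    show "AE x in lebesgue_on \<Omega>. norm ((norm (f x))\<^sup>2) \<le> B\<^sup>2"
      using B by (auto intro!: AE_I2 power_mono)
  qed (use f in measurable)
  then show ?thesis
    using f by (simp add: L2_def)
qed

lemma L2_inner_lincomb_left:
  assumes "u \<in> L2 \<Omega>" "v \<in> L2 \<Omega>" "w \<in> L2 \<Omega>"
  shows "L2_inner \<Omega> (\<lambda>x. a * u x + b * v x) w = a * L2_inner \<Omega> u w + b * L2_inner \<Omega> v w"
  using integrable_L2_mult[OF assms(1,3)] integrable_L2_mult[OF assms(2,3)]
  by (simp add: L2_inner_def distrib_right mult.assoc)

lemma L2_inner_commute: "L2_inner \<Omega> u v = L2_inner \<Omega> v u"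
  by (simp add: L2_inner_def mult.commute)

lemma L2_inner_lincomb_right:
  assumes "u \<in> L2 \<Omega>" "v \<in> L2 \<Omega>" "w \<in> L2 \<Omega>"
  shows "L2_inner \<Omega> w (\<lambda>x. a * u x + b * v x) = a * L2_inner \<Omega> w u + b * L2_inner \<Omega> w v"
  using L2_inner_lincomb_left[OF assms] by (simp add: L2_inner_commute)

section \<open>Weak gradients\<close>

text \<open>Leads from \<Omega> to the whole space, where the measure is translation
  invariant.\<close>

lemma integral_lebesgue_on_eq_lborel:
  fixes f :: "'a::euclidean_space \<Rightarrow> real"
  assumes "S \<in> sets lebesgue" "f \<in> borel_measurable borel" "\<And>x. x \<notin> S \<Longrightarrow> f x = 0"
  shows "(LINT x|lebesgue_on S. f x) = (LINT x|lborel. f x)"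
proof -
  have "(LINT x|lebesgue_on S. f x) = (LINT x|lebesgue. indicator S x *\<^sub>R f x)"
    using assms(1) by (intro integral_restrict_space) auto
  also have "\<dots> = (LINT x|lebesgue. f x)"
    using assms(3) by (intro Bochner_Integration.integral_cong) (auto simp: indicator_def)
  also have "\<dots> = (LINT x|lborel. f x)"
    using assms(2) by (intro integral_completion) simp
  finally show ?thesis .
qed

lemma frechet_derivative_eq_0_outside:
  assumes "closed K" "\<And>x. x \<notin> K \<Longrightarrow> f x = 0" "x \<notin> K"
  shows "frechet_derivative f (at x) = (\<lambda>_. 0)"
proof -
  have "((\<lambda>_. 0) has_derivative (\<lambda>_. 0)) (at x)"
    by simp
  then have "(f has_derivative (\<lambda>_. 0)) (at x)"
    by (rule has_derivative_transform_within_open[where s="- K"]) (use assms in auto)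
  then show ?thesis
    using frechet_derivative_at by metis
qed

lemma bounded_compact_support:
  fixes f :: "'a::topological_space \<Rightarrow> real"
  assumes "continuous_on K f" "compact K" "\<And>x. x \<notin> K \<Longrightarrow> f x = 0"
  obtains B where "B \<ge> 0" "\<And>x. \<bar>f x\<bar> \<le> B"
proof -
  have "bounded (f ` K)"
    using assms compact_continuous_image compact_imp_bounded by blast
  then obtain B where B: "B > 0" "\<And>x. x \<in> K \<Longrightarrow> \<bar>f x\<bar> \<le> B"
    by (auto simp: bounded_pos)
  then have "\<bar>f x\<bar> \<le> B" for x
    using assms(3)[of x] by (cases "x \<in> K") auto
  then show thesis
    using that[of B] B(1) by simp
qed

text \<open>
  By translation invariance the difference quotients have integral zero; dominated convergence
  carries this over to the derivative.
\<close>

lemma integral_directional_derivative_eq_0: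
  fixes F :: "'a::euclidean_space \<Rightarrow> real"
  assumes F: "Ck_on (Suc 0) F UNIV" and K: "compact K" and supp: "\<And>x. x \<notin> K \<Longrightarrow> F x = 0"
  shows "(LINT x|lborel. frechet_derivative F (at x) v) = 0"
proof -
  define D where "D x = frechet_derivative F (at x) v" for x
  have der: "(F has_derivative frechet_derivative F (at x)) (at x)" for x
    using F by (rule Ck_on_has_derivative)
  have contD: "continuous_on UNIV D" and contF: "continuous_on UNIV F"
    using F Ck_on_Suc_imp[OF F] by (auto simp: D_def[abs_def])
  have "D x = 0" if "x \<notin> K" for x
    using frechet_derivative_eq_0_outside[of K F x] that supp compact_imp_closed[OF K]
    by (simp add: D_def)
  then obtain B where B: "B \<ge> 0" "\<And>x. \<bar>D x\<bar> \<le> B"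
    using bounded_compact_support[OF continuous_on_subset[OF contD] K] by blast
  obtain r where r: "K \<subseteq> cball 0 r" "r > 0"
    using compact_imp_bounded[OF K] by (metis bounded_subset_ballD ball_subset_cball subset_trans)
  define h where "h n = 1 / real (Suc n)" for n
  have h: "h n > 0" "h n \<le> 1" for n
    by (auto simp: h_def)
  define q where "q n x = (F (h n *\<^sub>R v + x) - F x) / h n" for n x
  have [measurable]: "F \<in> borel_measurable borel" "D \<in> borel_measurable borel"
    using contF contD borel_measurable_continuous_onI by auto
  have intF: "integrable lborel F"
  proof -
    have "integrable lborel (\<lambda>x. indicator K x *\<^sub>R F x)"
      using K contF by (intro borel_integrable_compact) (auto intro: continuous_on_subset)
    moreover have "(\<lambda>x. indicator K x *\<^sub>R F x) = F"
    proof
      show "indicator K x *\<^sub>R F x = F x" for x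
        using supp by (cases "x \<in> K") auto
    qed
    ultimately show ?thesis
      by simp
  qed
  have "(LINT x|lborel. q n x) = 0" for n
  proof -
    have "integrable lborel (\<lambda>x. F (h n *\<^sub>R v + x))"
      "(LINT x|lborel. F (h n *\<^sub>R v + x)) = (LINT x|lborel. F x)"
      using lborel_distr_plus[of "h n *\<^sub>R v"] intF
        integrable_distr[of "(+) (h n *\<^sub>R v)" lborel borel F]
        integral_distr[of "(+) (h n *\<^sub>R v)" lborel borel F]
      by simp_all
    then show ?thesis
      using intF by (simp add: q_def)
  qed
  moreover have "(\<lambda>n. LINT x|lborel. q n x) \<longlonglongrightarrow> (LINT x|lborel. D x)"
  proof (rule integral_dominated_convergence)
    \<comment> \<open>As \<open>h n \<le> 1\<close>, both \<open>x\<close> and its translate lie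
      outside \<open>K\<close> when \<open>x\<close> is outside this ball, so a single ball supports
      all quotients.\<close>
    let ?C = "cball 0 (r + norm v) :: 'a set"
    show "integrable lborel (\<lambda>x. indicator ?C x *\<^sub>R B)"
      by (intro borel_integrable_compact) auto
    show "AE x in lborel. (\<lambda>n. q n x) \<longlonglongrightarrow> D x"
    proof (rule AE_I2)
      fix x
      have line: "((\<lambda>t. t *\<^sub>R v + x) has_derivative (\<lambda>t. t *\<^sub>R v)) (at 0)"
        by (auto intro!: derivative_eq_intros)
      have "((\<lambda>t. F (t *\<^sub>R v + x)) has_derivative (\<lambda>t. frechet_derivative F (at x) (t *\<^sub>R v))) (at 0)"
        using has_derivative_compose[OF line, of F "frechet_derivative F (at x)"] der by simp
      then have "((\<lambda>t. F (t *\<^sub>R v + x)) has_real_derivative D x) (at 0)"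
        using has_derivative_linear[OF der]
        by (simp add: has_field_derivative_def D_def linear_scale mult_commute_abs)
      then have "((\<lambda>t. (F (t *\<^sub>R v + x) - F x) / t) \<longlongrightarrow> D x) (at 0)"
        by (simp add: DERIV_def)
      moreover have "filterlim h (at 0) sequentially"
      proof -
        have "h \<longlonglongrightarrow> 0"
          unfolding h_def[abs_def] by (rule LIMSEQ_Suc[OF lim_1_over_n])
        then show ?thesis
          using h(1) by (auto simp: filterlim_at intro!: always_eventually less_imp_neq[THEN not_sym])
      qed
      ultimately show "(\<lambda>n. q n x) \<longlonglongrightarrow> D x"
        unfolding q_def by (rule filterlim_compose)
    qed
    show "AE x in lborel. norm (q n x) \<le> indicator ?C x *\<^sub>R B" for n
    proof (rule AE_I2)
      fix x
      show "norm (q n x) \<le> indicator ?C x *\<^sub>R B"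
      proof (cases "x \<in> ?C")
        case True
        have "((\<lambda>t. F (t *\<^sub>R v + x)) has_derivative
            (\<lambda>s. frechet_derivative F (at (t *\<^sub>R v + x)) (s *\<^sub>R v))) (at t within {0..h n})" for t
        proof -
          have line: "((\<lambda>t. t *\<^sub>R v + x) has_derivative (\<lambda>t. t *\<^sub>R v)) (at t within {0..h n})"
            by (auto intro!: derivative_eq_intros)
          show ?thesis
            by (rule has_derivative_compose[OF line, of F]) (rule der)
        qed
        \<comment> \<open>The mean value theorem turns the quotient into a value of \<open>D\<close>
          at an intermediate point, which \<open>B\<close> bounds for all \<open>n\<close> at
          once.\<close>
        then obtain t where "F (h n *\<^sub>R v + x) - F (0 *\<^sub>R v + x) =
            frechet_derivative F (at (t *\<^sub>R v + x)) ((h n - 0) *\<^sub>R v)"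
          using mvt_simple[OF h(1)] by meson
        then have "F (h n *\<^sub>R v + x) - F x = h n * D (t *\<^sub>R v + x)"
          using has_derivative_linear[OF der] by (simp add: D_def linear_scale)
        then have "q n x = D (t *\<^sub>R v + x)"
          using h(1)[of n] by (simp add: q_def)
        then show ?thesis
          using True B by simp
      next
        case False
        have "norm (h n *\<^sub>R v) \<le> norm v"
          using h[of n] by (simp add: mult_left_le_one_le)
        moreover have "norm x > r + norm v"
          using False by simp
        moreover have "norm x \<le> norm (h n *\<^sub>R v + x) + norm (h n *\<^sub>R v)"
          using norm_triangle_ineq4[of "h n *\<^sub>R v + x" "h n *\<^sub>R v"] by simp
        ultimately have "norm x > r" "norm (h n *\<^sub>R v + x) > r"
          using norm_ge_zero[of v] by linarith+
        then have "x \<notin> K" "h n *\<^sub>R v + x \<notin> K"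
          using r(1) by auto
        then show ?thesis
          using False supp by (simp add: q_def)
      qed
    qed
  qed (auto simp: q_def[abs_def])
  ultimately have "(\<lambda>n. 0) \<longlonglongrightarrow> (LINT x|lborel. D x)"
    by simp
  then show ?thesis
    by (simp add: LIMSEQ_const_iff D_def[abs_def])
qed

section \<open>Test functions and integration by parts\<close>

lemma test_function_smooth: "test_function \<Omega> \<phi> \<Longrightarrow> smooth_on \<phi> UNIV"
  by (simp add: test_function_def)

lemma test_function_continuous: "test_function \<Omega> \<phi> \<Longrightarrow> continuous_on S \<phi>"
  using smooth_onD[OF test_function_smooth, of \<Omega> \<phi> 0] by (auto intro: continuous_on_subset)

lemma test_function_derivative_continuous:
  "test_function \<Omega> \<phi> \<Longrightarrow> continuous_on S (\<lambda>x. frechet_derivative \<phi> (at x) v)"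
  using smooth_onD[OF test_function_smooth, of \<Omega> \<phi> "Suc 0"] by (auto intro: continuous_on_subset)

lemma test_function_eq_0:
  assumes "test_function \<Omega> \<phi>" "x \<notin> closure {x. \<phi> x \<noteq> 0}"
  shows "\<phi> x = 0" "frechet_derivative \<phi> (at x) = (\<lambda>_. 0)"
  using assms closure_subset[of "{x. \<phi> x \<noteq> 0}"]
  by (auto intro!: frechet_derivative_eq_0_outside[of "closure {x. \<phi> x \<noteq> 0}"])

lemma test_function_cmult:
  assumes "test_function \<Omega> \<phi>" shows "test_function \<Omega> (\<lambda>x. a * \<phi> x)"
proof -
  have "closure {x. a * \<phi> x \<noteq> 0} \<subseteq> closure {x. \<phi> x \<noteq> 0}"
    by (rule closure_mono) auto
  then show ?thesis
    using assms compact_Int_closed[of "closure {x. \<phi> x \<noteq> 0}" "closure {x. a * \<phi> x \<noteq> 0}"]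
    by (auto simp: test_function_def inf.absorb2 intro: smooth_on_mult smooth_on_const)
qed

lemma test_function_add:
  assumes "test_function \<Omega> \<phi>" "test_function \<Omega> \<psi>" shows "test_function \<Omega> (\<lambda>x. \<phi> x + \<psi> x)"
proof -
  let ?K = "closure {x. \<phi> x \<noteq> 0} \<union> closure {x. \<psi> x \<noteq> 0}"
  have "closure {x. \<phi> x + \<psi> x \<noteq> 0} \<subseteq> closure ({x. \<phi> x \<noteq> 0} \<union> {x. \<psi> x \<noteq> 0})"
    by (rule closure_mono) auto
  then have "closure {x. \<phi> x + \<psi> x \<noteq> 0} \<subseteq> ?K"
    by simp
  moreover have "compact ?K" "?K \<subseteq> interior \<Omega>"
    using assms by (auto simp: test_function_def)
  ultimately show ?thesis
    using assms compact_Int_closed[of ?K "closure {x. \<phi> x + \<psi> x \<noteq> 0}"]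
    by (auto simp: test_function_def inf.absorb2 intro: smooth_on_add)
qed

lemma test_function_L2:
  assumes "compact \<Omega>" "test_function \<Omega> \<phi>"
  shows "\<phi> \<in> L2 \<Omega>" "(\<lambda>x. frechet_derivative \<phi> (at x) v) \<in> L2 \<Omega>"
  using assms
  by (auto intro!: continuous_on_imp_L2 test_function_continuous test_function_derivative_continuous)

text \<open>The product of two test functions is smooth with compact support, so its directional
  derivative has integral zero; the product rule splits this integral into the two sides.\<close>

lemma test_function_integral_by_parts:
  fixes \<Omega> :: "(real^'n) set"
  assumes \<Omega>: "compact \<Omega>" and \<phi>: "test_function \<Omega> \<phi>" and \<psi>: "test_function \<Omega> \<psi>"
  shows "(LINT x|lebesgue_on \<Omega>. \<phi> x * frechet_derivative \<psi> (at x) v) =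
    - (LINT x|lebesgue_on \<Omega>. frechet_derivative \<phi> (at x) v * \<psi> x)"
proof -
  let ?K = "closure {x. \<phi> x \<noteq> 0}"
  define D where "D x = \<phi> x * frechet_derivative \<psi> (at x) v + frechet_derivative \<phi> (at x) v * \<psi> x" for x
  have smooth: "smooth_on (\<lambda>x. \<phi> x * \<psi> x) UNIV"
    using \<phi> \<psi> by (intro smooth_on_mult test_function_smooth)
  have "((\<lambda>x. \<phi> x * \<psi> x) has_derivative
      (\<lambda>v. \<phi> x * frechet_derivative \<psi> (at x) v + frechet_derivative \<phi> (at x) v * \<psi> x)) (at x)" for x
    using \<phi> \<psi> by (intro has_derivative_mult Ck_on_has_derivative[of 0] smooth_onD test_function_smooth)
  note frechet_derivative_at[OF this, symmetric, THEN fun_cong]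
  then have D: "frechet_derivative (\<lambda>x. \<phi> x * \<psi> x) (at x) v = D x" for x
    by (simp add: D_def)
  have K: "compact ?K" "?K \<subseteq> \<Omega>"
    using \<phi> interior_subset by (auto simp: test_function_def)
  have "continuous_on UNIV D"
    unfolding D_def[abs_def] using \<phi> \<psi>
    by (intro continuous_intros test_function_continuous test_function_derivative_continuous)
  moreover have "D x = 0" if "x \<notin> \<Omega>" for x
  proof -
    have "x \<notin> ?K"
      using K that by blast
    from test_function_eq_0[OF \<phi> this] show ?thesis
      by (simp add: D_def)
  qed
  ultimately have "(LINT x|lebesgue_on \<Omega>. D x) = (LINT x|lborel. D x)"
    using lmeasurable_compact[OF \<Omega>] borel_measurable_continuous_onI
    by (intro integral_lebesgue_on_eq_lborel) (auto simp: fmeasurable_def)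
  also have "\<dots> = 0"
  proof -
    have "\<phi> x * \<psi> x = 0" if "x \<notin> ?K" for x
      using test_function_eq_0(1)[OF \<phi> that] by simp
    from integral_directional_derivative_eq_0[OF smooth_onD[OF smooth] K(1) this, of v]
    show ?thesis
      by (simp add: D)
  qed
  finally have "(LINT x|lebesgue_on \<Omega>. D x) = 0" .
  moreover have "(LINT x|lebesgue_on \<Omega>. D x) =
    (LINT x|lebesgue_on \<Omega>. \<phi> x * frechet_derivative \<psi> (at x) v) +
    (LINT x|lebesgue_on \<Omega>. frechet_derivative \<phi> (at x) v * \<psi> x)"
    unfolding D_def using \<Omega> \<phi> \<psi>
    by (intro Bochner_Integration.integral_add integrable_L2_mult test_function_L2)
  ultimately show ?thesis
    by simp
qed

lemma weak_gradient_test_function: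
  fixes \<Omega> :: "(real^'n) set"
  assumes "compact \<Omega>" "test_function \<Omega> \<phi>"
  shows "weak_gradient \<Omega> \<phi> (\<lambda>x. \<chi> i. frechet_derivative \<phi> (at x) (axis i 1))"
  using test_function_integral_by_parts[OF assms] by (simp add: weak_gradient_def)

text \<open>Makes the errors \<open>u - \<phi>\<close> in the definition of \<open>H1_0\<close>
  elements of \<open>H1\<close>, so that norm estimates apply to them.\<close>

lemma test_function_in_H1:
  fixes \<Omega> :: "(real^'n) set"
  assumes "compact \<Omega>" "test_function \<Omega> \<phi>"
  shows "\<phi> \<in> H1 \<Omega>"
proof -
  have "(\<lambda>x. \<chi> i. frechet_derivative \<phi> (at x) (axis i 1)) \<in> L2 \<Omega>"
    using assms by (intro continuous_on_imp_L2 continuous_intros test_function_derivative_continuous)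
  then show ?thesis
    using weak_gradient_test_function[OF assms] test_function_L2(1)[OF assms] by (auto simp: H1_def)
qed

lemma wgrad_works:
  assumes "u \<in> H1 \<Omega>"
  shows "wgrad \<Omega> u \<in> L2 \<Omega>" "weak_gradient \<Omega> u (wgrad \<Omega> u)"
proof -
  have "\<exists>g. g \<in> L2 \<Omega> \<and> weak_gradient \<Omega> u g"
    using assms by (auto simp: H1_def)
  then show "wgrad \<Omega> u \<in> L2 \<Omega>" "weak_gradient \<Omega> u (wgrad \<Omega> u)"
    unfolding wgrad_def by (metis (mono_tags, lifting) someI_ex)+
qed

lemma H1_imp_L2: "u \<in> H1 \<Omega> \<Longrightarrow> u \<in> L2 \<Omega>"
  by (simp add: H1_def)

text \<open>The fundamental lemma of the calculus of variations. Bumps converge to the indicator of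
  a box, with \<open>\<bar>d\<bar>\<close> as dominating function, so the integrals of
  \<open>d\<close> over boxes inside the open interior vanish; what is left of \<Omega> is its
  boundary, a null set.\<close>

lemma AE_eq_0_if_test_integrals_eq_0:
  fixes d :: "real^'n \<Rightarrow> real"
  assumes \<Omega>: "smooth_compact_domain \<Omega>" and d: "integrable (lebesgue_on \<Omega>) d"
    and test: "\<And>\<phi>. test_function \<Omega> \<phi> \<Longrightarrow> (LINT x|lebesgue_on \<Omega>. d x * \<phi> x) = 0"
  shows "AE x in lebesgue_on \<Omega>. d x = 0"
proof -
  have "compact \<Omega>"
    using \<Omega> by (simp add: smooth_compact_domain_def)
  then have meas: "\<Omega> \<in> sets lebesgue"
    using lmeasurable_compact fmeasurableD by blast
  define h where "h x = indicator \<Omega> x *\<^sub>R d x" for x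
  have h: "integrable lebesgue h"
    using d meas by (simp add: h_def[abs_def] integrable_restrict_space)
  have "AE x in lebesgue. x \<in> interior \<Omega> \<longrightarrow> h x = 0"
  proof (rule AE_eq_0_if_box_integrals_eq_0[OF h open_interior])
    fix a b assume ab: "cbox a b \<subseteq> interior \<Omega>"
    have m: "box_bump a b n \<in> borel_measurable (lebesgue_on \<Omega>)" for n
      using test_function_continuous[OF test_function_box_bump[OF ab]] meas
      by (rule continuous_imp_measurable_on_sets_lebesgue)
    have m': "(\<lambda>x. d x * indicator (box a b) x) \<in> borel_measurable (lebesgue_on \<Omega>)"
      by (rule borel_measurable_times[OF borel_measurable_integrable[OF d]],
          rule measurable_restrict_space1, rule borel_measurable_indicator) simp
    have "(\<lambda>n. LINT x|lebesgue_on \<Omega>. d x * box_bump a b n x) \<longlonglongrightarrow>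
      (LINT x|lebesgue_on \<Omega>. d x * indicator (box a b) x)"
    proof (rule integral_dominated_convergence[where w="\<lambda>x. \<bar>d x\<bar>"])
      show "AE x in lebesgue_on \<Omega>. (\<lambda>n. d x * box_bump a b n x) \<longlonglongrightarrow> d x * indicator (box a b) x"
        by (intro AE_I2 tendsto_intros box_bump_tendsto)
      show "AE x in lebesgue_on \<Omega>. norm (d x * box_bump a b n x) \<le> \<bar>d x\<bar>" for n
        by (intro AE_I2) (simp add: abs_mult mult_left_le box_bump_bounds)
    qed (use d m m' in \<open>auto intro: borel_measurable_times\<close>)
    then have "(LINT x|lebesgue_on \<Omega>. d x * indicator (box a b) x) = 0"
      using test[OF test_function_box_bump[OF ab]] by (simp add: LIMSEQ_const_iff)
    then show "(LINT x|lebesgue. indicator (box a b) x * h x) = 0"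
      using meas by (simp add: h_def integral_restrict_space mult_ac)
  qed
  moreover have "AE x in lebesgue. x \<notin> frontier \<Omega>"
    using negligible_frontier_smooth_domain[OF \<Omega>] by (simp add: AE_not_in negligible_iff_null_sets)
  ultimately have "AE x in lebesgue. x \<in> \<Omega> \<longrightarrow> d x = 0"
  proof eventually_elim
    case (elim x)
    then show ?case
      using closure_subset[of \<Omega>] by (auto simp: frontier_def h_def)
  qed
  then show ?thesis
    using meas by (subst AE_restrict_space_iff) auto
qed

lemma weak_gradient_unique:
  assumes \<Omega>: "smooth_compact_domain \<Omega>" and "g \<in> L2 \<Omega>" "k \<in> L2 \<Omega>"
    and "weak_gradient \<Omega> u g" "weak_gradient \<Omega> u k"
  shows "AE x in lebesgue_on \<Omega>. g x = k x"
proof -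
  have "compact \<Omega>"
    using \<Omega> by (simp add: smooth_compact_domain_def)
  have "AE x in lebesgue_on \<Omega>. g x $ i - k x $ i = 0" for i
  proof (rule AE_eq_0_if_test_integrals_eq_0[OF \<Omega>])
    \<comment> \<open>On a compact set the constant 1 is square-integrable, and pairing with it
      shows that square-integrable functions are integrable.\<close>
    have one: "(\<lambda>_. 1) \<in> L2 \<Omega>"
      using \<open>compact \<Omega>\<close> by (intro continuous_on_imp_L2) auto
    show "integrable (lebesgue_on \<Omega>) (\<lambda>x. g x $ i - k x $ i)"
      using integrable_L2_mult[OF L2_nth[OF assms(2)] one] integrable_L2_mult[OF L2_nth[OF assms(3)] one]
      by simp
    fix \<phi> assume \<phi>: "test_function \<Omega> \<phi>"
    have "integrable (lebesgue_on \<Omega>) (\<lambda>x. g x $ i * \<phi> x)" "integrable (lebesgue_on \<Omega>) (\<lambda>x. k x $ i * \<phi> x)"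
      using assms(2,3) test_function_L2(1)[OF \<open>compact \<Omega>\<close> \<phi>] by (auto intro: integrable_L2_mult L2_nth)
    moreover have "(LINT x|lebesgue_on \<Omega>. g x $ i * \<phi> x) = (LINT x|lebesgue_on \<Omega>. k x $ i * \<phi> x)"
      using assms(4,5)[unfolded weak_gradient_def, rule_format, OF \<phi>, of i] by simp
    ultimately show "(LINT x|lebesgue_on \<Omega>. (g x $ i - k x $ i) * \<phi> x) = 0"
      by (simp add: left_diff_distrib)
  qed
  then have "AE x in lebesgue_on \<Omega>. \<forall>i. g x $ i - k x $ i = 0"
    by (simp add: AE_all_countable)
  then show ?thesis
    by eventually_elim (simp add: vec_eq_iff)
qed

lemma weak_gradient_lincomb:
  assumes \<Omega>: "compact \<Omega>" and L2: "u \<in> L2 \<Omega>" "v \<in> L2 \<Omega>" "g \<in> L2 \<Omega>" "k \<in> L2 \<Omega>"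
    and "weak_gradient \<Omega> u g" "weak_gradient \<Omega> v k"
  shows "weak_gradient \<Omega> (\<lambda>x. a * u x + b * v x) (\<lambda>x. a *\<^sub>R g x + b *\<^sub>R k x)"
  unfolding weak_gradient_def
proof (intro allI impI)
  fix \<phi> i assume \<phi>: "test_function \<Omega> \<phi>"
  note intg = integrable_L2_mult[OF L2(1) test_function_L2(2)[OF \<Omega> \<phi>]]
    integrable_L2_mult[OF L2(2) test_function_L2(2)[OF \<Omega> \<phi>]]
    integrable_L2_mult[OF L2_nth[OF L2(3)] test_function_L2(1)[OF \<Omega> \<phi>]]
    integrable_L2_mult[OF L2_nth[OF L2(4)] test_function_L2(1)[OF \<Omega> \<phi>]]
  have "(LINT x|lebesgue_on \<Omega>. u x * frechet_derivative \<phi> (at x) (axis i 1)) = - (LINT x|lebesgue_on \<Omega>. g x $ i * \<phi> x)"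
    "(LINT x|lebesgue_on \<Omega>. v x * frechet_derivative \<phi> (at x) (axis i 1)) = - (LINT x|lebesgue_on \<Omega>. k x $ i * \<phi> x)"
    using assms(6,7) \<phi> by (auto simp: weak_gradient_def)
  then show "(LINT x|lebesgue_on \<Omega>. (a * u x + b * v x) * frechet_derivative \<phi> (at x) (axis i 1)) =
      - (LINT x|lebesgue_on \<Omega>. (a *\<^sub>R g x + b *\<^sub>R k x) $ i * \<phi> x)"
    using intg by (simp add: distrib_right mult.assoc)
qed

lemma H1_lincomb:
  assumes \<Omega>: "smooth_compact_domain \<Omega>" and "u \<in> H1 \<Omega>" "v \<in> H1 \<Omega>"
  shows "(\<lambda>x. a * u x + b * v x) \<in> H1 \<Omega>"
    and "AE x in lebesgue_on \<Omega>. wgrad \<Omega> (\<lambda>x. a * u x + b * v x) x = a *\<^sub>R wgrad \<Omega> u x + b *\<^sub>R wgrad \<Omega> v x"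
proof -
  have "compact \<Omega>"
    using \<Omega> by (simp add: smooth_compact_domain_def)
  let ?g = "\<lambda>x. a *\<^sub>R wgrad \<Omega> u x + b *\<^sub>R wgrad \<Omega> v x"
  have g: "?g \<in> L2 \<Omega>" "weak_gradient \<Omega> (\<lambda>x. a * u x + b * v x) ?g"
    using assms wgrad_works \<open>compact \<Omega>\<close>
    by (auto intro!: L2_add L2_scaleR weak_gradient_lincomb H1_imp_L2)
  then show H1: "(\<lambda>x. a * u x + b * v x) \<in> H1 \<Omega>"
    using assms by (auto simp: H1_def intro!: L2_lincomb)
  show "AE x in lebesgue_on \<Omega>. wgrad \<Omega> (\<lambda>x. a * u x + b * v x) x = ?g x"
    using weak_gradient_unique[OF \<Omega> wgrad_works(1)[OF H1] g(1) wgrad_works(2)[OF H1] g(2)] .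
qed

lemma H1_norm_power2:
  "(H1_norm \<Omega> u)\<^sup>2 = (LINT x|lebesgue_on \<Omega>. (u x)\<^sup>2) + (LINT x|lebesgue_on \<Omega>. (norm (wgrad \<Omega> u x))\<^sup>2)"
  by (simp add: H1_norm_def)

lemma H1_norm_nonneg: "0 \<le> H1_norm \<Omega> u"
  by (simp add: H1_norm_def)

text \<open>A crude bound in place of the triangle inequality; it is sharp enough for showing that
  \<open>H1_0\<close> is closed under linear combinations.\<close>

lemma H1_norm_lincomb_le:
  assumes \<Omega>: "smooth_compact_domain \<Omega>" and u: "u \<in> H1 \<Omega>" and v: "v \<in> H1 \<Omega>"
  shows "(H1_norm \<Omega> (\<lambda>x. a * u x + b * v x))\<^sup>2 \<le> 2 * a\<^sup>2 * (H1_norm \<Omega> u)\<^sup>2 + 2 * b\<^sup>2 * (H1_norm \<Omega> v)\<^sup>2"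
proof -
  let ?M = "lebesgue_on \<Omega>"
  note int1 = L2_integrable[OF H1_imp_L2[OF u]] L2_integrable[OF H1_imp_L2[OF v]]
  note int2 = L2_integrable[OF wgrad_works(1)[OF u]] L2_integrable[OF wgrad_works(1)[OF v]]
  note H1 = H1_lincomb[OF \<Omega> u v, of a b]
  have "(LINT x|?M. (a * u x + b * v x)\<^sup>2) \<le> (LINT x|?M. 2 * a\<^sup>2 * (u x)\<^sup>2 + 2 * b\<^sup>2 * (v x)\<^sup>2)"
  proof (rule integral_mono)
    show "(a * u x + b * v x)\<^sup>2 \<le> 2 * a\<^sup>2 * (u x)\<^sup>2 + 2 * b\<^sup>2 * (v x)\<^sup>2" for x
      using power2_norm_add_le[of "a * u x" "b * v x"] by (simp add: power_mult_distrib)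
  qed (use int1 L2_integrable[OF H1_imp_L2[OF H1(1)]] in auto)
  moreover have "(LINT x|?M. (norm (wgrad \<Omega> (\<lambda>x. a * u x + b * v x) x))\<^sup>2) \<le>
      (LINT x|?M. 2 * a\<^sup>2 * (norm (wgrad \<Omega> u x))\<^sup>2 + 2 * b\<^sup>2 * (norm (wgrad \<Omega> v x))\<^sup>2)"
  proof (rule integral_mono_AE)
    show "AE x in ?M. (norm (wgrad \<Omega> (\<lambda>x. a * u x + b * v x) x))\<^sup>2 \<le>
      2 * a\<^sup>2 * (norm (wgrad \<Omega> u x))\<^sup>2 + 2 * b\<^sup>2 * (norm (wgrad \<Omega> v x))\<^sup>2"
      using H1(2)
    proof eventually_elim
      case (elim x)
      then show ?case
        using power2_norm_add_le[of "a *\<^sub>R wgrad \<Omega> u x" "b *\<^sub>R wgrad \<Omega> v x"]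
        by (simp add: power_mult_distrib)
    qed
  qed (use int2 L2_integrable[OF wgrad_works(1)[OF H1(1)]] in auto)
  ultimately show ?thesis
    using int1 int2 by (simp add: H1_norm_power2 algebra_simps)
qed

lemma H1_0_lincomb:
  assumes \<Omega>: "smooth_compact_domain \<Omega>" and "u \<in> H1_0 \<Omega>" "v \<in> H1_0 \<Omega>"
  shows "(\<lambda>x. a * u x + b * v x) \<in> H1_0 \<Omega>"
proof -
  have "compact \<Omega>"
    using \<Omega> by (simp add: smooth_compact_domain_def)
  have uv: "u \<in> H1 \<Omega>" "v \<in> H1 \<Omega>"
    using assms by (auto simp: H1_0_def)
  have "\<exists>\<phi>. test_function \<Omega> \<phi> \<and> H1_norm \<Omega> (\<lambda>x. a * u x + b * v x - \<phi> x) < e" if "e > 0" for e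
  proof -
    \<comment> \<open>The first two summands are the coefficients of
      \<open>H1_norm_lincomb_le\<close>. The 1 makes the final estimate strict and keeps
      \<open>C\<close> positive when \<open>a\<close> and \<open>b\<close> vanish;
      \<open>\<delta>\<close> is then fixed by
      \<open>C * \<delta>\<^sup>2 = e\<^sup>2\<close>.\<close>
    define C where "C = 2 * a\<^sup>2 + 2 * b\<^sup>2 + 1"
    have "C > 0"
      by (auto simp: C_def intro: add_nonneg_pos)
    define \<delta> where "\<delta> = e / sqrt C"
    have "\<delta> > 0"
      using \<open>e > 0\<close> \<open>C > 0\<close> by (simp add: \<delta>_def)
    obtain \<phi> \<psi> where test: "test_function \<Omega> \<phi>" "test_function \<Omega> \<psi>"
      and close: "H1_norm \<Omega> (\<lambda>x. u x - \<phi> x) < \<delta>" "H1_norm \<Omega> (\<lambda>x. v x - \<psi> x) < \<delta>"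
      using assms(2,3) \<open>\<delta> > 0\<close> unfolding H1_0_def by blast
    let ?u = "\<lambda>x. u x - \<phi> x" and ?v = "\<lambda>x. v x - \<psi> x"
    have H1: "?u \<in> H1 \<Omega>" "?v \<in> H1 \<Omega>"
      using H1_lincomb(1)[OF \<Omega> uv(1) test_function_in_H1[OF \<open>compact \<Omega>\<close> test(1)], of 1 "-1"]
        H1_lincomb(1)[OF \<Omega> uv(2) test_function_in_H1[OF \<open>compact \<Omega>\<close> test(2)], of 1 "-1"] by simp_all
    note sq = power_mono[OF less_imp_le[OF close(1)] H1_norm_nonneg, of 2]
      power_mono[OF less_imp_le[OF close(2)] H1_norm_nonneg, of 2]
    have "(H1_norm \<Omega> (\<lambda>x. a * ?u x + b * ?v x))\<^sup>2 \<le> 2 * a\<^sup>2 * \<delta>\<^sup>2 + 2 * b\<^sup>2 * \<delta>\<^sup>2"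
      by (rule order_trans[OF H1_norm_lincomb_le[OF \<Omega> H1]])
        (intro add_mono mult_left_mono sq; simp)
    also have "\<dots> < C * \<delta>\<^sup>2"
      using \<open>\<delta> > 0\<close> by (simp add: C_def algebra_simps)
    also have "\<dots> = e\<^sup>2"
      using \<open>C > 0\<close> by (simp add: \<delta>_def power_divide)
    finally have "H1_norm \<Omega> (\<lambda>x. a * ?u x + b * ?v x) < e"
      by (rule power_less_imp_less_base) (use \<open>e > 0\<close> in simp)
    then show ?thesis
      using test_function_add[OF test_function_cmult[OF test(1), of a] test_function_cmult[OF test(2), of b]]
      by (intro exI[of _ "\<lambda>x. a * \<phi> x + b * \<psi> x"]) (simp add: algebra_simps)
  qed
  then show ?thesis
    using H1_lincomb(1)[OF \<Omega> uv] by (auto simp: H1_0_def)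
qed

section \<open>Perturbation of inverse matrices\<close>

text \<open>The norm of a matrix, as a vector of its rows, is the Frobenius norm; Cauchy-Schwarz in
  each row gives the bound.\<close>

lemma norm_matrix_vector_mult_le:
  fixes A :: "real^'n^'m"
  shows "norm (A *v x) \<le> norm A * norm x"
proof -
  have "norm (A *v x) \<le> L2_set (\<lambda>i. norm x * norm (A $ i)) UNIV"
    unfolding norm_vec_def[of "A *v x"]
    using Cauchy_Schwarz_ineq2[of "A $ i" x for i]
    by (intro L2_set_mono) (auto simp: matrix_vector_mul_component mult.commute[of "norm x"])
  also have "\<dots> = norm A * norm x"
    by (simp add: norm_vec_def[of A] L2_set_right_distrib mult.commute)
  finally show ?thesis .
qed

lemma norm_transpose:
  fixes A :: "real^'n^'m"
  shows "norm (transpose A) = norm A"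
  by (simp add: norm_vec_def L2_set_def transpose_def sum_nonneg) (rule sum.swap)

text \<open>Row \<open>i\<close> of the product is \<open>transpose B\<close> applied to row
  \<open>i\<close> of \<open>A\<close>, so the bound for vectors is summed over the rows.\<close>

lemma norm_matrix_matrix_mult_le:
  fixes A :: "real^'n^'m" and B :: "real^'k^'n"
  shows "norm (A ** B) \<le> norm A * norm B"
proof -
  have row: "(A ** B) $ i = transpose B *v (A $ i)" for i
    by (simp add: vec_eq_iff matrix_matrix_mult_def vector_matrix_mult_def mult.commute)
  have "norm (A ** B) \<le> L2_set (\<lambda>i. norm B * norm (A $ i)) UNIV"
    unfolding norm_vec_def[of "A ** B"] row
    using norm_matrix_vector_mult_le[of "transpose B"] by (intro L2_set_mono) (auto simp: norm_transpose)
  also have "\<dots> = norm A * norm B"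
    by (simp add: norm_vec_def[of A] L2_set_right_distrib mult.commute)
  finally show ?thesis .
qed

lemma bounded_bilinear_matrix_matrix_mult:
  "bounded_bilinear ((**) :: real^'n^'m \<Rightarrow> real^'k^'n \<Rightarrow> real^'k^'m)"
proof
  show "\<exists>K. \<forall>a b. norm (a ** b) \<le> norm (a :: real^'n^'m) * norm (b :: real^'k^'n) * K"
    using norm_matrix_matrix_mult_le by (intro exI[of _ 1]) auto
qed (auto simp: vec_eq_iff matrix_matrix_mult_def distrib_left distrib_right sum.distrib
    sum_distrib_left mult_ac)

lemma bounded_linear_transpose: "bounded_linear (transpose :: real^'n^'m \<Rightarrow> real^'m^'n)"
proof
  show "\<exists>K. \<forall>a. norm (transpose a) \<le> norm (a :: real^'n^'m) * K"
    by (intro exI[of _ 1]) (auto simp: norm_transpose)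
qed (auto simp: vec_eq_iff transpose_def)

lemmas uniform_limit_matrix_mult = bounded_bilinear.bounded_uniform_limit[OF bounded_bilinear_matrix_matrix_mult]
lemmas continuous_on_matrix_mult = bounded_bilinear.continuous_on[OF bounded_bilinear_matrix_matrix_mult]
lemmas uniform_limit_transpose = bounded_linear.uniform_limit[OF bounded_linear_transpose]
lemmas continuous_on_transpose = bounded_linear.continuous_on[OF bounded_linear_transpose]
lemmas matrix_mult_diff_left = bounded_bilinear.diff_left[OF bounded_bilinear_matrix_matrix_mult]
lemmas matrix_mult_diff_right = bounded_bilinear.diff_right[OF bounded_bilinear_matrix_matrix_mult]
lemmas matrix_mult_minus_left = bounded_bilinear.minus_left[OF bounded_bilinear_matrix_matrix_mult]
lemmas matrix_mult_minus_right = bounded_bilinear.minus_right[OF bounded_bilinear_matrix_matrix_mult]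
lemmas matrix_mult_scaleR_left = bounded_bilinear.scaleR_left[OF bounded_bilinear_matrix_matrix_mult]
lemmas matrix_mult_scaleR_right = bounded_bilinear.scaleR_right[OF bounded_bilinear_matrix_matrix_mult]
lemmas transpose_diff = linear_diff[OF bounded_linear.linear[OF bounded_linear_transpose]]
lemmas transpose_minus = linear_neg[OF bounded_linear.linear[OF bounded_linear_transpose]]

lemma matrix_inv_right_left:
  fixes A :: "real^'n^'n"
  assumes "invertible A"
  shows "A ** matrix_inv A = mat 1" "matrix_inv A ** A = mat 1"
proof -
  have "\<exists>B. A ** B = mat 1 \<and> B ** A = mat 1"
    using assms by (simp add: invertible_def)
  from someI_ex[OF this] show "A ** matrix_inv A = mat 1" "matrix_inv A ** A = mat 1"
    by (simp_all add: matrix_inv_def)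
qed

lemma matrix_inv_eqI:
  fixes A :: "real^'n^'n"
  assumes "B ** A = mat 1"
  shows "matrix_inv A = B"
proof -
  have "invertible A"
    using assms invertible_left_inverse by blast
  then have "matrix_inv A = B ** A ** matrix_inv A"
    using assms by simp
  then show ?thesis
    using matrix_inv_right_left(1)[OF \<open>invertible A\<close>] by (simp flip: matrix_mul_assoc)
qed

text \<open>This factorization reduces the differentiation of the inverse Gram matrix to that of
  \<open>matrix_inv A\<close>, and it makes the symmetry of the dynamic matrix visible.\<close>

lemma matrix_inv_transpose_mult:
  fixes A :: "real^'n^'n"
  assumes "invertible A"
  shows "matrix_inv (transpose A ** A) = matrix_inv A ** transpose (matrix_inv A)"
proof (rule matrix_inv_eqI)
  have "transpose (matrix_inv A) ** transpose A = mat 1"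
    using matrix_inv_right_left(1)[OF assms] by (metis matrix_transpose_mul transpose_mat)
  then have "matrix_inv A ** transpose (matrix_inv A) ** (transpose A ** A) = matrix_inv A ** mat 1 ** A"
    by (metis matrix_mul_assoc)
  then show "matrix_inv A ** transpose (matrix_inv A) ** (transpose A ** A) = mat 1"
    using matrix_inv_right_left(2)[OF assms] by simp
qed

text \<open>The resolvent identity: divided by a step size, it expresses the quotient of the
  inverses exactly through the quotient of the matrices.\<close>

lemma matrix_inv_diff:
  fixes A B :: "real^'n^'n"
  assumes "invertible A" "invertible B"
  shows "matrix_inv B - matrix_inv A = - (matrix_inv B ** (B - A) ** matrix_inv A)"
proof -
  have "matrix_inv B ** (B - A) ** matrix_inv A =
      matrix_inv B ** B ** matrix_inv A - matrix_inv B ** (A ** matrix_inv A)"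
    by (simp add: matrix_mult_diff_left matrix_mult_diff_right matrix_mul_assoc)
  then show ?thesis
    using matrix_inv_right_left[OF assms(1)] matrix_inv_right_left[OF assms(2)] by simp
qed

text \<open>The identity for \<open>B\<^sup>-\<^sup>1 - A\<^sup>-\<^sup>1\<close> first yields \<open>\<parallel>B\<^sup>-\<^sup>1\<parallel> \<le> 2 C\<close>.\<close>

lemma norm_matrix_inv_diff_le:
  fixes A B :: "real^'n^'n"
  assumes inv: "invertible A" "invertible B" and C: "norm (matrix_inv A) \<le> C"
    and close: "norm (B - A) * C \<le> 1 / 2"
  shows "norm (matrix_inv B - matrix_inv A) \<le> 2 * C * C * norm (B - A)"
proof -
  have "C \<ge> 0"
    using C norm_ge_zero order_trans by blast
  have "norm (matrix_inv B - matrix_inv A) \<le> norm (matrix_inv B ** (B - A)) * norm (matrix_inv A)"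
    by (simp add: matrix_inv_diff[OF inv] norm_matrix_matrix_mult_le)
  also have "\<dots> \<le> norm (matrix_inv B) * norm (B - A) * C"
    by (intro mult_mono norm_matrix_matrix_mult_le C) auto
  finally have diff: "norm (matrix_inv B - matrix_inv A) \<le> norm (matrix_inv B) * norm (B - A) * C" .
  have "norm (matrix_inv B) \<le> norm (matrix_inv A) + norm (matrix_inv B - matrix_inv A)"
    by (metis add_diff_cancel_left' diff_add_cancel norm_triangle_ineq add.commute)
  also have "\<dots> \<le> C + norm (matrix_inv B) * (norm (B - A) * C)"
    using diff C by (simp add: mult.assoc)
  \<comment> \<open>The factor 1/2 allows this term to be absorbed on the left.\<close>
  also have "\<dots> \<le> C + norm (matrix_inv B) * (1 / 2)"
    using close by (intro add_left_mono mult_left_mono) auto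
  finally have "norm (matrix_inv B) \<le> 2 * C"
    by simp
  then have "norm (matrix_inv B) * norm (B - A) * C \<le> 2 * C * norm (B - A) * C"
    using \<open>C \<ge> 0\<close> by (intro mult_right_mono) auto
  with diff show ?thesis
    by (simp add: mult_ac)
qed

lemma continuous_on_matrix_inv:
  fixes J :: "'a::topological_space \<Rightarrow> real^'n^'n"
  assumes "continuous_on S J" and inv: "\<And>x. x \<in> S \<Longrightarrow> invertible (J x)"
  shows "continuous_on S (\<lambda>x. matrix_inv (J x))"
  unfolding continuous_on_def
proof
  fix x assume "x \<in> S"
  define C where "C = norm (matrix_inv (J x)) + 1"
  have "C > 0"
    by (simp add: C_def add_nonneg_pos)
  have "(J \<longlongrightarrow> J x) (at x within S)"
    using assms(1) \<open>x \<in> S\<close> by (simp add: continuous_on_def)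
  then have lim: "((\<lambda>y. norm (J y - J x)) \<longlongrightarrow> 0) (at x within S)"
    by (simp add: LIM_zero tendsto_norm_zero)
  then have "\<forall>\<^sub>F y in at x within S. norm (J y - J x) < 1 / (2 * C)"
    using \<open>C > 0\<close> by (intro order_tendstoD(2)) auto
  moreover have "\<forall>\<^sub>F y in at x within S. y \<in> S"
    by (simp add: eventually_at_filter)
  ultimately have "\<forall>\<^sub>F y in at x within S.
      norm (matrix_inv (J y) - matrix_inv (J x)) \<le> 2 * C * C * norm (J y - J x)"
  proof eventually_elim
    case (elim y)
    show ?case
    proof (rule norm_matrix_inv_diff_le)
      show "norm (J y - J x) * C \<le> 1 / 2"
        using elim(1) \<open>C > 0\<close> by (simp add: field_simps)
    qed (use elim inv \<open>x \<in> S\<close> in \<open>auto simp: C_def\<close>)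
  qed
  moreover have "((\<lambda>y. 2 * C * C * norm (J y - J x)) \<longlongrightarrow> 0) (at x within S)"
    using tendsto_mult_right_zero[OF lim] .
  ultimately have "((\<lambda>y. matrix_inv (J y) - matrix_inv (J x)) \<longlongrightarrow> 0) (at x within S)"
    by (rule Lim_null_comparison)
  then show "((\<lambda>x. matrix_inv (J x)) \<longlongrightarrow> matrix_inv (J x)) (at x within S)"
    by (simp add: LIM_zero_iff)
qed

text \<open>The increment is \<open>h\<close> times the quotient. The quotient has a bounded limit
  and \<open>h\<close> tends to 0 uniformly, so the product tends to 0 uniformly.\<close>

lemma uniform_limit_of_quotient:
  fixes f :: "real \<Rightarrow> 'a \<Rightarrow> 'b::real_normed_vector"
  assumes "uniform_limit S (\<lambda>h x. (1 / h) *\<^sub>R (f h x - f 0 x)) f' (at 0)" and "bounded (f' ` S)"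
  shows "uniform_limit S f (f 0) (at 0)"
proof -
  have "uniform_limit S (\<lambda>h x. h) (\<lambda>x. 0) (at (0::real))"
    by (rule uniform_limitI) (auto simp: eventually_at dist_real_def)
  from bounded_bilinear.bounded_uniform_limit[OF bounded_bilinear_scaleR this assms(1,2)]
  have "uniform_limit S (\<lambda>h x. h *\<^sub>R (1 / h) *\<^sub>R (f h x - f 0 x)) (\<lambda>x. 0) (at 0)"
    by (auto simp: image_constant_conv)
  from uniform_limit_add[OF this uniform_limit_const[where S=S and c="f 0"]]
  have "uniform_limit S (\<lambda>h x. h *\<^sub>R (1 / h) *\<^sub>R (f h x - f 0 x) + f 0 x) (f 0) (at 0)"
    by simp
  then show ?thesis
    by (rule uniform_limit_cong[THEN iffD1, rotated -1]) (auto simp: eventually_at_filter)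
qed

lemma uniform_limit_matrix_inv:
  fixes J :: "real \<Rightarrow> 'a \<Rightarrow> real^'n^'n"
  assumes J: "uniform_limit S J (J 0) (at 0)" and "bounded ((\<lambda>x. matrix_inv (J 0 x)) ` S)"
    and inv0: "\<And>x. x \<in> S \<Longrightarrow> invertible (J 0 x)"
    and inv: "\<forall>\<^sub>F h in at 0. \<forall>x\<in>S. invertible (J h x)"
  shows "uniform_limit S (\<lambda>h x. matrix_inv (J h x)) (\<lambda>x. matrix_inv (J 0 x)) (at 0)"
proof (rule uniform_limitI)
  fix e :: real assume "e > 0"
  obtain C where C: "C > 0" "\<And>x. x \<in> S \<Longrightarrow> norm (matrix_inv (J 0 x)) \<le> C"
    using assms(2) by (auto simp: bounded_pos)
  \<comment> \<open>The first bound meets the closeness condition of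
    \<open>norm_matrix_inv_diff_le\<close>, the second makes its conclusion smaller than
    \<open>e\<close>.\<close>
  define d where "d = min (1 / (2 * C)) (e / (2 * C * C))"
  have "d > 0"
    using C \<open>e > 0\<close> by (simp add: d_def)
  from uniform_limitD[OF J this] inv
  show "\<forall>\<^sub>F h in at 0. \<forall>x\<in>S. dist (matrix_inv (J h x)) (matrix_inv (J 0 x)) < e"
  proof eventually_elim
    case (elim h)
    show ?case
    proof
      fix x assume "x \<in> S"
      then have close: "norm (J h x - J 0 x) < 1 / (2 * C)" "norm (J h x - J 0 x) < e / (2 * C * C)"
        using elim(1) by (auto simp: d_def dist_norm)
      have "norm (matrix_inv (J h x) - matrix_inv (J 0 x)) \<le> 2 * C * C * norm (J h x - J 0 x)"
        using close(1) C elim(2) inv0 \<open>x \<in> S\<close>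
        by (intro norm_matrix_inv_diff_le) (auto simp: field_simps)
      also have "\<dots> < e"
        using close(2) C(1) by (simp add: field_simps)
      finally show "dist (matrix_inv (J h x)) (matrix_inv (J 0 x)) < e"
        by (simp add: dist_norm)
    qed
  qed
qed

text \<open>In the resolvent identity each factor converges uniformly. Uniform limits may be
  multiplied because the limits are bounded, which explains the boundedness conditions.\<close>

lemma uniform_limit_quotient_matrix_inv:
  fixes J :: "real \<Rightarrow> 'a \<Rightarrow> real^'n^'n"
  assumes J: "uniform_limit S (\<lambda>h x. (1 / h) *\<^sub>R (J h x - J 0 x)) J' (at 0)"
    and bdd: "bounded (J' ` S)" "bounded ((\<lambda>x. matrix_inv (J 0 x)) ` S)"
    and inv0: "\<And>x. x \<in> S \<Longrightarrow> invertible (J 0 x)"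
    and inv: "\<forall>\<^sub>F h in at 0. \<forall>x\<in>S. invertible (J h x)"
  shows "uniform_limit S (\<lambda>h x. (1 / h) *\<^sub>R (matrix_inv (J h x) - matrix_inv (J 0 x)))
    (\<lambda>x. - (matrix_inv (J 0 x) ** J' x ** matrix_inv (J 0 x))) (at 0)"
proof -
  have M: "uniform_limit S (\<lambda>h x. matrix_inv (J h x)) (\<lambda>x. matrix_inv (J 0 x)) (at 0)"
    using uniform_limit_of_quotient[OF J bdd(1)] bdd(2) inv0 inv by (rule uniform_limit_matrix_inv)
  have bdd2: "bounded ((\<lambda>x. matrix_inv (J 0 x) ** J' x) ` S)"
  proof -
    obtain B C where "\<And>x. x \<in> S \<Longrightarrow> norm (J' x) \<le> B" "\<And>x. x \<in> S \<Longrightarrow> norm (matrix_inv (J 0 x)) \<le> C"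
      using bdd by (auto simp: bounded_iff)
    then have "norm (matrix_inv (J 0 x) ** J' x) \<le> C * B" if "x \<in> S" for x
      using that norm_ge_zero order_trans
      by (intro order_trans[OF norm_matrix_matrix_mult_le] mult_mono) blast+
    then show ?thesis
      by (auto simp: bounded_iff)
  qed
  have "uniform_limit S (\<lambda>h x. - (matrix_inv (J h x) ** ((1 / h) *\<^sub>R (J h x - J 0 x)) ** matrix_inv (J 0 x)))
    (\<lambda>x. - (matrix_inv (J 0 x) ** J' x ** matrix_inv (J 0 x))) (at 0)"
    by (intro uniform_limit_uminus uniform_limit_matrix_mult uniform_limit_const M J bdd bdd2)
  then show ?thesis
  proof (rule uniform_limit_cong[THEN iffD1, rotated -1])
    show "\<forall>\<^sub>F h in at 0. \<forall>x\<in>S. - (matrix_inv (J h x) ** ((1 / h) *\<^sub>R (J h x - J 0 x)) ** matrix_inv (J 0 x)) =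
        (1 / h) *\<^sub>R (matrix_inv (J h x) - matrix_inv (J 0 x))"
      using inv by eventually_elim
        (simp add: inv0 matrix_inv_diff matrix_mult_scaleR_left matrix_mult_scaleR_right)
  qed simp
qed

lemma uniform_limit_quotient_matrix_inv_gram:
  fixes J :: "real \<Rightarrow> 'a \<Rightarrow> real^'n^'n"
  assumes J: "uniform_limit S (\<lambda>h x. (1 / h) *\<^sub>R (J h x - J 0 x)) J' (at 0)"
    and bdd: "bounded (J' ` S)" "bounded ((\<lambda>x. matrix_inv (J 0 x)) ` S)"
    and inv0: "\<And>x. x \<in> S \<Longrightarrow> invertible (J 0 x)"
    and inv: "\<forall>\<^sub>F h in at 0. \<forall>x\<in>S. invertible (J h x)"
  defines "N \<equiv> \<lambda>x. matrix_inv (J 0 x) ** J' x ** matrix_inv (J 0 x) ** transpose (matrix_inv (J 0 x))"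
  shows "uniform_limit S (\<lambda>h x. (1 / h) *\<^sub>R
      (matrix_inv (transpose (J h x) ** J h x) - matrix_inv (transpose (J 0 x) ** J 0 x)))
    (\<lambda>x. - (N x + transpose (N x))) (at 0)"
proof -
  define M where "M h x = matrix_inv (J h x)" for h x
  define M' where "M' x = - (M 0 x ** J' x ** M 0 x)" for x
  have D: "uniform_limit S (\<lambda>h x. (1 / h) *\<^sub>R (M h x - M 0 x)) M' (at 0)"
    using uniform_limit_quotient_matrix_inv[OF J bdd inv0 inv] by (simp add: M_def M'_def[abs_def])
  obtain B C where BC: "\<And>x. x \<in> S \<Longrightarrow> norm (J' x) \<le> B" "\<And>x. x \<in> S \<Longrightarrow> norm (M 0 x) \<le> C"
    using bdd by (auto simp: bounded_iff M_def)
  have "norm (M' x) \<le> C * B * C" if "x \<in> S" for x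
  proof -
    have "norm (M' x) \<le> norm (M 0 x) * norm (J' x) * norm (M 0 x)"
      unfolding M'_def norm_minus_cancel
      by (intro order_trans[OF norm_matrix_matrix_mult_le] mult_right_mono norm_matrix_matrix_mult_le) auto
    also have "\<dots> \<le> C * B * C"
    proof -
      have "0 \<le> C" "0 \<le> B"
        using BC[OF that] norm_ge_zero order_trans by blast+
      then show ?thesis
        using BC[OF that] by (intro mult_mono) auto
    qed
    finally show ?thesis .
  qed
  then have bM': "bounded (M' ` S)"
    by (auto simp: bounded_iff)
  have bM: "bounded (M 0 ` S)"
    using bdd(2) by (simp add: M_def)
  have bt: "bounded ((\<lambda>x. transpose (M' x)) ` S)" "bounded ((\<lambda>x. transpose (M 0 x)) ` S)"
    using bM' bM by (auto simp: bounded_iff norm_transpose)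
  have M: "uniform_limit S M (M 0) (at 0)"
    using D bM' by (rule uniform_limit_of_quotient)
  \<comment> \<open>The exact product rule for the increment of \<open>M\<close> times its
    transpose: one factor is taken at \<open>h\<close>, the other at 0. With
    \<open>M' = - M J' M\<close> the two limits are \<open>- N\<close> and the transpose of
    \<open>- N\<close>.\<close>
  have "uniform_limit S (\<lambda>h x. ((1 / h) *\<^sub>R (M h x - M 0 x)) ** transpose (M h x) +
        M 0 x ** transpose ((1 / h) *\<^sub>R (M h x - M 0 x)))
      (\<lambda>x. M' x ** transpose (M 0 x) + M 0 x ** transpose (M' x)) (at 0)"
    by (intro uniform_limit_add uniform_limit_matrix_mult uniform_limit_transpose uniform_limit_const
        D M bM bM' bt)
  then show ?thesis
  proof (rule uniform_limit_cong[THEN iffD1, rotated -1])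
    show "\<forall>\<^sub>F h in at 0. \<forall>x\<in>S. ((1 / h) *\<^sub>R (M h x - M 0 x)) ** transpose (M h x) +
        M 0 x ** transpose ((1 / h) *\<^sub>R (M h x - M 0 x)) = (1 / h) *\<^sub>R
      (matrix_inv (transpose (J h x) ** J h x) - matrix_inv (transpose (J 0 x) ** J 0 x))"
      using inv
    proof eventually_elim
      case (elim h)
      show ?case
      proof
        fix x assume "x \<in> S"
        then have gram: "matrix_inv (transpose (J h x) ** J h x) = M h x ** transpose (M h x)"
          "matrix_inv (transpose (J 0 x) ** J 0 x) = M 0 x ** transpose (M 0 x)"
          using elim inv0 by (simp_all add: matrix_inv_transpose_mult M_def)
        show "((1 / h) *\<^sub>R (M h x - M 0 x)) ** transpose (M h x) +
          M 0 x ** transpose ((1 / h) *\<^sub>R (M h x - M 0 x)) = (1 / h) *\<^sub>R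
          (matrix_inv (transpose (J h x) ** J h x) - matrix_inv (transpose (J 0 x) ** J 0 x))"
          unfolding gram
          by (simp add: transpose_scalar transpose_diff matrix_mult_scaleR_left matrix_mult_scaleR_right
              matrix_mult_diff_left matrix_mult_diff_right flip: scaleR_add_right)
      qed
    qed
    show "M' x ** transpose (M 0 x) + M 0 x ** transpose (M' x) = - (N x + transpose (N x))" for x
      by (simp add: M'_def N_def M_def matrix_mult_minus_left matrix_mult_minus_right transpose_minus
          matrix_transpose_mul matrix_mul_assoc)
  qed
qed

section \<open>Differentiability of the dynamic matrix\<close>

lemma frechet_derivative_within_cong:
  assumes "x \<in> S" "\<And>y. y \<in> S \<Longrightarrow> f y = g y"
  shows "frechet_derivative f (at x within S) = frechet_derivative g (at x within S)"
proof -
  have "(f has_derivative D) (at x within S) \<longleftrightarrow> (g has_derivative D) (at x within S)" for D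
    using assms has_derivative_transform[of x S f g D] has_derivative_transform[of x S g f D] by auto
  then show ?thesis
    by (simp add: frechet_derivative_def)
qed

lemma Ck_on_cong:
  assumes "Ck_on k f S" "\<And>y. y \<in> S \<Longrightarrow> f y = g y"
  shows "Ck_on k g S"
  using assms
proof (induction k arbitrary: f g)
  case 0
  then show ?case
    by (simp cong: continuous_on_cong)
next
  case (Suc k)
  have "g differentiable_on S"
    using Suc.prems has_derivative_transform[of _ S g f]
    by (fastforce simp: differentiable_on_def differentiable_def)
  moreover have "Ck_on k (\<lambda>x. frechet_derivative g (at x within S) v) S" for v
  proof (rule Suc.IH)
    show "Ck_on k (\<lambda>x. frechet_derivative f (at x within S) v) S"
      using Suc.prems by simp
    show "frechet_derivative f (at x within S) v = frechet_derivative g (at x within S) v"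
      if "x \<in> S" for x
      using frechet_derivative_within_cong[OF that Suc.prems(2)] by simp
  qed
  ultimately show ?case
    by simp
qed

section \<open>Derivatives within a smooth domain\<close>

context
  fixes \<Omega> :: "'a::euclidean_space set"
  assumes \<Omega>: "smooth_compact_domain \<Omega>"
begin

lemma frechet_derivative_within_eqI:
  assumes "x \<in> \<Omega>" "(f has_derivative D) (at x within \<Omega>)"
  shows "frechet_derivative f (at x within \<Omega>) = D"
proof -
  have "(f has_derivative frechet_derivative f (at x within \<Omega>)) (at x within \<Omega>)"
    using assms(2) differentiableI frechet_derivative_works by blast
  then show ?thesis
    using has_derivative_unique_within_smooth_domain[OF \<Omega> assms(1)] assms(2) by blast
qed


text \<open>The formula for the derivative is known at points of \<Omega> only, where derivatives
  are unique, so it enters through \<open>Ck_on_cong\<close>. The lemma serves to show that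
  difference quotients of the family \<open>T\<close> are of class C^2.\<close>

lemma Ck_on_lincomb:
  assumes "Ck_on k f \<Omega>" "Ck_on k g \<Omega>"
  shows "Ck_on k (\<lambda>x. a *\<^sub>R f x + b *\<^sub>R g x) \<Omega>"
  using assms
proof (induction k arbitrary: f g)
  case 0
  then show ?case
    by (auto intro!: continuous_intros)
next
  case (Suc k)
  have der: "((\<lambda>x. a *\<^sub>R f x + b *\<^sub>R g x) has_derivative
      (\<lambda>v. a *\<^sub>R frechet_derivative f (at x within \<Omega>) v + b *\<^sub>R frechet_derivative g (at x within \<Omega>) v))
      (at x within \<Omega>)" if "x \<in> \<Omega>" for x
    using Suc.prems that
    by (intro has_derivative_add has_derivative_scaleR_right Ck_on_has_derivative_within)
  then have "(\<lambda>x. a *\<^sub>R f x + b *\<^sub>R g x) differentiable_on \<Omega>"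
    by (auto simp: differentiable_on_def differentiable_def)
  moreover have "Ck_on k (\<lambda>x. frechet_derivative (\<lambda>x. a *\<^sub>R f x + b *\<^sub>R g x) (at x within \<Omega>) v) \<Omega>" for v
  proof (rule Ck_on_cong)
    show "Ck_on k (\<lambda>x. a *\<^sub>R frechet_derivative f (at x within \<Omega>) v +
        b *\<^sub>R frechet_derivative g (at x within \<Omega>) v) \<Omega>"
      using Suc.prems by (intro Suc.IH) auto
    show "a *\<^sub>R frechet_derivative f (at x within \<Omega>) v + b *\<^sub>R frechet_derivative g (at x within \<Omega>) v =
        frechet_derivative (\<lambda>x. a *\<^sub>R f x + b *\<^sub>R g x) (at x within \<Omega>) v" if "x \<in> \<Omega>" for x
      using frechet_derivative_within_eqI[OF that der[OF that]] by simp
  qed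
  ultimately show ?case
    by simp
qed

end

lemma has_derivative_vec_lambda:
  fixes f :: "'i::finite \<Rightarrow> 'a::real_normed_vector \<Rightarrow> 'b::euclidean_space"
  assumes "\<And>i. (f i has_derivative f' i) (at x within S)"
  shows "((\<lambda>x. \<chi> i. f i x) has_derivative (\<lambda>h. \<chi> i. f' i h)) (at x within S)"
  unfolding has_derivative_componentwise_within[of "\<lambda>x. \<chi> i. f i x"]
  using assms by (auto simp: Basis_vec_def inner_axis intro: has_derivative_inner_left)

text \<open>\<open>Ck_on\<close> speaks about one direction at a time; this bounds the operator norm
  by finitely many directions.\<close>

lemma onorm_le_sum_Basis:
  fixes L :: "'a::euclidean_space \<Rightarrow> 'b::real_normed_vector"
  assumes "linear L"
  shows "onorm L \<le> (\<Sum>b\<in>Basis. norm (L b))"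
proof (rule onorm_le)
  fix h
  have "L h = L (\<Sum>b\<in>Basis. (h \<bullet> b) *\<^sub>R b)"
    by (simp add: euclidean_representation)
  also have "\<dots> = (\<Sum>b\<in>Basis. (h \<bullet> b) *\<^sub>R L b)"
    by (simp add: linear_sum[OF assms] linear_scale[OF assms])
  finally have "norm (L h) \<le> (\<Sum>b\<in>Basis. \<bar>h \<bullet> b\<bar> * norm (L b))"
    using norm_sum[of "\<lambda>b. (h \<bullet> b) *\<^sub>R L b" Basis] by simp
  also have "\<dots> \<le> (\<Sum>b\<in>Basis. norm h * norm (L b))"
    by (intro sum_mono mult_right_mono Basis_le_norm) auto
  finally show "norm (L h) \<le> (\<Sum>b\<in>Basis. norm (L b)) * norm h"
    by (simp add: sum_distrib_left mult.commute)
qed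

context
  fixes \<Omega> :: "(real^'n) set"
  assumes \<Omega>: "smooth_compact_domain \<Omega>"
begin

lemma jacobian_eqI:
  assumes "x \<in> \<Omega>" "(f has_derivative (\<lambda>h. A *v h)) (at x within \<Omega>)"
  shows "jacobian f (at x within \<Omega>) = A"
  using frechet_derivative_within_eqI[OF \<Omega> assms] by (simp add: jacobian_def)

lemma jacobian_has_derivative:
  assumes "Ck_on (Suc k) f \<Omega>" "x \<in> \<Omega>"
  shows "(f has_derivative (\<lambda>h. jacobian f (at x within \<Omega>) *v h)) (at x within \<Omega>)"
  using assms jacobian_works by (auto simp: differentiable_on_def)

lemma jacobian_alt:
  "jacobian f (at x within \<Omega>) = (\<chi> i j. frechet_derivative f (at x within \<Omega>) (axis j 1) $ i)"
  by (simp add: jacobian_def matrix_def)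

lemma continuous_on_jacobian:
  assumes "Ck_on (Suc k) f \<Omega>"
  shows "continuous_on \<Omega> (\<lambda>x. jacobian f (at x within \<Omega>))"
proof -
  have "Ck_on k' f \<Omega>" if "k' \<le> Suc k" for k'
    using that assms by (induction rule: inc_induct) (auto dest: Ck_on_Suc_imp simp del: Ck_on.simps)
  from this[of "Suc 0"] show ?thesis
    unfolding jacobian_alt by (intro continuous_on_vec_lambda continuous_on_component) auto
qed

text \<open>
  The supremum of an unbounded set of reals is unspecified, so that \<^const>\<open>C2_norm\<close> controls the
  Jacobian only once all three sets in its definition are known to be bounded.
\<close>

lemma bdd_above_onorm_derivative_jacobian:
  assumes f: "Ck_on 2 f \<Omega>"
  shows "bdd_above ((\<lambda>x. onorm (frechet_derivative (\<lambda>y. jacobian f (at y within \<Omega>)) (at x within \<Omega>))) ` \<Omega>)"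
    and "x \<in> \<Omega> \<Longrightarrow> 0 \<le> onorm (frechet_derivative (\<lambda>y. jacobian f (at y within \<Omega>)) (at x within \<Omega>))"
proof -
  let ?G = "\<lambda>y. jacobian f (at y within \<Omega>)"
  \<comment> \<open>\<open>Ck_on 2\<close> differentiates each directional derivative separately.
    \<open>D j\<close> is the derivative of column \<open>j\<close> of the Jacobian, and the columns
    are then assembled into the derivative of the matrix.\<close>
  define D where "D j x = frechet_derivative (\<lambda>y. frechet_derivative f (at y within \<Omega>) (axis j 1)) (at x within \<Omega>)" for j x
  have col: "Ck_on (Suc 0) (\<lambda>y. frechet_derivative f (at y within \<Omega>) (axis j 1)) \<Omega>" for j
    using f by (simp add: numeral_2_eq_2)
  have D: "((\<lambda>y. frechet_derivative f (at y within \<Omega>) (axis j 1)) has_derivative D j x) (at x within \<Omega>)"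
    if "x \<in> \<Omega>" for j x
    unfolding D_def by (rule Ck_on_has_derivative_within[OF col that])
  have der: "(?G has_derivative (\<lambda>h. \<chi> i j. D j x h $ i)) (at x within \<Omega>)" if "x \<in> \<Omega>" for x
    unfolding jacobian_alt
    using D[OF that]
    by (intro has_derivative_vec_lambda bounded_linear.has_derivative[OF bounded_linear_vec_nth])
  have G: "frechet_derivative ?G (at x within \<Omega>) = (\<lambda>h. \<chi> i j. D j x h $ i)"
    "linear (frechet_derivative ?G (at x within \<Omega>))" if "x \<in> \<Omega>" for x
    using frechet_derivative_within_eqI[OF \<Omega> that der[OF that]] has_derivative_linear[OF der[OF that]]
    by simp_all
  have "continuous_on \<Omega> (\<lambda>x. D j x b)" for j b
    using col[of j] by (simp add: D_def)
  then have "continuous_on \<Omega> (\<lambda>x. \<Sum>b\<in>Basis. norm (\<chi> i j. D j x b $ i))"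
    by (intro continuous_on_sum continuous_on_norm continuous_on_vec_lambda continuous_on_component)
  then have "bdd_above ((\<lambda>x. \<Sum>b\<in>Basis. norm (\<chi> i j. D j x b $ i)) ` \<Omega>)"
    using \<Omega> by (intro bounded_imp_bdd_above compact_imp_bounded compact_continuous_image)
      (auto simp: smooth_compact_domain_def)
  then obtain M where M: "\<And>x. x \<in> \<Omega> \<Longrightarrow> (\<Sum>b\<in>Basis. norm (\<chi> i j. D j x b $ i)) \<le> M"
    by (auto simp: bdd_above_def)
  show "bdd_above ((\<lambda>x. onorm (frechet_derivative ?G (at x within \<Omega>))) ` \<Omega>)"
  proof (rule bdd_aboveI2)
    show "onorm (frechet_derivative ?G (at x within \<Omega>)) \<le> M" if "x \<in> \<Omega>" for x
      using onorm_le_sum_Basis[OF G(2)[OF that]] M[OF that] by (simp add: G(1)[OF that])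
  qed
  show "0 \<le> onorm (frechet_derivative ?G (at x within \<Omega>))" if "x \<in> \<Omega>"
    using G(2)[OF that] by (intro onorm_pos_le) (simp add: linear_conv_bounded_linear)
qed

lemma norm_jacobian_le_C2_norm:
  assumes f: "Ck_on 2 f \<Omega>" and "x \<in> \<Omega>"
  shows "norm (jacobian f (at x within \<Omega>)) \<le> C2_norm \<Omega> f"
proof -
  have comp: "compact \<Omega>"
    using \<Omega> by (simp add: smooth_compact_domain_def)
  have f1: "Ck_on (Suc 0) f \<Omega>" and f0: "continuous_on \<Omega> f"
    using f Ck_on_Suc_imp[of 1 f \<Omega>] Ck_on_Suc_imp[of 0 f \<Omega>] by (simp_all add: numeral_2_eq_2)
  have "bdd_above ((\<lambda>x. norm (f x)) ` \<Omega>)"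
    using f0 comp by (intro bounded_imp_bdd_above compact_imp_bounded compact_continuous_image continuous_on_norm)
  from cSUP_upper2[OF this \<open>x \<in> \<Omega>\<close> norm_ge_zero] have "0 \<le> (SUP x\<in>\<Omega>. norm (f x))" .
  moreover have "bdd_above ((\<lambda>x. norm (jacobian f (at x within \<Omega>))) ` \<Omega>)"
    using continuous_on_jacobian[OF f1] comp
    by (intro bounded_imp_bdd_above compact_imp_bounded compact_continuous_image continuous_on_norm)
  from cSUP_upper[OF \<open>x \<in> \<Omega>\<close> this]
  have "norm (jacobian f (at x within \<Omega>)) \<le> (SUP x\<in>\<Omega>. norm (jacobian f (at x within \<Omega>)))" .
  moreover have "0 \<le> (SUP x\<in>\<Omega>. onorm (frechet_derivative (\<lambda>y. jacobian f (at y within \<Omega>)) (at x within \<Omega>)))"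
    using bdd_above_onorm_derivative_jacobian[OF f] \<open>x \<in> \<Omega>\<close> by (intro cSUP_upper2)
  ultimately show ?thesis
    by (simp add: C2_norm_def)
qed

text \<open>By the chain rule a derivative of the inverse map composed with the Jacobian is a
  derivative of the identity within \<Omega>. Derivatives are unique there, so the Jacobian has a
  left inverse.\<close>

lemma invertible_jacobian_C2_diffeo:
  assumes f: "C2_diffeo_onto_image \<Omega> f" and x: "x \<in> \<Omega>"
  shows "invertible (jacobian f (at x within \<Omega>))"
proof -
  let ?g = "inv_into \<Omega> f"
  have "inj_on f \<Omega>" and Ck: "Ck_on (Suc 1) f \<Omega>" "Ck_on (Suc 1) ?g (f ` \<Omega>)"
    using f by (auto simp: C2_diffeo_onto_image_def numeral_2_eq_2)
  have "(?g has_derivative frechet_derivative ?g (at (f x) within f ` \<Omega>)) (at (f x) within f ` \<Omega>)"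
    by (rule Ck_on_has_derivative_within[OF Ck(2)]) (use x in simp)
  \<comment> \<open>Any derivative of the inverse will do; uniqueness is invoked on \<Omega>, not on
    the image.\<close>
  then obtain B where B: "(?g has_derivative (\<lambda>h. B *v h)) (at (f x) within f ` \<Omega>)"
    by (metis differentiable_def jacobian_works)
  have "(?g \<circ> f has_derivative (\<lambda>h. B *v h) \<circ> (\<lambda>h. jacobian f (at x within \<Omega>) *v h)) (at x within \<Omega>)"
    using jacobian_has_derivative[OF Ck(1) x] B by (rule diff_chain_within)
  then have "((\<lambda>y. y) has_derivative (\<lambda>h. B *v (jacobian f (at x within \<Omega>) *v h))) (at x within \<Omega>)"
    by (intro has_derivative_transform[OF x, of "\<lambda>y. y" "?g \<circ> f"]) (auto simp: \<open>inj_on f \<Omega>\<close> o_def)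
  then have "(\<lambda>h. B *v (jacobian f (at x within \<Omega>) *v h)) = (\<lambda>h. h)"
    using has_derivative_unique_within_smooth_domain[OF \<Omega> x] has_derivative_ident by blast
  then have "B ** jacobian f (at x within \<Omega>) = mat 1"
    by (simp add: matrix_eq matrix_vector_mul_assoc[symmetric] fun_eq_iff)
  then show ?thesis
    using invertible_left_inverse by blast
qed

lemma continuous_on_dyn_matrix:
  assumes "C2_diffeo_onto_image \<Omega> f"
  shows "continuous_on \<Omega> (dyn_matrix \<Omega> f)"
proof -
  have J: "continuous_on \<Omega> (\<lambda>x. jacobian f (at x within \<Omega>))"
    using assms by (intro continuous_on_jacobian[of 1]) (simp add: C2_diffeo_onto_image_def numeral_2_eq_2)
  show ?thesis
    unfolding dyn_matrix_def Let_def
    using invertible_jacobian_C2_diffeo[OF assms]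
    by (intro continuous_on_scaleR continuous_on_const continuous_on_add continuous_on_matrix_inv
        continuous_on_matrix_mult continuous_on_transpose J invertible_mult transpose_invertible)
qed

lemma transpose_dyn_matrix:
  assumes "C2_diffeo_onto_image \<Omega> f" "x \<in> \<Omega>"
  shows "transpose (dyn_matrix \<Omega> f x) = dyn_matrix \<Omega> f x"
proof -
  have "transpose (A + B) = transpose A + transpose B" for A B :: "real^'n^'n"
    by (simp add: vec_eq_iff transpose_def)
  then show ?thesis
    using matrix_inv_transpose_mult[OF invertible_jacobian_C2_diffeo[OF assms]]
    by (simp add: dyn_matrix_def Let_def transpose_scalar matrix_transpose_mul)
qed

lemma continuous_on_matrix_inv_jacobian:
  assumes "C2_diffeo_onto_image \<Omega> f"
  shows "continuous_on \<Omega> (\<lambda>x. matrix_inv (jacobian f (at x within \<Omega>)))"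
proof -
  have "continuous_on \<Omega> (\<lambda>x. jacobian f (at x within \<Omega>))"
    using assms by (intro continuous_on_jacobian[of 1]) (simp add: C2_diffeo_onto_image_def numeral_2_eq_2)
  then show ?thesis
    using invertible_jacobian_C2_diffeo[OF assms] by (rule continuous_on_matrix_inv)
qed

lemma continuous_on_dyn_matrix_dot:
  assumes f: "C2_diffeo_onto_image \<Omega> f" and "Ck_on 2 f' \<Omega>"
  shows "continuous_on \<Omega> (dyn_matrix_dot \<Omega> f f')"
proof -
  have "continuous_on \<Omega> (\<lambda>x. jacobian f' (at x within \<Omega>))"
    using assms by (intro continuous_on_jacobian[of 1]) (simp add: numeral_2_eq_2)
  then show ?thesis
    unfolding dyn_matrix_dot_def Let_def sym_part_def
    by (intro continuous_on_minus continuous_on_scaleR continuous_on_const continuous_on_add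
        continuous_on_matrix_mult continuous_on_transpose continuous_on_matrix_inv_jacobian[OF f])
qed

text \<open>The error \<open>F h\<close> of the difference quotient has Jacobian equal to the error
  of the quotient of the Jacobians, and its C^2 norm bounds that Jacobian at every point of
  \<Omega>.\<close>

lemma uniform_limit_quotient_jacobian:
  assumes "\<epsilon>0 > 0" and T: "C1_family_in_C2 \<epsilon>0 \<Omega> T T'"
  shows "uniform_limit \<Omega>
    (\<lambda>h x. (1 / h) *\<^sub>R (jacobian (T h) (at x within \<Omega>) - jacobian (T 0) (at x within \<Omega>)))
    (\<lambda>x. jacobian (T' 0) (at x within \<Omega>)) (at 0)"
proof (rule uniform_limitI)
  fix e :: real assume "e > 0"
  have in0: "0 \<in> {-\<epsilon>0<..<\<epsilon>0}"
    using \<open>\<epsilon>0 > 0\<close> by simp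
  define F where "F h x = (1 / h) *\<^sub>R (T h x - T 0 x) - T' 0 x" for h x
  have "((\<lambda>h. C2_norm \<Omega> (F h)) \<longlongrightarrow> 0) (at 0)"
    using T in0 unfolding C1_family_in_C2_def F_def by fastforce
  then have "\<forall>\<^sub>F h in at 0. C2_norm \<Omega> (F h) < e"
    using \<open>e > 0\<close> by (rule order_tendstoD)
  moreover have "\<forall>\<^sub>F h in at 0. h \<in> {-\<epsilon>0<..<\<epsilon>0}"
    using eventually_at_in_open'[OF open_greaterThanLessThan in0] .
  ultimately show "\<forall>\<^sub>F h in at 0. \<forall>x\<in>\<Omega>. dist ((1 / h) *\<^sub>R (jacobian (T h) (at x within \<Omega>) -
      jacobian (T 0) (at x within \<Omega>))) (jacobian (T' 0) (at x within \<Omega>)) < e"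
  proof eventually_elim
    case (elim h)
    have Ck: "Ck_on 2 (T h) \<Omega>" "Ck_on 2 (T 0) \<Omega>" "Ck_on 2 (T' 0) \<Omega>"
      using T elim in0 by (auto simp: C1_family_in_C2_def)
    have "Ck_on 2 (F h) \<Omega>"
      using Ck_on_lincomb[OF \<Omega> Ck_on_lincomb[OF \<Omega> Ck(1,2), of "1 / h" "- (1 / h)"] Ck(3), of 1 "-1"]
      by (simp add: F_def[abs_def] algebra_simps)
    show ?case
    proof
      fix x assume x: "x \<in> \<Omega>"
      have J: "(f has_derivative (\<lambda>h. jacobian f (at x within \<Omega>) *v h)) (at x within \<Omega>)"
        if "Ck_on 2 f \<Omega>" for f
        using that x by (intro jacobian_has_derivative[of 1]) (simp_all add: numeral_2_eq_2)
      have "jacobian (F h) (at x within \<Omega>) = (1 / h) *\<^sub>R (jacobian (T h) (at x within \<Omega>) -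
          jacobian (T 0) (at x within \<Omega>)) - jacobian (T' 0) (at x within \<Omega>)"
        unfolding F_def[abs_def]
        by (rule jacobian_eqI[OF x])
          (auto intro!: derivative_eq_intros J Ck
            simp: matrix_vector_mult_diff_rdistrib simp flip: scaleR_matrix_vector_assoc)
      then show "dist ((1 / h) *\<^sub>R (jacobian (T h) (at x within \<Omega>) - jacobian (T 0) (at x within \<Omega>)))
          (jacobian (T' 0) (at x within \<Omega>)) < e"
        using norm_jacobian_le_C2_norm[OF \<open>Ck_on 2 (F h) \<Omega>\<close> x] elim(1) by (simp add: dist_norm)
    qed
  qed
qed

text \<open>The identity matrix cancels in the quotient, and the factor 1/2 of
  \<open>dyn_matrix\<close> turns the limit for the inverse Gram matrix into minus the symmetric
  part in \<open>dyn_matrix_dot\<close>.\<close>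

lemma uniform_limit_quotient_dyn_matrix:
  assumes "\<epsilon>0 > 0" and T: "C1_family_in_C2 \<epsilon>0 \<Omega> T T'"
    and diffeo: "\<And>\<epsilon>. \<epsilon> \<in> {-\<epsilon>0<..<\<epsilon>0} \<Longrightarrow> C2_diffeo_onto_image \<Omega> (T \<epsilon>)"
  shows "uniform_limit \<Omega> (\<lambda>h x. (1 / h) *\<^sub>R (dyn_matrix \<Omega> (T h) x - dyn_matrix \<Omega> (T 0) x))
    (dyn_matrix_dot \<Omega> (T 0) (T' 0)) (at 0)"
proof -
  have in0: "0 \<in> {-\<epsilon>0<..<\<epsilon>0}"
    using \<open>\<epsilon>0 > 0\<close> by simp
  define J where "J h x = jacobian (T h) (at x within \<Omega>)" for h x
  define J' where "J' x = jacobian (T' 0) (at x within \<Omega>)" for x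
  define N where "N x = matrix_inv (J 0 x) ** J' x ** matrix_inv (J 0 x) ** transpose (matrix_inv (J 0 x))" for x
  have bdd: "bounded (f ` \<Omega>)" if "continuous_on \<Omega> f" for f :: "real^'n \<Rightarrow> real^'n^'n"
    using that \<Omega> by (intro compact_imp_bounded compact_continuous_image) (auto simp: smooth_compact_domain_def)
  have "uniform_limit \<Omega> (\<lambda>h x. (1 / h) *\<^sub>R
      (matrix_inv (transpose (J h x) ** J h x) - matrix_inv (transpose (J 0 x) ** J 0 x)))
    (\<lambda>x. - (N x + transpose (N x))) (at 0)"
    unfolding N_def
  proof (rule uniform_limit_quotient_matrix_inv_gram)
    show "uniform_limit \<Omega> (\<lambda>h x. (1 / h) *\<^sub>R (J h x - J 0 x)) J' (at 0)"
      using uniform_limit_quotient_jacobian[OF assms(1,2)] by (simp add: J_def J'_def[abs_def])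
    show "bounded (J' ` \<Omega>)"
      unfolding J'_def[abs_def] using T in0
      by (intro bdd continuous_on_jacobian[of 1]) (auto simp: C1_family_in_C2_def numeral_2_eq_2)
    show "bounded ((\<lambda>x. matrix_inv (J 0 x)) ` \<Omega>)"
      unfolding J_def using diffeo[OF in0] by (intro bdd continuous_on_matrix_inv_jacobian)
    show "invertible (J 0 x)" if "x \<in> \<Omega>" for x
      unfolding J_def using diffeo[OF in0] that by (rule invertible_jacobian_C2_diffeo)
    have "\<forall>\<^sub>F h in at 0. h \<in> {-\<epsilon>0<..<\<epsilon>0}"
      using eventually_at_in_open'[OF open_greaterThanLessThan in0] .
    then show "\<forall>\<^sub>F h in at 0. \<forall>x\<in>\<Omega>. invertible (J h x)"
      by eventually_elim (use diffeo invertible_jacobian_C2_diffeo J_def in auto)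
  qed
  from bounded_linear.uniform_limit[OF bounded_linear_scaleR_right this, of "1 / 2"]
  show ?thesis
    by (rule uniform_limit_cong'[THEN iffD1, rotated -1])
      (simp_all add: dyn_matrix_def dyn_matrix_dot_def Let_def sym_part_def J_def J'_def N_def algebra_simps)
qed

end

section \<open>The linear response\<close>

text \<open>Carried over from the nonnegative integral; membership in \<open>L2\<close> makes all
  three integrals finite.\<close>

lemma L2_Cauchy_Schwarz:
  assumes "u \<in> L2 \<Omega>" "v \<in> L2 \<Omega>"
  shows "(LINT x|lebesgue_on \<Omega>. norm (u x) * norm (v x)) \<le>
    sqrt (LINT x|lebesgue_on \<Omega>. (norm (u x))\<^sup>2) * sqrt (LINT x|lebesgue_on \<Omega>. (norm (v x))\<^sup>2)"
    (is "?c \<le> sqrt ?a * sqrt ?b")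
proof -
  let ?M = "lebesgue_on \<Omega>"
  have [measurable]: "u \<in> borel_measurable ?M" "v \<in> borel_measurable ?M"
    using assms by (auto intro: L2_measurable)
  have nn: "(\<integral>\<^sup>+x. ennreal (norm (u x)) * ennreal (norm (v x)) \<partial>?M) = ennreal ?c"
    "(\<integral>\<^sup>+x. (ennreal (norm (u x)))\<^sup>2 \<partial>?M) = ennreal ?a"
    "(\<integral>\<^sup>+x. (ennreal (norm (v x)))\<^sup>2 \<partial>?M) = ennreal ?b"
    using nn_integral_eq_integral[OF integrable_norm_mult[OF assms]]
      nn_integral_eq_integral[OF L2_integrable[OF assms(1)]]
      nn_integral_eq_integral[OF L2_integrable[OF assms(2)]]
    by (simp_all add: ennreal_mult ennreal_power)
  have "(ennreal ?c)\<^sup>2 \<le> ennreal ?a * ennreal ?b"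
    using Cauchy_Schwarz_nn_integral[of "\<lambda>x. ennreal (norm (u x))" ?M "\<lambda>x. ennreal (norm (v x))"]
    by (simp add: nn)
  then have "?c\<^sup>2 \<le> ?a * ?b"
    by (simp add: ennreal_power flip: ennreal_mult)
  then have "?c \<le> sqrt (?a * ?b)"
    by (rule real_le_rsqrt)
  then show ?thesis
    by (simp add: real_sqrt_mult)
qed

lemma sqrt_integral_le_H1_norm:
  "sqrt (LINT x|lebesgue_on \<Omega>. (u x)\<^sup>2) \<le> H1_norm \<Omega> u"
  "sqrt (LINT x|lebesgue_on \<Omega>. (norm (wgrad \<Omega> u x))\<^sup>2) \<le> H1_norm \<Omega> u"
  by (simp_all add: H1_norm_def)

lemma abs_L2_inner_le:
  assumes "u \<in> H1 \<Omega>" "v \<in> H1 \<Omega>"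
  shows "\<bar>L2_inner \<Omega> u v\<bar> \<le> H1_norm \<Omega> u * H1_norm \<Omega> v"
proof -
  have "\<bar>L2_inner \<Omega> u v\<bar> \<le> (LINT x|lebesgue_on \<Omega>. norm (u x) * norm (v x))"
    unfolding L2_inner_def using integral_abs_bound[of "lebesgue_on \<Omega>" "\<lambda>x. u x * v x"]
    by (simp add: abs_mult)
  also have "\<dots> \<le> sqrt (LINT x|lebesgue_on \<Omega>. (norm (u x))\<^sup>2) * sqrt (LINT x|lebesgue_on \<Omega>. (norm (v x))\<^sup>2)"
    using assms by (intro L2_Cauchy_Schwarz H1_imp_L2)
  also have "\<dots> \<le> H1_norm \<Omega> u * H1_norm \<Omega> v"
    using sqrt_integral_le_H1_norm(1) by (intro mult_mono) (auto simp: H1_norm_nonneg)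
  finally show ?thesis .
qed

section \<open>Bounds, bilinearity and limits of the forms\<close>

context
  fixes \<Omega> :: "(real^'n) set"
  assumes \<Omega>: "smooth_compact_domain \<Omega>"
begin

lemma compact_domain: "compact \<Omega>"
  using \<Omega> by (simp add: smooth_compact_domain_def)

lemma form_bound:
  fixes A :: "real^'n \<Rightarrow> real^'n^'n"
  assumes "continuous_on \<Omega> A" "g \<in> L2 \<Omega>" "k \<in> L2 \<Omega>" and B: "\<And>x. x \<in> \<Omega> \<Longrightarrow> norm (A x) \<le> B"
  shows "integrable (lebesgue_on \<Omega>) (\<lambda>x. (A x *v g x) \<bullet> k x)"
    and "\<bar>LINT x|lebesgue_on \<Omega>. (A x *v g x) \<bullet> k x\<bar> \<le> B * (LINT x|lebesgue_on \<Omega>. norm (g x) * norm (k x))"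
proof -
  have int: "integrable (lebesgue_on \<Omega>) (\<lambda>x. B * (norm (g x) * norm (k x)))"
    using integrable_norm_mult[OF assms(2,3)] by simp
  \<comment> \<open>Component \<open>i\<close> of the product \<open>A x *v g x\<close> is the inner
    product of row \<open>i\<close> of \<open>A x\<close> with \<open>g x\<close>, so measurability
    reduces to rows.\<close>
  have meas: "(\<lambda>x. (A x *v g x) \<bullet> k x) \<in> borel_measurable (lebesgue_on \<Omega>)"
  proof -
    have "(\<lambda>x. A x $ i) \<in> borel_measurable (lebesgue_on \<Omega>)" for i
      using continuous_on_imp_L2[OF compact_domain continuous_on_component[OF assms(1)]]
      by (rule L2_measurable)
    then have "(\<lambda>x. (A x $ i) \<bullet> g x) \<in> borel_measurable (lebesgue_on \<Omega>)" for i
      using L2_measurable[OF assms(2)] by (intro borel_measurable_inner)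
    moreover have "(\<lambda>x. k x $ i) \<in> borel_measurable (lebesgue_on \<Omega>)" for i
      using L2_nth[OF assms(3)] by (rule L2_measurable)
    ultimately show ?thesis
      by (simp add: inner_vec_def[of "_ *v _"] matrix_vector_mul_component)
  qed
  have le: "\<bar>(A x *v g x) \<bullet> k x\<bar> \<le> B * (norm (g x) * norm (k x))" if "x \<in> \<Omega>" for x
  proof -
    have "\<bar>(A x *v g x) \<bullet> k x\<bar> \<le> norm (A x) * norm (g x) * norm (k x)"
      by (rule order_trans[OF Cauchy_Schwarz_ineq2])
        (intro mult_right_mono norm_matrix_vector_mult_le norm_ge_zero)
    also have "\<dots> \<le> B * norm (g x) * norm (k x)"
      using B[OF that] by (intro mult_right_mono) auto
    finally show ?thesis
      by (simp add: mult.assoc)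
  qed
  show int': "integrable (lebesgue_on \<Omega>) (\<lambda>x. (A x *v g x) \<bullet> k x)"
    using le by (intro Bochner_Integration.integrable_bound[OF int meas]) (auto intro!: AE_I2 order_trans[OF le])
  have "\<bar>LINT x|lebesgue_on \<Omega>. (A x *v g x) \<bullet> k x\<bar> \<le> (LINT x|lebesgue_on \<Omega>. \<bar>(A x *v g x) \<bullet> k x\<bar>)"
    by (rule integral_abs_bound)
  also have "\<dots> \<le> (LINT x|lebesgue_on \<Omega>. B * (norm (g x) * norm (k x)))"
    using le int int' by (intro integral_mono) auto
  finally show "\<bar>LINT x|lebesgue_on \<Omega>. (A x *v g x) \<bullet> k x\<bar> \<le> B * (LINT x|lebesgue_on \<Omega>. norm (g x) * norm (k x))"
    by simp
qed

lemma bounded_on_domain: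
  fixes A :: "real^'n \<Rightarrow> 'b::real_normed_vector"
  assumes "continuous_on \<Omega> A"
  obtains B where "B > 0" "\<And>x. x \<in> \<Omega> \<Longrightarrow> norm (A x) \<le> B"
proof -
  have "bounded (A ` \<Omega>)"
    using assms compact_domain by (intro compact_imp_bounded compact_continuous_image)
  then show thesis
    using that by (auto simp: bounded_pos)
qed

lemma integrable_grad_form:
  assumes "continuous_on \<Omega> A" "u \<in> H1 \<Omega>" "\<phi> \<in> H1 \<Omega>"
  shows "integrable (lebesgue_on \<Omega>) (\<lambda>x. (A x *v wgrad \<Omega> u x) \<bullet> wgrad \<Omega> \<phi> x)"
proof -
  obtain B where "\<And>x. x \<in> \<Omega> \<Longrightarrow> norm (A x) \<le> B"
    using bounded_on_domain[OF assms(1)] by blast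
  then show ?thesis
    using assms by (intro form_bound(1) wgrad_works)
qed

lemma abs_grad_form_le:
  assumes "continuous_on \<Omega> A" and "u \<in> H1 \<Omega>" "\<phi> \<in> H1 \<Omega>"
    and B: "B \<ge> 0" "\<And>x. x \<in> \<Omega> \<Longrightarrow> norm (A x) \<le> B"
  shows "\<bar>grad_form \<Omega> A u \<phi>\<bar> \<le> B * (H1_norm \<Omega> u * H1_norm \<Omega> \<phi>)"
proof -
  have "\<bar>grad_form \<Omega> A u \<phi>\<bar> \<le> B * (LINT x|lebesgue_on \<Omega>. norm (wgrad \<Omega> u x) * norm (wgrad \<Omega> \<phi> x))"
    unfolding grad_form_def using assms by (intro form_bound(2) wgrad_works)
  also have "\<dots> \<le> B * (sqrt (LINT x|lebesgue_on \<Omega>. (norm (wgrad \<Omega> u x))\<^sup>2) *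
      sqrt (LINT x|lebesgue_on \<Omega>. (norm (wgrad \<Omega> \<phi> x))\<^sup>2))"
    using assms by (intro mult_left_mono L2_Cauchy_Schwarz wgrad_works)
  also have "\<dots> \<le> B * (H1_norm \<Omega> u * H1_norm \<Omega> \<phi>)"
    using sqrt_integral_le_H1_norm(2) B(1) by (intro mult_left_mono mult_mono) (auto simp: H1_norm_nonneg)
  finally show ?thesis .
qed

lemma grad_form_lincomb_left:
  assumes A: "continuous_on \<Omega> A" and u: "u \<in> H1 \<Omega>" and v: "v \<in> H1 \<Omega>" and \<phi>: "\<phi> \<in> H1 \<Omega>"
  shows "grad_form \<Omega> A (\<lambda>x. a * u x + b * v x) \<phi> = a * grad_form \<Omega> A u \<phi> + b * grad_form \<Omega> A v \<phi>"
proof -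
  note int = integrable_grad_form[OF A u \<phi>] integrable_grad_form[OF A v \<phi>]
  have "grad_form \<Omega> A (\<lambda>x. a * u x + b * v x) \<phi> =
    (LINT x|lebesgue_on \<Omega>. a * ((A x *v wgrad \<Omega> u x) \<bullet> wgrad \<Omega> \<phi> x) + b * ((A x *v wgrad \<Omega> v x) \<bullet> wgrad \<Omega> \<phi> x))"
    unfolding grad_form_def
  proof (rule integral_cong_AE)
    show "(\<lambda>x. (A x *v wgrad \<Omega> (\<lambda>x. a * u x + b * v x) x) \<bullet> wgrad \<Omega> \<phi> x) \<in> borel_measurable (lebesgue_on \<Omega>)"
      using integrable_grad_form[OF A H1_lincomb(1)[OF \<Omega> u v] \<phi>] by (rule borel_measurable_integrable)
    show "(\<lambda>x. a * ((A x *v wgrad \<Omega> u x) \<bullet> wgrad \<Omega> \<phi> x) + b * ((A x *v wgrad \<Omega> v x) \<bullet> wgrad \<Omega> \<phi> x))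
        \<in> borel_measurable (lebesgue_on \<Omega>)"
      using int by (intro borel_measurable_integrable) simp
    show "AE x in lebesgue_on \<Omega>. (A x *v wgrad \<Omega> (\<lambda>x. a * u x + b * v x) x) \<bullet> wgrad \<Omega> \<phi> x =
        a * ((A x *v wgrad \<Omega> u x) \<bullet> wgrad \<Omega> \<phi> x) + b * ((A x *v wgrad \<Omega> v x) \<bullet> wgrad \<Omega> \<phi> x)"
      using H1_lincomb(2)[OF \<Omega> u v, of a b]
      by eventually_elim (simp add: matrix_vector_right_distrib matrix_vector_mult_scaleR inner_add_left)
  qed
  then show ?thesis
    using int by (simp add: grad_form_def)
qed

lemma grad_form_lincomb_right:
  assumes A: "continuous_on \<Omega> A" and u: "u \<in> H1 \<Omega>" and v: "v \<in> H1 \<Omega>" and \<phi>: "\<phi> \<in> H1 \<Omega>"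
  shows "grad_form \<Omega> A \<phi> (\<lambda>x. a * u x + b * v x) = a * grad_form \<Omega> A \<phi> u + b * grad_form \<Omega> A \<phi> v"
proof -
  note int = integrable_grad_form[OF A \<phi> u] integrable_grad_form[OF A \<phi> v]
  have "grad_form \<Omega> A \<phi> (\<lambda>x. a * u x + b * v x) =
    (LINT x|lebesgue_on \<Omega>. a * ((A x *v wgrad \<Omega> \<phi> x) \<bullet> wgrad \<Omega> u x) + b * ((A x *v wgrad \<Omega> \<phi> x) \<bullet> wgrad \<Omega> v x))"
    unfolding grad_form_def
  proof (rule integral_cong_AE)
    show "(\<lambda>x. (A x *v wgrad \<Omega> \<phi> x) \<bullet> wgrad \<Omega> (\<lambda>x. a * u x + b * v x) x) \<in> borel_measurable (lebesgue_on \<Omega>)"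
      using integrable_grad_form[OF A \<phi> H1_lincomb(1)[OF \<Omega> u v]] by (rule borel_measurable_integrable)
    show "(\<lambda>x. a * ((A x *v wgrad \<Omega> \<phi> x) \<bullet> wgrad \<Omega> u x) + b * ((A x *v wgrad \<Omega> \<phi> x) \<bullet> wgrad \<Omega> v x))
        \<in> borel_measurable (lebesgue_on \<Omega>)"
      using int by (intro borel_measurable_integrable) simp
    show "AE x in lebesgue_on \<Omega>. (A x *v wgrad \<Omega> \<phi> x) \<bullet> wgrad \<Omega> (\<lambda>x. a * u x + b * v x) x =
        a * ((A x *v wgrad \<Omega> \<phi> x) \<bullet> wgrad \<Omega> u x) + b * ((A x *v wgrad \<Omega> \<phi> x) \<bullet> wgrad \<Omega> v x)"
      using H1_lincomb(2)[OF \<Omega> u v, of a b]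
      by eventually_elim (simp add: inner_add_right)
  qed
  then show ?thesis
    using int by (simp add: grad_form_def)
qed

lemma grad_form_diff_matrix:
  assumes "continuous_on \<Omega> A" "continuous_on \<Omega> B" "u \<in> H1 \<Omega>" "\<phi> \<in> H1 \<Omega>"
  shows "grad_form \<Omega> (\<lambda>x. A x - B x) u \<phi> = grad_form \<Omega> A u \<phi> - grad_form \<Omega> B u \<phi>"
  using integrable_grad_form[OF assms(1,3,4)] integrable_grad_form[OF assms(2,3,4)]
  by (simp add: grad_form_def matrix_vector_mult_diff_rdistrib inner_diff_left)

lemma grad_form_scaleR_matrix:
  "grad_form \<Omega> (\<lambda>x. c *\<^sub>R A x) u \<phi> = c * grad_form \<Omega> A u \<phi>"
  by (simp add: grad_form_def flip: scaleR_matrix_vector_assoc)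

lemma grad_form_commute:
  assumes "\<And>x. x \<in> \<Omega> \<Longrightarrow> transpose (A x) = A x"
  shows "grad_form \<Omega> A u v = grad_form \<Omega> A v u"
  unfolding grad_form_def
proof (rule Bochner_Integration.integral_cong[OF refl])
  fix x assume "x \<in> space (lebesgue_on \<Omega>)"
  then have "transpose (A x) = A x"
    using assms by simp
  then show "(A x *v wgrad \<Omega> u x) \<bullet> wgrad \<Omega> v x = (A x *v wgrad \<Omega> v x) \<bullet> wgrad \<Omega> u x"
    by (metis dot_lmul_matrix inner_commute transpose_matrix_vector)
qed

text \<open>The form is linear in the matrix, so the error is the form of \<open>B h - B0\<close>,
  at most the uniform distance times the two \<open>H1\<close> norms.\<close>

lemma grad_form_tendsto_matrix:
  assumes lim: "uniform_limit \<Omega> B B0 F" and B: "\<forall>\<^sub>F h in F. continuous_on \<Omega> (B h)"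
    and B0: "continuous_on \<Omega> B0" and u: "u \<in> H1 \<Omega>" and \<phi>: "\<phi> \<in> H1 \<Omega>"
  shows "((\<lambda>h. grad_form \<Omega> (B h) u \<phi>) \<longlongrightarrow> grad_form \<Omega> B0 u \<phi>) F"
proof (rule tendstoI)
  fix e :: real assume "e > 0"
  define C where "C = H1_norm \<Omega> u * H1_norm \<Omega> \<phi>"
  have "C \<ge> 0"
    by (simp add: C_def H1_norm_nonneg)
  \<comment> \<open>\<open>C\<close> may be 0, hence \<open>C + 1\<close>.\<close>
  define d where "d = e / (C + 1)"
  have "d > 0" "d * C < e"
    using \<open>e > 0\<close> \<open>C \<ge> 0\<close> by (auto simp: d_def field_simps)
  from uniform_limitD[OF lim \<open>d > 0\<close>] B
  show "\<forall>\<^sub>F h in F. dist (grad_form \<Omega> (B h) u \<phi>) (grad_form \<Omega> B0 u \<phi>) < e"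
  proof eventually_elim
    case (elim h)
    have "\<bar>grad_form \<Omega> (\<lambda>x. B h x - B0 x) u \<phi>\<bar> \<le> d * (H1_norm \<Omega> u * H1_norm \<Omega> \<phi>)"
    proof (rule abs_grad_form_le)
      show "continuous_on \<Omega> (\<lambda>x. B h x - B0 x)"
        using elim B0 by (intro continuous_on_diff)
      show "norm (B h x - B0 x) \<le> d" if "x \<in> \<Omega>" for x
        using elim(1) that by (auto simp: dist_norm less_imp_le)
    qed (use u \<phi> \<open>d > 0\<close> in auto)
    then show ?case
      using \<open>d * C < e\<close> grad_form_diff_matrix[OF elim(2) B0 u \<phi>] by (simp add: C_def dist_real_def)
  qed
qed

text \<open>The form at \<open>w h\<close> is the form at \<open>w h - v\<close> plus the form at
  \<open>v\<close>. The first tends to 0, because the matrices eventually lie within 1 of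
  \<open>A0\<close> and are thus bounded by \<open>B + 1\<close>; the second has a fixed
  argument.\<close>

lemma grad_form_tendsto:
  assumes lim: "uniform_limit \<Omega> A A0 F" and A: "\<forall>\<^sub>F h in F. continuous_on \<Omega> (A h)"
    and A0: "continuous_on \<Omega> A0" and w: "\<forall>\<^sub>F h in F. w h \<in> H1 \<Omega>"
    and v: "v \<in> H1 \<Omega>" and \<phi>: "\<phi> \<in> H1 \<Omega>"
    and wv: "((\<lambda>h. H1_norm \<Omega> (\<lambda>x. w h x - v x)) \<longlongrightarrow> 0) F"
  shows "((\<lambda>h. grad_form \<Omega> (A h) (w h) \<phi>) \<longlongrightarrow> grad_form \<Omega> A0 v \<phi>) F"
proof -
  obtain B where B: "B > 0" "\<And>x. x \<in> \<Omega> \<Longrightarrow> norm (A0 x) \<le> B"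
    using bounded_on_domain[OF A0] by blast
  have "\<forall>\<^sub>F h in F. \<forall>x\<in>\<Omega>. dist (A h x) (A0 x) < 1"
    using uniform_limitD[OF lim, of 1] by simp
  then have "\<forall>\<^sub>F h in F. norm (grad_form \<Omega> (A h) (\<lambda>x. 1 * w h x + (-1) * v x) \<phi>) \<le>
      (B + 1) * (H1_norm \<Omega> (\<lambda>x. w h x - v x) * H1_norm \<Omega> \<phi>)"
    using A w
  proof eventually_elim
    case (elim h)
    have "\<bar>grad_form \<Omega> (A h) (\<lambda>x. 1 * w h x + (-1) * v x) \<phi>\<bar> \<le>
        (B + 1) * (H1_norm \<Omega> (\<lambda>x. 1 * w h x + (-1) * v x) * H1_norm \<Omega> \<phi>)"
    proof (rule abs_grad_form_le)
      show "norm (A h x) \<le> B + 1" if "x \<in> \<Omega>" for x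
      proof -
        have "norm (A h x) \<le> norm (A0 x) + norm (A h x - A0 x)"
          by (metis add.commute diff_add_cancel norm_triangle_ineq)
        then show ?thesis
          using elim(1) B(2) that by (fastforce simp: dist_norm)
      qed
    qed (use elim B \<phi> H1_lincomb(1)[OF \<Omega> elim(3) v, of 1 "-1"] in auto)
    then show ?case
      by simp
  qed
  moreover have "((\<lambda>h. (B + 1) * (H1_norm \<Omega> (\<lambda>x. w h x - v x) * H1_norm \<Omega> \<phi>)) \<longlongrightarrow> 0) F"
    by (intro tendsto_mult_right_zero tendsto_mult_left_zero wv)
  ultimately have "((\<lambda>h. grad_form \<Omega> (A h) (\<lambda>x. 1 * w h x + (-1) * v x) \<phi>) \<longlongrightarrow> 0) F"
    by (rule Lim_null_comparison)
  from tendsto_add[OF this grad_form_tendsto_matrix[OF lim A A0 v \<phi>]]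
  have "((\<lambda>h. grad_form \<Omega> (A h) (\<lambda>x. 1 * w h x + (-1) * v x) \<phi> + grad_form \<Omega> (A h) v \<phi>)
      \<longlongrightarrow> grad_form \<Omega> A0 v \<phi>) F"
    by simp
  moreover have "\<forall>\<^sub>F h in F. grad_form \<Omega> (A h) (\<lambda>x. 1 * w h x + (-1) * v x) \<phi> + grad_form \<Omega> (A h) v \<phi> =
      grad_form \<Omega> (A h) (w h) \<phi>"
    using A w
  proof eventually_elim
    case (elim h)
    show ?case
      using grad_form_lincomb_left[OF elim v \<phi>, of 1 "-1"] by simp
  qed
  ultimately show ?thesis
    by (rule Lim_transform_eventually)
qed

lemma L2_inner_tendsto:
  assumes w: "\<forall>\<^sub>F h in F. w h \<in> H1 \<Omega>" and v: "v \<in> H1 \<Omega>" and \<phi>: "\<phi> \<in> H1 \<Omega>"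
    and wv: "((\<lambda>h. H1_norm \<Omega> (\<lambda>x. w h x - v x)) \<longlongrightarrow> 0) F"
  shows "((\<lambda>h. L2_inner \<Omega> (w h) \<phi>) \<longlongrightarrow> L2_inner \<Omega> v \<phi>) F"
proof -
  have "\<forall>\<^sub>F h in F. norm (L2_inner \<Omega> (w h) \<phi> - L2_inner \<Omega> v \<phi>) \<le> H1_norm \<Omega> (\<lambda>x. w h x - v x) * H1_norm \<Omega> \<phi>"
    using w
  proof eventually_elim
    case (elim h)
    have "L2_inner \<Omega> (w h) \<phi> - L2_inner \<Omega> v \<phi> = L2_inner \<Omega> (\<lambda>x. 1 * w h x + (-1) * v x) \<phi>"
      using elim v \<phi> by (subst L2_inner_lincomb_left) (auto intro: H1_imp_L2)
    then show ?case
      using abs_L2_inner_le[OF H1_lincomb(1)[OF \<Omega> elim v, of 1 "-1"] \<phi>] by simp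
  qed
  then have "((\<lambda>h. L2_inner \<Omega> (w h) \<phi> - L2_inner \<Omega> v \<phi>) \<longlongrightarrow> 0) F"
    by (rule Lim_null_comparison) (intro tendsto_mult_left_zero wv)
  then show ?thesis
    by (simp add: LIM_zero_iff)
qed

lemma derivative_of_weak_eigenvalue_equation:
  fixes A :: "real \<Rightarrow> real^'n \<Rightarrow> real^'n^'n"
  assumes A: "\<forall>\<^sub>F h in at 0. continuous_on \<Omega> (A h)" and A0: "continuous_on \<Omega> (A 0)"
    and A': "continuous_on \<Omega> A'"
    and lim: "uniform_limit \<Omega> (\<lambda>h x. (1 / h) *\<^sub>R (A h x - A 0 x)) A' (at 0)"
    and u: "\<forall>\<^sub>F h in at 0. u h \<in> H1 \<Omega>" and u0: "u 0 \<in> H1 \<Omega>" and v: "v \<in> H1 \<Omega>" and \<phi>: "\<phi> \<in> H1 \<Omega>"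
    and eq: "\<forall>\<^sub>F h in at 0. - grad_form \<Omega> (A h) (u h) \<phi> = lam h * L2_inner \<Omega> (u h) \<phi>"
    and eq0: "- grad_form \<Omega> (A 0) (u 0) \<phi> = lam 0 * L2_inner \<Omega> (u 0) \<phi>"
    and du: "((\<lambda>h. H1_norm \<Omega> (\<lambda>x. (u h x - u 0 x) / h - v x)) \<longlongrightarrow> 0) (at 0)"
    and dlam: "((\<lambda>h. (lam h - lam 0) / h) \<longlongrightarrow> lam') (at 0)"
  shows "grad_form \<Omega> (A 0) v \<phi> + grad_form \<Omega> A' (u 0) \<phi> +
    lam 0 * L2_inner \<Omega> v \<phi> + lam' * L2_inner \<Omega> (u 0) \<phi> = 0"
proof -
  define w where "w h x = 1 / h * u h x + (- 1 / h) * u 0 x" for h x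
  have w_eq: "w h = (\<lambda>x. (u h x - u 0 x) / h)" for h
    by (simp add: w_def fun_eq_iff diff_divide_distrib)
  have w: "\<forall>\<^sub>F h in at 0. w h \<in> H1 \<Omega>"
    using u unfolding w_def by eventually_elim (rule H1_lincomb(1)[OF \<Omega> _ u0])
  have wv: "((\<lambda>h. H1_norm \<Omega> (\<lambda>x. w h x - v x)) \<longlongrightarrow> 0) (at 0)"
    using du by (simp add: w_eq)
  obtain B where "\<And>x. x \<in> \<Omega> \<Longrightarrow> norm (A' x) \<le> B"
    using bounded_on_domain[OF A'] by blast
  then have "bounded (A' ` \<Omega>)"
    by (auto simp: bounded_iff)
  have limA: "uniform_limit \<Omega> A (A 0) (at 0)"
    using lim \<open>bounded (A' ` \<Omega>)\<close> by (rule uniform_limit_of_quotient)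
  \<comment> \<open>Differentiability of \<open>lam\<close> at 0 implies its continuity there,
    needed for the product \<open>lam h * L2_inner \<Omega> (w h) \<phi>\<close>.\<close>
  have "((\<lambda>h. lam 0 + h * ((lam h - lam 0) / h)) \<longlongrightarrow> lam 0 + 0 * lam') (at 0)"
    by (intro tendsto_intros dlam)
  then have "(lam \<longlongrightarrow> lam 0 + 0 * lam') (at 0)"
    by (rule Lim_transform_eventually) (auto simp: eventually_at_filter)
  then have lam: "(lam \<longlongrightarrow> lam 0) (at 0)"
    by simp
  have quot: "\<forall>\<^sub>F h in at 0. continuous_on \<Omega> (\<lambda>x. (1 / h) *\<^sub>R (A h x - A 0 x))"
    using A by eventually_elim (intro continuous_intros A0)
  \<comment> \<open>Product rule for both bilinear terms of the equation: coefficients at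
    \<open>h\<close> meet the quotient \<open>w h\<close>, and quotients of coefficients meet
    \<open>u 0\<close>.\<close>
  have "((\<lambda>h. grad_form \<Omega> (A h) (w h) \<phi> + grad_form \<Omega> (\<lambda>x. (1 / h) *\<^sub>R (A h x - A 0 x)) (u 0) \<phi> +
      lam h * L2_inner \<Omega> (w h) \<phi> + (lam h - lam 0) / h * L2_inner \<Omega> (u 0) \<phi>) \<longlongrightarrow>
    grad_form \<Omega> (A 0) v \<phi> + grad_form \<Omega> A' (u 0) \<phi> +
      lam 0 * L2_inner \<Omega> v \<phi> + lam' * L2_inner \<Omega> (u 0) \<phi>) (at 0)"
    by (intro tendsto_add tendsto_mult tendsto_const lam dlam grad_form_tendsto[OF limA A A0 w v \<phi> wv]
        grad_form_tendsto_matrix[OF lim quot A' u0 \<phi>] L2_inner_tendsto[OF w v \<phi> wv])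
  moreover have "\<forall>\<^sub>F h in at 0. h \<noteq> (0::real)"
    by (simp add: eventually_at_filter)
  then have "\<forall>\<^sub>F h in at 0. grad_form \<Omega> (A h) (w h) \<phi> +
      grad_form \<Omega> (\<lambda>x. (1 / h) *\<^sub>R (A h x - A 0 x)) (u 0) \<phi> +
      lam h * L2_inner \<Omega> (w h) \<phi> + (lam h - lam 0) / h * L2_inner \<Omega> (u 0) \<phi> = 0"
    using A u eq
  proof eventually_elim
    case (elim h)
    have "grad_form \<Omega> (A h) (w h) \<phi> = (grad_form \<Omega> (A h) (u h) \<phi> - grad_form \<Omega> (A h) (u 0) \<phi>) / h"
      unfolding w_def using grad_form_lincomb_left[OF elim(2,3) u0 \<phi>, of "1 / h" "- 1 / h"] by (simp add: diff_divide_distrib)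
    moreover have "grad_form \<Omega> (\<lambda>x. (1 / h) *\<^sub>R (A h x - A 0 x)) (u 0) \<phi> =
        (grad_form \<Omega> (A h) (u 0) \<phi> - grad_form \<Omega> (A 0) (u 0) \<phi>) / h"
      using grad_form_diff_matrix[OF elim(2) A0 u0 \<phi>] by (simp add: grad_form_scaleR_matrix)
    moreover have "L2_inner \<Omega> (w h) \<phi> = (L2_inner \<Omega> (u h) \<phi> - L2_inner \<Omega> (u 0) \<phi>) / h"
      unfolding w_def using L2_inner_lincomb_left[OF H1_imp_L2[OF elim(3)] H1_imp_L2[OF u0] H1_imp_L2[OF \<phi>], of "1 / h" "- 1 / h"]
      by (simp add: diff_divide_distrib)
    \<comment> \<open>The mixed terms, with a coefficient at \<open>h\<close> and the function
      \<open>u 0\<close>, cancel; the equations at \<open>h\<close> and at 0 remain.\<close>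
    ultimately have "grad_form \<Omega> (A h) (w h) \<phi> + grad_form \<Omega> (\<lambda>x. (1 / h) *\<^sub>R (A h x - A 0 x)) (u 0) \<phi> +
        lam h * L2_inner \<Omega> (w h) \<phi> + (lam h - lam 0) / h * L2_inner \<Omega> (u 0) \<phi> =
      ((grad_form \<Omega> (A h) (u h) \<phi> + lam h * L2_inner \<Omega> (u h) \<phi>) -
        (grad_form \<Omega> (A 0) (u 0) \<phi> + lam 0 * L2_inner \<Omega> (u 0) \<phi>)) / h"
      using elim(1) by (simp only:) (simp add: divide_simps, simp add: algebra_simps)
    moreover have "grad_form \<Omega> (A h) (u h) \<phi> + lam h * L2_inner \<Omega> (u h) \<phi> = 0"
      "grad_form \<Omega> (A 0) (u 0) \<phi> + lam 0 * L2_inner \<Omega> (u 0) \<phi> = 0"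
      using elim(4) eq0 by linarith+
    ultimately show ?case
      by simp
  qed
  ultimately have "((\<lambda>h. 0) \<longlongrightarrow> grad_form \<Omega> (A 0) v \<phi> + grad_form \<Omega> A' (u 0) \<phi> +
      lam 0 * L2_inner \<Omega> v \<phi> + lam' * L2_inner \<Omega> (u 0) \<phi>) (at (0::real))"
    by (rule Lim_transform_eventually)
  then show ?thesis
    by (simp add: tendsto_const_iff)
qed

end

text \<open>Simplicity makes \<open>z = c w\<close> and \<open>u = d w\<close> multiples of one
  eigenfunction \<open>w\<close>, which need not be \<open>u\<close>. Then \<open>d z = c u\<close>,
  and pairing with \<open>u\<close> gives \<open>c = 0\<close>.\<close>

lemma eigenvector_orthogonal_eq_0:
  assumes simple: "algebraically_simple \<Omega> H A lam" and H: "H \<subseteq> L2 \<Omega>"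
    and u: "eigenpair \<Omega> H A lam u" and "L2_inner \<Omega> u u \<noteq> 0"
    and z: "z \<in> H" "\<And>\<phi>. \<phi> \<in> H \<Longrightarrow> - grad_form \<Omega> A z \<phi> = lam * L2_inner \<Omega> z \<phi>"
    and orth: "L2_inner \<Omega> z u = 0"
  shows "AE x in lebesgue_on \<Omega>. z x = 0"
proof -
  \<comment> \<open>For a weak eigenfunction the operator gives \<open>lam * y\<close>, so the
    difference in \<open>gen_eigenspace\<close> is the zero function, an element of the space of
    index 0.\<close>
  have gen: "y \<in> gen_eigenspace \<Omega> H A lam (Suc 0)"
    if "y \<in> H" "\<And>\<phi>. \<phi> \<in> H \<Longrightarrow> - grad_form \<Omega> A y \<phi> = lam * L2_inner \<Omega> y \<phi>" for y
  proof -
    have "weak_operator \<Omega> H A y (\<lambda>x. lam * y x)"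
      using that H L2_scaleR[of y \<Omega> lam] by (auto simp: weak_operator_def L2_inner_def mult.assoc)
    moreover have "(\<lambda>x. 0) \<in> L2 \<Omega>"
      by (simp add: L2_def)
    ultimately show ?thesis
      by (auto intro!: exI[of _ "\<lambda>x. lam * y x"])
  qed
  have uH: "u \<in> H" and ueq: "\<And>\<phi>. \<phi> \<in> H \<Longrightarrow> - grad_form \<Omega> A u \<phi> = lam * L2_inner \<Omega> u \<phi>"
    using u by (auto simp: eigenpair_def)
  obtain w c d where zw: "AE x in lebesgue_on \<Omega>. z x = c * w x" and uw: "AE x in lebesgue_on \<Omega>. u x = d * w x"
    using simple gen[OF z] gen[OF uH ueq] unfolding algebraically_simple_def by blast
  have [measurable]: "u \<in> borel_measurable (lebesgue_on \<Omega>)" "z \<in> borel_measurable (lebesgue_on \<Omega>)"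
    using H uH z(1) L2_measurable by blast+
  have "d * L2_inner \<Omega> z u = c * L2_inner \<Omega> u u"
  proof -
    have "(LINT x|lebesgue_on \<Omega>. d * (z x * u x)) = (LINT x|lebesgue_on \<Omega>. c * (u x * u x))"
    proof (rule integral_cong_AE)
      show "AE x in lebesgue_on \<Omega>. d * (z x * u x) = c * (u x * u x)"
        using zw uw by eventually_elim (simp add: algebra_simps)
    qed auto
    then show ?thesis
      by (simp add: L2_inner_def)
  qed
  then have "c = 0"
    using orth assms(4) by simp
  then show ?thesis
    using zw by simp
qed

theorem theorem3:
  fixes \<Omega> :: "(real^'n) set"
    and T T' :: "real \<Rightarrow> real^'n \<Rightarrow> real^'n"
    and H :: "(real^'n \<Rightarrow> real) set"
    and lam :: "real \<Rightarrow> real" and u :: "real \<Rightarrow> real^'n \<Rightarrow> real"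
    and lamdot :: real and udot :: "real^'n \<Rightarrow> real"
    and \<epsilon>0 :: real
  assumes "\<epsilon>0 > 0"
    and "smooth_compact_domain \<Omega>"
    and "\<And>\<epsilon>. \<epsilon> \<in> {-\<epsilon>0<..<\<epsilon>0} \<Longrightarrow> C2_diffeo_onto_image \<Omega> (T \<epsilon>)"
    and "\<And>\<epsilon>. \<epsilon> \<in> {-\<epsilon>0<..<\<epsilon>0} \<Longrightarrow> volume_preserving_on \<Omega> (T \<epsilon>)"
    and "C1_family_in_C2 \<epsilon>0 \<Omega> T T'"
    and "H = H1 \<Omega> \<or> H = H1_0 \<Omega>"
    and "\<And>\<epsilon> \<mu> w. \<epsilon> \<in> {-\<epsilon>0<..<\<epsilon>0} \<Longrightarrow> eigenpair \<Omega> H (dyn_matrix \<Omega> (T \<epsilon>)) \<mu> w \<Longrightarrow>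
           algebraically_simple \<Omega> H (dyn_matrix \<Omega> (T \<epsilon>)) \<mu>"
    and "algebraically_simple \<Omega> H (dyn_matrix \<Omega> (T 0)) (lam 0)"
    and "\<And>\<epsilon>. \<epsilon> \<in> {-\<epsilon>0<..<\<epsilon>0} \<Longrightarrow> eigenpair \<Omega> H (dyn_matrix \<Omega> (T \<epsilon>)) (lam \<epsilon>) (u \<epsilon>)"
    and "\<And>\<epsilon>. \<epsilon> \<in> {-\<epsilon>0<..<\<epsilon>0} \<Longrightarrow> L2_norm \<Omega> (u \<epsilon>) = 1"
    and "udot \<in> orth_in \<Omega> H (u 0)"
    and "((\<lambda>\<epsilon>. H1_norm \<Omega> (\<lambda>x. (u \<epsilon> x - u 0 x) / \<epsilon> - udot x)) \<longlongrightarrow> 0) (at 0)"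
    and "((\<lambda>\<epsilon>. \<bar>(lam \<epsilon> - lam 0) / \<epsilon> - lamdot\<bar>) \<longlongrightarrow> 0) (at 0)"
  shows "response_equations \<Omega> H (dyn_matrix \<Omega> (T 0)) (dyn_matrix_dot \<Omega> (T 0) (T' 0))
           (lam 0) (u 0) udot lamdot \<and>
    (\<forall>v\<in>orth_in \<Omega> H (u 0). \<forall>\<mu>.
       response_equations \<Omega> H (dyn_matrix \<Omega> (T 0)) (dyn_matrix_dot \<Omega> (T 0) (T' 0))
         (lam 0) (u 0) v \<mu> \<longrightarrow>
       (AE x in lebesgue_on \<Omega>. v x = udot x) \<and> \<mu> = lamdot)"
proof -
  note \<Omega> = assms(2)
  let ?A = "dyn_matrix \<Omega> (T 0)" and ?A' = "dyn_matrix_dot \<Omega> (T 0) (T' 0)"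
  let ?I = "{-\<epsilon>0<..<\<epsilon>0}"
  have in0: "0 \<in> ?I"
    using \<open>\<epsilon>0 > 0\<close> by simp
  have near0: "\<forall>\<^sub>F h in at 0. h \<in> ?I"
    using eventually_at_in_open'[OF open_greaterThanLessThan in0] .
  have HH1: "H \<subseteq> H1 \<Omega>"
    using assms(6) by (auto simp: H1_0_def)
  have Hlin: "(\<lambda>x. a * f x + b * g x) \<in> H" if "f \<in> H" "g \<in> H" for a b f g
    using assms(6) H1_lincomb(1)[OF \<Omega>] H1_0_lincomb[OF \<Omega>] that by blast
  have contA: "continuous_on \<Omega> (dyn_matrix \<Omega> (T h))" if "h \<in> ?I" for h
    using continuous_on_dyn_matrix[OF \<Omega> assms(3)[OF that]] .
  have "Ck_on 2 (T' 0) \<Omega>"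
    using assms(5) in0 by (auto simp: C1_family_in_C2_def)
  then have contA': "continuous_on \<Omega> ?A'"
    by (rule continuous_on_dyn_matrix_dot[OF \<Omega> assms(3)[OF in0]])
  have uH: "u h \<in> H" if "h \<in> ?I" for h
    using assms(9)[OF that] by (simp add: eigenpair_def)
  have eig: "- grad_form \<Omega> (dyn_matrix \<Omega> (T h)) (u h) \<phi> = lam h * L2_inner \<Omega> (u h) \<phi>"
    if "h \<in> ?I" "\<phi> \<in> H" for h \<phi>
    using assms(9)[OF that(1)] that(2) by (simp add: eigenpair_def)
  have norm1: "L2_inner \<Omega> (u 0) (u 0) = 1"
    using assms(10)[OF in0] by (simp add: L2_norm_def)
  have udot: "udot \<in> H" "L2_inner \<Omega> udot (u 0) = 0"
    using assms(11) by (auto simp: orth_in_def)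
  have sym: "grad_form \<Omega> ?A f g = grad_form \<Omega> ?A g f" for f g
    using transpose_dyn_matrix[OF \<Omega> assms(3)[OF in0]] by (intro grad_form_commute[OF \<Omega>])
  have dlam: "((\<lambda>h. (lam h - lam 0) / h) \<longlongrightarrow> lamdot) (at 0)"
    using assms(13) by (simp add: LIM_zero_iff tendsto_rabs_zero_iff)
  have key: "grad_form \<Omega> ?A udot \<phi> + grad_form \<Omega> ?A' (u 0) \<phi> +
      lam 0 * L2_inner \<Omega> udot \<phi> + lamdot * L2_inner \<Omega> (u 0) \<phi> = 0" if \<phi>: "\<phi> \<in> H" for \<phi>
  proof (rule derivative_of_weak_eigenvalue_equation[OF \<Omega>, where A="\<lambda>h. dyn_matrix \<Omega> (T h)" and u=u and lam=lam])
    show "uniform_limit \<Omega> (\<lambda>h x. (1 / h) *\<^sub>R (dyn_matrix \<Omega> (T h) x - ?A x)) ?A' (at 0)"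
      by (rule uniform_limit_quotient_dyn_matrix[OF \<Omega> assms(1,5,3)])
    show "\<forall>\<^sub>F h in at 0. continuous_on \<Omega> (dyn_matrix \<Omega> (T h))"
      using near0 by eventually_elim (rule contA)
    show "\<forall>\<^sub>F h in at 0. u h \<in> H1 \<Omega>"
      using near0 by eventually_elim (use uH HH1 in blast)
    show "\<forall>\<^sub>F h in at 0. - grad_form \<Omega> (dyn_matrix \<Omega> (T h)) (u h) \<phi> = lam h * L2_inner \<Omega> (u h) \<phi>"
      using near0 by eventually_elim (rule eig[OF _ \<phi>])
  qed (use contA[OF in0] contA' uH[OF in0] udot(1) \<phi> HH1 eig[OF in0] assms(12) dlam in auto)
  \<comment> \<open>By symmetry this is the eigenvalue equation of \<open>u 0\<close> tested with
    \<open>udot\<close>, whose right-hand side vanishes by orthogonality.\<close>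
  have "grad_form \<Omega> ?A udot (u 0) = 0"
    using eig[OF in0 udot(1)] udot(2) by (simp add: sym[of udot] L2_inner_commute[of \<Omega> "u 0"])
  then have lamdot: "lamdot = - grad_form \<Omega> ?A' (u 0) (u 0)"
    using key[OF uH[OF in0]] udot(2) norm1 by simp
  have resp: "response_equations \<Omega> H ?A ?A' (lam 0) (u 0) udot lamdot"
    unfolding response_equations_def
  proof (intro conjI ballI)
    show "lamdot = - grad_form \<Omega> ?A' (u 0) (u 0) / (L2_norm \<Omega> (u 0))\<^sup>2"
      using lamdot assms(10)[OF in0] by simp
    fix \<phi> assume "\<phi> \<in> orth_in \<Omega> H (u 0)"
    then show "grad_form \<Omega> ?A udot \<phi> + lam 0 * L2_inner \<Omega> udot \<phi> =
        - (grad_form \<Omega> ?A' (u 0) \<phi> + lamdot * L2_inner \<Omega> (u 0) \<phi>)"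
      using key[of \<phi>] by (simp add: orth_in_def)
  qed
  have unique: "(AE x in lebesgue_on \<Omega>. v x = udot x) \<and> \<mu> = lamdot"
    if v: "v \<in> orth_in \<Omega> H (u 0)" and "response_equations \<Omega> H ?A ?A' (lam 0) (u 0) v \<mu>" for v \<mu>
  proof
    \<comment> \<open>The second response equation determines \<open>\<mu>\<close> without reference
      to \<open>v\<close>.\<close>
    show \<mu>: "\<mu> = lamdot"
      using that(2) resp by (simp add: response_equations_def)
    \<comment> \<open>The explicit coefficients match the lemmas on linear combinations.\<close>
    define z where "z x = 1 * v x + (-1) * udot x" for x
    have vH: "v \<in> H" "L2_inner \<Omega> v (u 0) = 0"
      using v by (auto simp: orth_in_def)
    have zH: "z \<in> H"
      unfolding z_def using vH(1) udot(1) by (rule Hlin)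
    have L2: "f \<in> L2 \<Omega>" if "f \<in> H" for f
      using that HH1 H1_imp_L2 by blast
    have z_inner: "L2_inner \<Omega> z \<phi> = L2_inner \<Omega> v \<phi> - L2_inner \<Omega> udot \<phi>" if "\<phi> \<in> H" for \<phi>
      unfolding z_def using L2_inner_lincomb_left[OF L2[OF vH(1)] L2[OF udot(1)] L2[OF that], of 1 "-1"] by simp
    have z_form: "grad_form \<Omega> ?A z \<phi> = grad_form \<Omega> ?A v \<phi> - grad_form \<Omega> ?A udot \<phi>" if "\<phi> \<in> H" for \<phi>
      unfolding z_def
      using grad_form_lincomb_left[OF \<Omega> contA[OF in0], of v udot \<phi> 1 "-1"] vH(1) udot(1) that HH1 by auto
    have z_orth: "L2_inner \<Omega> z (u 0) = 0"
      using z_inner[OF uH[OF in0]] vH(2) udot(2) by simp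
    \<comment> \<open>As \<open>\<mu> = lamdot\<close>, both solutions have the same right-hand
      side, so their difference solves the homogeneous equation.\<close>
    have z_eq0: "grad_form \<Omega> ?A z \<phi> + lam 0 * L2_inner \<Omega> z \<phi> = 0" if "\<phi> \<in> orth_in \<Omega> H (u 0)" for \<phi>
    proof -
      have "grad_form \<Omega> ?A v \<phi> + lam 0 * L2_inner \<Omega> v \<phi> = grad_form \<Omega> ?A udot \<phi> + lam 0 * L2_inner \<Omega> udot \<phi>"
        using \<open>response_equations \<Omega> H ?A ?A' (lam 0) (u 0) v \<mu>\<close> resp \<mu> that
        unfolding response_equations_def by metis
      moreover have "\<phi> \<in> H"
        using that by (simp add: orth_in_def)
      ultimately show ?thesis
        using z_form[of \<phi>] z_inner[of \<phi>] by (simp add: right_diff_distrib)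
    qed
    have z_u0: "grad_form \<Omega> ?A z (u 0) = 0"
      using eig[OF in0 zH] z_orth by (simp add: sym[of z] L2_inner_commute[of \<Omega> "u 0"])
    have z_eig: "- grad_form \<Omega> ?A z \<phi> = lam 0 * L2_inner \<Omega> z \<phi>" if \<phi>: "\<phi> \<in> H" for \<phi>
    proof -
      \<comment> \<open>Since \<open>u 0\<close> has norm 1, \<open>c\<close> is the coefficient of
        the projection of \<open>\<phi>\<close> onto \<open>u 0\<close>. Removing it changes neither
        the form nor the inner product with \<open>z\<close>, because both vanish on the pair of
        \<open>z\<close> and \<open>u 0\<close>.\<close>
      define c where "c = L2_inner \<Omega> \<phi> (u 0)"
      define \<psi> where "\<psi> x = 1 * \<phi> x + (- c) * u 0 x" for x
      have "\<psi> \<in> H"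
        unfolding \<psi>_def using \<phi> uH[OF in0] by (rule Hlin)
      moreover have "L2_inner \<Omega> \<psi> (u 0) = 0"
        unfolding \<psi>_def using L2_inner_lincomb_left[OF L2[OF \<phi>] L2[OF uH[OF in0]] L2[OF uH[OF in0]], of 1 "-c"]
        by (simp add: c_def norm1)
      ultimately have "grad_form \<Omega> ?A z \<psi> + lam 0 * L2_inner \<Omega> z \<psi> = 0"
        by (intro z_eq0) (simp add: orth_in_def)
      moreover have "grad_form \<Omega> ?A z \<psi> = grad_form \<Omega> ?A z \<phi>"
        unfolding \<psi>_def using grad_form_lincomb_right[OF \<Omega> contA[OF in0], of \<phi> "u 0" z 1 "-c"]
          \<phi> uH[OF in0] zH HH1 z_u0 by auto
      moreover have "L2_inner \<Omega> z \<psi> = L2_inner \<Omega> z \<phi>"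
        unfolding \<psi>_def using L2_inner_lincomb_right[OF L2[OF \<phi>] L2[OF uH[OF in0]] L2[OF zH], of 1 "-c"] z_orth
        by simp
      ultimately show ?thesis
        by simp
    qed
    have "AE x in lebesgue_on \<Omega>. z x = 0"
      using norm1 HH1 H1_imp_L2
      by (intro eigenvector_orthogonal_eq_0[OF assms(8) _ assms(9)[OF in0] _ zH z_eig z_orth]) auto
    then show "AE x in lebesgue_on \<Omega>. v x = udot x"
      by eventually_elim (simp add: z_def)
  qed
  show ?thesis
    using resp unique by blast
qed

end
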